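(* (Lower bound.) Let $p\ge 1$ be a real number, let $k\ge 4$ be an integer, and let $0<\theta\le 1$. Suppose that $\mathcal{M}\subseteq S^{k-1}$ is a $(1/\sqrt{k})$-dense subset of $S^{k-1}$ with respect to the Euclidean metric. For every $D\ge 1$ and $m\in\mathbb{N}$, if the metric space $(\mathcal{M},\|x-y\|_2^\theta)$ embeds with distortion $D$ into $\ell_p^m$, then $$m\ge \frac{1}{(4D)^p}\left(\frac{k}{2p\theta\log k+8}\right)^{\frac{p\theta}{2}}.$$ (Upper bound.) Conversely, there is a universal constant $C\ge 1$, and for every real $p\ge 1$ there is a constant $C_p>0$ depending only on $p$, such that for every integer $k\ge 4$ and every $0<\theta\le 1$ the metric space $(\mathbb{R}^k,\|x-y\|_2^\theta)$ embeds with distortion $C$ into $\ell_p^m$ for some integer $m$ satisfying $$1\le m\le C_p\left(\frac{k}{\theta}\right)^{\max\{1,\,p\theta/2\}}.$$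
   Context: A metric space $(\mathcal{M},d_{\mathcal{M}})$ embeds with distortion $D\ge 1$ into a metric space $(\mathcal{N},d_{\mathcal{N}})$ if there are $f:\mathcal{M}\to\mathcal{N}$ and $s>0$ such that $s\,d_{\mathcal{M}}(x,y)\le d_{\mathcal{N}}(f(x),f(y))\le Ds\,d_{\mathcal{M}}(x,y)$ for all $x,y\in\mathcal{M}$. For $x\in\mathbb{R}^n$, $\|x\|_p=(|x_1|^p+\cdots+|x_n|^p)^{1/p}$, and $\ell_p^n$ is $(\mathbb{R}^n,\|\cdot\|_p)$. $S^{k-1}=\{x\in\mathbb{R}^k:\|x\|_2=1\}$. A subset $\mathcal{C}$ of a metric space $(\mathcal{M},d_{\mathcal{M}})$ is $\varepsilon$-dense if for every $x\in\mathcal{M}$ there is $y\in\mathcal{C}$ with $d_{\mathcal{M}}(x,y)\le\varepsilon$. $\log$ is the natural logarithm. *)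

theory Defs
  imports "HOL-Analysis.Analysis"
begin

text \<open>
  Metric spaces are given by a carrier and a distance function, as in the locale
  \<^locale>\<open>Metric_space\<close>. Since dimensions are quantified inside the main statement,
  vectors of length \<open>n\<close> are functions on \<^typ>\<open>nat\<close> that vanish from \<open>n\<close> on, which is
  the convention of \<^const>\<open>Euclidean_space\<close>; the coordinates are indexed from 0.
\<close>

definition Rn :: "nat \<Rightarrow> (nat \<Rightarrow> real) set" where
  "Rn n = {x. \<forall>i\<ge>n. x i = 0}"

definition lp_norm :: "real \<Rightarrow> nat \<Rightarrow> (nat \<Rightarrow> real) \<Rightarrow> real" where
  "lp_norm p n x = (\<Sum>i<n. \<bar>x i\<bar> powr p) powr (1 / p)"

definition lp_dist :: "real \<Rightarrow> nat \<Rightarrow> (nat \<Rightarrow> real) \<Rightarrow> (nat \<Rightarrow> real) \<Rightarrow> real" where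
  "lp_dist p n x y = lp_norm p n (\<lambda>i. x i - y i)"

text \<open>The snowflake metric; note that \<open>0 powr \<theta> = 0\<close>.\<close>

definition snowflake_dist :: "real \<Rightarrow> nat \<Rightarrow> (nat \<Rightarrow> real) \<Rightarrow> (nat \<Rightarrow> real) \<Rightarrow> real" where
  "snowflake_dist \<theta> n x y = lp_dist 2 n x y powr \<theta>"

text \<open>The parameter is the dimension \<open>k\<close> of the ambient space, so this is the sphere usually
  denoted by a superscript \<open>k - 1\<close>.\<close>

definition unit_sphere :: "nat \<Rightarrow> (nat \<Rightarrow> real) set" where
  "unit_sphere k = {x \<in> Rn k. lp_norm 2 k x = 1}"

definition eps_dense :: "real \<Rightarrow> 'a set \<Rightarrow> 'a set \<Rightarrow> ('a \<Rightarrow> 'a \<Rightarrow> real) \<Rightarrow> bool" where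
  "eps_dense \<epsilon> C M d \<longleftrightarrow> C \<subseteq> M \<and> (\<forall>x\<in>M. \<exists>y\<in>C. d x y \<le> \<epsilon>)"

definition embeds_with_distortion ::
  "real \<Rightarrow> 'a set \<Rightarrow> ('a \<Rightarrow> 'a \<Rightarrow> real) \<Rightarrow> 'b set \<Rightarrow> ('b \<Rightarrow> 'b \<Rightarrow> real) \<Rightarrow> bool" where
  "embeds_with_distortion D M dM N dN \<longleftrightarrow>
     (\<exists>f s. f \<in> M \<rightarrow> N \<and> s > 0 \<and>
        (\<forall>x\<in>M. \<forall>y\<in>M. s * dM x y \<le> dN (f x) (f y) \<and> dN (f x) (f y) \<le> D * s * dM x y))"

end

theory Submission
  imports Defs "HOL-Probability.Probability"
begin

text \<open>
  Lower bound. Every coordinate of the embedding is a \<open>\<theta>\<close>-Hoelder function on the dense subset of the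
  sphere. On the high dimensional sphere such a function is nearly constant: outside a set of
  measure of order \<open>k powr (- p * \<theta> / 2)\<close> it differs from its median by at most a constant times
  \<open>T powr \<theta>\<close>, where \<open>T\<^sup>2 = (2 * p * \<theta> * ln k + 8) / k\<close>. Hence each coordinate of the difference between
  the images of \<open>x\<close> and of \<open>- x\<close> has a \<open>p\<close>-th moment of order \<open>T powr (p * \<theta>)\<close>, whereas the distance
  of the two images is bounded below because \<open>x\<close> and \<open>- x\<close> are far apart. Adding up the moments of the
  \<open>m\<close> coordinates forces \<open>m\<close> to be of order \<open>T powr (- p * \<theta>)\<close>. A uniform point of the sphere is
  obtained as the direction of a Gaussian vector, and concentration follows from the
  Prekopa-Leindler inequality: if the directions of all points of two sets are at least \<open>T\<close> apart,
  the midpoints of the sets are so short that the product of the two Gaussian measures is at most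
  \<open>(1 - T\<^sup>2 / 4) ^ k\<close> (\<open>gaussP_two_sets\<close>, \<open>cone_separation\<close>, \<open>dimension_lower_bound\<close>).

  Upper bound. The \<open>p\<close>-th power of the snowflake distance is \<open>|x - y| powr (p * \<theta>)\<close>. This suggests to
  compose two maps. The first is linear: for a Gaussian random matrix \<open>G\<close> with sufficiently many rows,
  the sum of \<open>|(G v) i| powr (p * \<theta>)\<close> over the rows is comparable with \<open>|v| powr (p * \<theta>)\<close> for all \<open>v\<close>
  at once (\<open>euclidean_embedding\<close>). For \<open>q = p * \<theta> > 2\<close> this is Dvoretzky's theorem for the \<open>q\<close>-norm,
  which takes of order \<open>k powr (q / 2)\<close> rows; for \<open>q \<le> 2\<close> it follows from the same theorem for the
  1-norm and the 2-norm, which takes of order \<open>k\<close> rows. The second map sends every coordinate into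
  \<open>n = O(1 / \<theta>)\<close> coordinates by a map \<open>\<Psi>\<close> of the line for which the sum of
  \<open>|\<Psi> r a - \<Psi> r b| powr p\<close> over \<open>r < n\<close> is comparable with \<open>|a - b| powr (p * \<theta>)\<close>
  (\<open>snowflake_line\<close>). Together this needs \<open>m * n\<close> coordinates. All comparisons lose at most a
  universal constant to the power \<open>p\<close>, so that the distortion, a \<open>p\<close>-th root, is universal.

  The map of the line is a sum over scales \<open>R\<close> in a geometric progression, whose terms are
  \<open>R powr \<theta>\<close> times a bounded zigzag of wavelength \<open>R\<close>. If the ratio of the progression is large, a
  single scale dominates the difference of the values at two points. A bounded number of shifted
  progressions, each with its own coordinates, makes sure that one of them has a suitable scale. For
  \<open>\<theta> \<ge> 1 / 2\<close> the dominating zigzag is linear between the two points. For small \<open>\<theta>\<close> the ratio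
  must be exponential in \<open>1 / \<theta>\<close>, and one zigzag cannot separate all points at distances between two
  consecutive scales; instead the signs of the teeth are taken from an error-correcting code of length
  \<open>O(1 / \<theta>)\<close>, and a fixed fraction of the coordinates separates any two points.
\<close>

section \<open>The Prekopa-Leindler inequality\<close>

text \<open>Brunn-Minkowski is immediate for sets that have a maximum and a minimum. This lemma and the next
  one reduce the general case to it: cutting at suitable points of the set loses as little
  measure as desired.\<close>

lemma emeasure_initial_segment_approx:
  fixes A :: "real set"
  assumes A: "A \<in> sets borel" "c < emeasure lborel A"
  shows "\<exists>a\<in>A. c < emeasure lborel (A \<inter> {..a})"
proof -
  have "A \<noteq> {}" using A by auto
  \<comment> \<open>A countable cofinal subset: the maximum if there is one, otherwise any countable dense subset.\<close>
  obtain D where D: "countable D" "D \<subseteq> A" "\<And>x. x \<in> A \<Longrightarrow> \<exists>d\<in>D. x \<le> d"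
  proof (cases "\<exists>m\<in>A. \<forall>x\<in>A. x \<le> m")
    case True
    then obtain m where "m \<in> A" "\<forall>x\<in>A. x \<le> m" by auto
    then show ?thesis using that[of "{m}"] by auto
  next
    case False
    obtain D where D: "countable D" "D \<subseteq> A" "A \<subseteq> closure D" using separable by blast
    have "\<exists>d\<in>D. x \<le> d" if x: "x \<in> A" for x
    proof -
      obtain y where y: "y \<in> A" "y > x" using False x by (meson not_le)
      then have "y \<in> closure D" "y \<in> {x<..}" using D by auto
      then have "{x<..} \<inter> D \<noteq> {}"
        using open_Int_closure_eq_empty[OF open_greaterThan, of x D] by (metis disjoint_iff)
      then show ?thesis by (auto intro: less_imp_le)
    qed
    then show ?thesis using that D by auto
  qed
  have Dne: "D \<noteq> {}" using D(3) \<open>A \<noteq> {}\<close> by auto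
  define b where "b n = Max (from_nat_into D ` {..n})" for n
  have bD: "b n \<in> D" for n
  proof -
    have "b n \<in> from_nat_into D ` {..n}" unfolding b_def by (rule Max_in) auto
    then show ?thesis using from_nat_into[OF Dne] by auto
  qed
  have bmono: "b n \<le> b (Suc n)" for n unfolding b_def by (rule Max_mono) auto
  have "incseq b" using bmono by (rule incseq_SucI)
  then have inc: "incseq (\<lambda>n. A \<inter> {..b n})" by (fastforce simp: incseq_def intro: order_trans)
  have U: "(\<Union>n. A \<inter> {..b n}) = A"
  proof -
    have "\<exists>n. x \<le> b n" if x: "x \<in> A" for x
    proof -
      obtain d where d: "d \<in> D" "x \<le> d" using D(3) x by blast
      then obtain n where "from_nat_into D n = d" using D(1) by (metis from_nat_into_surj)
      then have "d \<le> b n" unfolding b_def by (intro Max_ge) auto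
      then show ?thesis using d by (blast intro: order_trans)
    qed
    then show ?thesis by auto
  qed
  have "(SUP n. emeasure lborel (A \<inter> {..b n})) = emeasure lborel (\<Union>n. A \<inter> {..b n})"
  proof (rule SUP_emeasure_incseq[OF _ inc])
    show "range (\<lambda>n. A \<inter> {..b n}) \<subseteq> sets lborel" using A(1) by auto
  qed
  then have "c < (SUP n. emeasure lborel (A \<inter> {..b n}))" using A(2) unfolding U by simp
  then obtain n where "c < emeasure lborel (A \<inter> {..b n})" by (auto simp: less_SUP_iff)
  then show ?thesis using bD D(2) by blast
qed

lemma emeasure_final_segment_approx:
  fixes B :: "real set"
  assumes B: "B \<in> sets borel" "c < emeasure lborel B"
  shows "\<exists>b\<in>B. c < emeasure lborel (B \<inter> {b..})"
proof -
  have refl: "emeasure lborel (uminus -` S) = emeasure lborel S" if [measurable]: "S \<in> sets borel" for S :: "real set"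
  proof -
    have "emeasure lborel S = emeasure (distr lborel borel uminus) S"
      using lborel_distr_uminus by simp
    also have "\<dots> = emeasure lborel (uminus -` S)" by (subst emeasure_distr) auto
    finally show ?thesis by simp
  qed
  have m[measurable]: "uminus -` B \<in> sets borel"
    using measurable_sets[of "uminus :: real \<Rightarrow> real" borel borel B] B(1) by simp
  obtain a where a: "a \<in> uminus -` B" "c < emeasure lborel (uminus -` B \<inter> {..a})"
    using emeasure_initial_segment_approx[OF m] B refl[OF B(1)] by auto
  have "uminus -` B \<inter> {..a} = uminus -` (B \<inter> {-a..})" by auto
  then have "c < emeasure lborel (B \<inter> {-a..})" using a refl[of "B \<inter> {-a..}"] B(1) by simp
  then show ?thesis using a by auto
qed

lemma emeasure_midpoint_preimage:
  fixes S :: "real set" and t :: real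
  assumes [measurable]: "S \<in> sets borel"
  shows "emeasure lborel ((\<lambda>x. (t + x) / 2) -` S) = 2 * emeasure lborel S"
proof -
  have m[measurable]: "(\<lambda>x. (t + x) / 2) -` S \<in> sets borel"
    using measurable_sets[of "\<lambda>x. (t + x) / 2" borel borel S] assms by simp
  have "emeasure lborel S = (\<integral>\<^sup>+x. indicator S x \<partial>lborel)" by simp
  also have "\<dots> = \<bar>1/2::real\<bar> * (\<integral>\<^sup>+x. indicator S (t/2 + 1/2 * x) \<partial>lborel)"
    by (rule nn_integral_real_affine) auto
  also have "(\<lambda>x. indicator S (t/2 + 1/2 * x) :: ennreal) = indicator ((\<lambda>x. (t + x) / 2) -` S)"
    by (auto simp: indicator_def fun_eq_iff add_divide_distrib)
  also have "(\<integral>\<^sup>+x. indicator ((\<lambda>x. (t + x) / 2) -` S) x \<partial>lborel) = emeasure lborel ((\<lambda>x. (t + x) / 2) -` S)"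
    by (rule nn_integral_indicator) auto
  finally have *: "emeasure lborel S = ennreal (1/2) * emeasure lborel ((\<lambda>x. (t + x) / 2) -` S)" by simp
  have "2 * emeasure lborel S = (ennreal 2 * ennreal (1/2)) * emeasure lborel ((\<lambda>x. (t + x) / 2) -` S)"
    unfolding * by (simp add: mult.assoc)
  also have "ennreal 2 * ennreal (1/2) = 1" by (subst ennreal_mult[symmetric]) auto
  finally show ?thesis by simp
qed

text \<open>The first premise covers \<open>x = 0\<close>, where no \<open>c\<close> exists.\<close>

lemma ennreal_add_le_of_approx:
  fixes e x y :: ennreal
  assumes "e \<le> y" "\<And>c. c < x \<Longrightarrow> e + c \<le> y"
  shows "e + x \<le> y"
proof (cases "e = \<top>")
  case True
  then show ?thesis using assms(1) by (simp add: top_unique)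
next
  case False
  have "x \<le> y - e"
  proof (rule dense_le)
    fix c assume "c < x"
    from assms(2)[OF this] have "(e + c) - e \<le> y - e" by (intro ennreal_minus_mono) auto
    then show "c \<le> y - e" using False by (simp add: ennreal_add_diff_cancel_left)
  qed
  then have "e + x \<le> e + (y - e)" by (rule add_left_mono)
  also have "\<dots> = y" using assms(1) by (rule add_diff_inverse_ennreal)
  finally show ?thesis .
qed

text \<open>For \<open>a \<in> A\<close> and \<open>b \<in> B\<close> the midpoints of \<open>b\<close> with the points of \<open>A\<close> up to \<open>a\<close> lie in \<open>C\<close> to the left of
  the midpoint of \<open>a\<close> and \<open>b\<close>, those of \<open>a\<close> with the points of \<open>B\<close> from \<open>b\<close> on lie in \<open>C\<close> to the right of
  it. So two half-size copies fit side by side into \<open>C\<close>.\<close>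

lemma brunn_minkowski_real:
  fixes A B C :: "real set"
  assumes meas: "A \<in> sets borel" "B \<in> sets borel" "C \<in> sets borel"
    and ne: "A \<noteq> {}" "B \<noteq> {}"
    and mid: "\<And>a b. a \<in> A \<Longrightarrow> b \<in> B \<Longrightarrow> (a + b) / 2 \<in> C"
  shows "emeasure lborel A + emeasure lborel B \<le> 2 * emeasure lborel C"
proof -
  note meas[measurable]
  have seg: "emeasure lborel (A \<inter> {..a}) + emeasure lborel (B \<inter> {b..}) \<le> 2 * emeasure lborel C"
    if ab: "a \<in> A" "b \<in> B" for a b
  proof -
    let ?z = "(a + b) / 2"
    have *: "emeasure lborel (A \<inter> {..a}) \<le> 2 * emeasure lborel (C \<inter> {..?z})"
    proof -
      have "A \<inter> {..a} \<subseteq> (\<lambda>x. (b + x) / 2) -` (C \<inter> {..?z})" using mid ab by (auto simp: add.commute)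
      moreover have "(\<lambda>x. (b + x) / 2) -` (C \<inter> {..?z}) \<in> sets borel"
        using measurable_sets[of "\<lambda>x. (b + x) / 2" borel borel "C \<inter> {..?z}"] by simp
      ultimately have "emeasure lborel (A \<inter> {..a}) \<le> emeasure lborel ((\<lambda>x. (b + x) / 2) -` (C \<inter> {..?z}))"
        by (intro emeasure_mono) auto
      then show ?thesis by (subst (asm) emeasure_midpoint_preimage) auto
    qed
    have **: "emeasure lborel (B \<inter> {b..}) \<le> 2 * emeasure lborel (C \<inter> {?z<..})"
    proof -
      have "B \<inter> {b..} - {b} \<subseteq> (\<lambda>x. (a + x) / 2) -` (C \<inter> {?z<..})" using mid ab by auto
      moreover have "(\<lambda>x. (a + x) / 2) -` (C \<inter> {?z<..}) \<in> sets borel"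
        using measurable_sets[of "\<lambda>x. (a + x) / 2" borel borel "C \<inter> {?z<..}"] by simp
      ultimately have "emeasure lborel (B \<inter> {b..} - {b}) \<le> emeasure lborel ((\<lambda>x. (a + x) / 2) -` (C \<inter> {?z<..}))"
        by (intro emeasure_mono) auto
      moreover have "emeasure lborel (B \<inter> {b..} - {b}) = emeasure lborel (B \<inter> {b..})"
        by (intro emeasure_Diff_null_set) (auto simp: null_sets_def)
      ultimately show ?thesis by (subst (asm) emeasure_midpoint_preimage) auto
    qed
    have "emeasure lborel (C \<inter> {..?z}) + emeasure lborel (C \<inter> {?z<..}) = emeasure lborel C"
      by (subst plus_emeasure) (auto intro!: arg_cong[where f="emeasure lborel"])
    then have "2 * emeasure lborel (C \<inter> {..?z}) + 2 * emeasure lborel (C \<inter> {?z<..}) = 2 * emeasure lborel C"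
      by (simp flip: distrib_left)
    then show ?thesis using add_mono[OF * **] by simp
  qed
  obtain a0 b0 where a0: "a0 \<in> A" and b0: "b0 \<in> B" using ne by auto
  have A0: "emeasure lborel (B \<inter> {b..}) + emeasure lborel A \<le> 2 * emeasure lborel C" if b: "b \<in> B" for b
  proof (rule ennreal_add_le_of_approx)
    have "emeasure lborel (B \<inter> {b..}) \<le> emeasure lborel (A \<inter> {..a0}) + emeasure lborel (B \<inter> {b..})"
      by (rule add_increasing) auto
    also note seg[OF a0 b]
    finally show "emeasure lborel (B \<inter> {b..}) \<le> 2 * emeasure lborel C" .
    fix c assume "c < emeasure lborel A"
    then obtain a where a: "a \<in> A" "c < emeasure lborel (A \<inter> {..a})"
      using emeasure_initial_segment_approx[OF meas(1)] by blast
    have "emeasure lborel (B \<inter> {b..}) + c \<le> emeasure lborel (B \<inter> {b..}) + emeasure lborel (A \<inter> {..a})"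
      using a by (intro add_left_mono) auto
    also have "\<dots> \<le> 2 * emeasure lborel C"
      using seg[OF a(1) b] by (subst add.commute)
    finally show "emeasure lborel (B \<inter> {b..}) + c \<le> 2 * emeasure lborel C" .
  qed
  show ?thesis
  proof (rule ennreal_add_le_of_approx)
    have "emeasure lborel A \<le> emeasure lborel (B \<inter> {b0..}) + emeasure lborel A"
      by (rule add_increasing) auto
    also note A0[OF b0]
    finally show "emeasure lborel A \<le> 2 * emeasure lborel C" .
    fix c assume "c < emeasure lborel B"
    then obtain b where b: "b \<in> B" "c < emeasure lborel (B \<inter> {b..})"
      using emeasure_final_segment_approx[OF meas(2)] by blast
    have "emeasure lborel A + c \<le> emeasure lborel A + emeasure lborel (B \<inter> {b..})"
      using b by (intro add_left_mono) auto
    also have "\<dots> \<le> 2 * emeasure lborel C"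
      using A0[OF b(1)] by (subst add.commute)
    finally show "emeasure lborel A + c \<le> 2 * emeasure lborel C" .
  qed
qed

text \<open>The layer cake formula with levels measured relative to the truncation height. In this form the
  levels of functions with different heights are compared at the same parameter \<open>t\<close>.\<close>

lemma nn_integral_min_layer_cake:
  fixes f :: "'a \<Rightarrow> ennreal" and a :: real
  assumes [measurable]: "f \<in> borel_measurable M" and a: "0 < a" and "sigma_finite_measure M"
  shows "(\<integral>\<^sup>+x. min (f x) (ennreal a) \<partial>M)
    = ennreal a * (\<integral>\<^sup>+t. emeasure M {x\<in>space M. ennreal (t * a) < f x} * indicator {0<..<1} t \<partial>lborel)"
proof -
  interpret pair_sigma_finite M lborel
    using assms(3) lborel.sigma_finite_measure_axioms by (simp add: pair_sigma_finite_def)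
  have pt: "min (f x) (ennreal a) = ennreal a * (\<integral>\<^sup>+t. indicator {t\<in>{0<..<1}. ennreal (t * a) < f x} t \<partial>lborel)" for x
  proof (cases "f x < ennreal a")
    case True
    then obtain r where r: "f x = ennreal r" "0 \<le> r" by (cases "f x") auto
    then have ra: "r < a" using True a by (simp add: ennreal_less_iff)
    have r1: "t < 1" if "t * a < r" for t
    proof -
      have "t * a < 1 * a" using that ra by simp
      then show ?thesis using a by (subst (asm) mult_less_cancel_right_pos) auto
    qed
    have "{t\<in>{0<..<1}. ennreal (t * a) < f x} = {0<..<r/a}"
      using r ra a by (auto simp: ennreal_less_iff pos_less_divide_eq intro: r1)
    then show ?thesis using r ra a True by (simp add: min_def ennreal_mult[symmetric])
  next
    case False
    have "ennreal (t * a) < f x" if "0 < t" "t < 1" for t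
    proof -
      have "t * a < a" using that a by simp
      then have "ennreal (t * a) < ennreal a" using that a by (simp add: ennreal_less_iff)
      then show ?thesis using False by (simp add: not_less)
    qed
    then have "{t\<in>{0<..<1}. ennreal (t * a) < f x} = {0<..<1}" by auto
    then show ?thesis using False by (simp add: min_def)
  qed
  have "(\<integral>\<^sup>+x. min (f x) (ennreal a) \<partial>M)
    = ennreal a * (\<integral>\<^sup>+x. (\<integral>\<^sup>+t. indicator {t\<in>{0<..<1}. ennreal (t * a) < f x} t \<partial>lborel) \<partial>M)"
    unfolding pt by (rule nn_integral_cmult) measurable
  also have "(\<integral>\<^sup>+x. (\<integral>\<^sup>+t. indicator {t\<in>{0<..<1}. ennreal (t * a) < f x} t \<partial>lborel) \<partial>M)
     = (\<integral>\<^sup>+t. (\<integral>\<^sup>+x. indicator {t\<in>{0<..<1}. ennreal (t * a) < f x} t \<partial>M) \<partial>lborel)"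
    by (rule Fubini'[symmetric]) measurable
  also have "\<dots> = (\<integral>\<^sup>+t. emeasure M {x\<in>space M. ennreal (t * a) < f x} * indicator {0<..<1} t \<partial>lborel)"
  proof (rule nn_integral_cong)
    fix t :: real
    have "(\<integral>\<^sup>+x. indicator {t\<in>{0<..<1}. ennreal (t * a) < f x} t \<partial>M)
       = (\<integral>\<^sup>+x. indicator {x\<in>space M. ennreal (t * a) < f x} x * indicator {0<..<1} t \<partial>M)"
      by (rule nn_integral_cong) (auto simp: indicator_def)
    also have "\<dots> = emeasure M {x\<in>space M. ennreal (t * a) < f x} * indicator {0<..<1} t"
      by (subst nn_integral_multc) auto
    finally show "(\<integral>\<^sup>+x. indicator {t\<in>{0<..<1}. ennreal (t * a) < f x} t \<partial>M) = \<dots>" .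
  qed
  finally show ?thesis .
qed

lemma ennreal_am_gm: "4 * (x * y) \<le> (x + y)\<^sup>2" for x y :: ennreal
proof (cases x; cases y)
  fix r s :: real assume rs: "0 \<le> r" "x = ennreal r" "0 \<le> s" "y = ennreal s"
  have "4 * (r * s) \<le> (r + s)\<^sup>2" using sum_squares_bound[of r s] by (simp add: power2_sum)
  then have "ennreal (4 * (r * s)) \<le> ennreal ((r + s)\<^sup>2)" by (rule ennreal_leI)
  then show ?thesis using rs by (simp add: ennreal_mult ennreal_power[symmetric])
qed (auto simp: power2_eq_square ennreal_mult_top ennreal_top_mult)

text \<open>If the truncation heights \<open>a\<close>, \<open>b\<close> are attained, all superlevel sets at levels \<open>t * a\<close>, \<open>t * b\<close> with
  \<open>t < 1\<close> are nonempty, and their midpoints belong to the superlevel set of \<open>h\<close> at level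
  \<open>t * sqrt (a * b)\<close>. Brunn-Minkowski and integration over \<open>t\<close> give the arithmetic mean of the
  normalised integrals, which dominates the geometric mean.\<close>

lemma prekopa_leindler_truncated:
  fixes f g h :: "real \<Rightarrow> ennreal" and a b :: real
  assumes [measurable]: "f \<in> borel_measurable borel" "g \<in> borel_measurable borel" "h \<in> borel_measurable borel"
    and mid: "\<And>x y. f x * g y \<le> (h ((x + y) / 2))\<^sup>2"
    and ab: "0 < a" "0 < b" and xa: "ennreal a \<le> f x" and yb: "ennreal b \<le> g y"
  shows "(\<integral>\<^sup>+x. min (f x) (ennreal a) \<partial>lborel) * (\<integral>\<^sup>+x. min (g x) (ennreal b) \<partial>lborel)
    \<le> (\<integral>\<^sup>+x. h x \<partial>lborel)\<^sup>2"
proof -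
  define c where "c = sqrt (a * b)"
  have c: "0 < c" "c\<^sup>2 = a * b" using ab by (auto simp: c_def)
  let ?F = "\<lambda>t. emeasure lborel {x. ennreal (t * a) < f x}"
  let ?G = "\<lambda>t. emeasure lborel {x. ennreal (t * b) < g x}"
  let ?H = "\<lambda>t. emeasure lborel {x. ennreal (t * c) < h x}"
  let ?I = "\<lambda>X. \<integral>\<^sup>+t. X t * indicator {0<..<1::real} t \<partial>lborel"
  have lc: "(\<integral>\<^sup>+x. min (f x) (ennreal a) \<partial>lborel) = ennreal a * ?I ?F"
    "(\<integral>\<^sup>+x. min (g x) (ennreal b) \<partial>lborel) = ennreal b * ?I ?G"
    "(\<integral>\<^sup>+x. min (h x) (ennreal c) \<partial>lborel) = ennreal c * ?I ?H"
    using nn_integral_min_layer_cake[of f lborel a] nn_integral_min_layer_cake[of g lborel b]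
      nn_integral_min_layer_cake[of h lborel c] ab c lborel.sigma_finite_measure_axioms by auto
  have level: "?F t * indicator {0<..<1} t + ?G t * indicator {0<..<1} t \<le> 2 * (?H t * indicator {0<..<1} t)" for t
  proof (cases "t \<in> {0<..<1}")
    case True
    then have t: "0 < t" "t < 1" by auto
    have "?F t + ?G t \<le> 2 * ?H t"
    proof (rule brunn_minkowski_real)
      have "ennreal (t * a) < ennreal a" "ennreal (t * b) < ennreal b" using t ab by (auto simp: ennreal_less_iff)
      then show "{x. ennreal (t * a) < f x} \<noteq> {}" "{x. ennreal (t * b) < g x} \<noteq> {}"
        using xa yb by (auto intro: less_le_trans)
      fix u v assume uv: "u \<in> {x. ennreal (t * a) < f x}" "v \<in> {x. ennreal (t * b) < g x}"
      have "(ennreal (t * c))\<^sup>2 = ennreal (t * a) * ennreal (t * b)"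
        using t ab c by (simp add: ennreal_power ennreal_mult[symmetric] power_mult_distrib power2_eq_square mult_ac)
      also have "\<dots> < f u * g v" 
      proof -
        have "ennreal (t * a) * ennreal (t * b) < f u * ennreal (t * b)"
          using uv t ab by (intro ennreal_mult_strict_right_mono) auto
        also have "\<dots> \<le> f u * g v" using uv by (intro mult_left_mono) auto
        finally show ?thesis .
      qed
      also have "\<dots> \<le> (h ((u + v) / 2))\<^sup>2" by (rule mid)
      finally have "(ennreal (t * c))\<^sup>2 < (h ((u + v) / 2))\<^sup>2" .
      then show "(u + v) / 2 \<in> {x. ennreal (t * c) < h x}"
        by (metis linorder_not_less mem_Collect_eq power_mono zero_le)
    qed auto
    then show ?thesis using True by simp
  qed simp
  have sum: "?I ?F + ?I ?G \<le> 2 * ?I ?H"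
  proof -
    have "?I ?F + ?I ?G = (\<integral>\<^sup>+t. ?F t * indicator {0<..<1} t + ?G t * indicator {0<..<1} t \<partial>lborel)"
      by (rule nn_integral_add[symmetric]) measurable
    also have "\<dots> \<le> (\<integral>\<^sup>+t. 2 * (?H t * indicator {0<..<1} t) \<partial>lborel)"
      by (rule nn_integral_mono) (rule level)
    also have "\<dots> = 2 * ?I ?H" by (rule nn_integral_cmult) measurable
    finally show ?thesis .
  qed
  have four: "?I ?F * ?I ?G \<le> (?I ?H)\<^sup>2"
  proof -
    have "4 * (?I ?F * ?I ?G) \<le> (?I ?F + ?I ?G)\<^sup>2" by (rule ennreal_am_gm)
    also have "\<dots> \<le> (2 * ?I ?H)\<^sup>2" by (rule power_mono[OF sum]) simp
    also have "\<dots> = 4 * (?I ?H)\<^sup>2" by (simp add: power_mult_distrib)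
    finally show ?thesis by (subst (asm) ennreal_mult_le_mult_iff) auto
  qed
  have "(\<integral>\<^sup>+x. min (f x) (ennreal a) \<partial>lborel) * (\<integral>\<^sup>+x. min (g x) (ennreal b) \<partial>lborel)
     = ennreal (a * b) * (?I ?F * ?I ?G)"
    using ab by (simp add: lc ennreal_mult mult_ac)
  also have "\<dots> \<le> ennreal (a * b) * (?I ?H)\<^sup>2" by (rule mult_left_mono[OF four]) simp
  also have "\<dots> = (ennreal c * ?I ?H)\<^sup>2"
    using c by (simp add: power_mult_distrib ennreal_power)
  also have "\<dots> \<le> (\<integral>\<^sup>+x. h x \<partial>lborel)\<^sup>2"
    unfolding lc(3)[symmetric] by (intro power_mono nn_integral_mono) auto
  finally show ?thesis .
qed

text \<open>Monotone convergence along truncation heights that increase to the supremum of \<open>f\<close>.\<close>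

lemma nn_integral_le_of_truncations:
  fixes f :: "'a \<Rightarrow> ennreal"
  assumes [measurable]: "f \<in> borel_measurable M"
    and le: "\<And>a x. 0 < a \<Longrightarrow> ennreal a \<le> f x \<Longrightarrow> (\<integral>\<^sup>+x. min (f x) (ennreal a) \<partial>M) * C \<le> D"
  shows "(\<integral>\<^sup>+x. f x \<partial>M) * C \<le> D"
proof -
  define X where "X = {ennreal a | a. 0 < a \<and> (\<exists>x. ennreal a \<le> f x)}"
  have fX: "f x \<le> Sup X" for x
  proof (rule dense_le)
    fix c assume "c < f x"
    then obtain d where d: "c < d" "d < f x" using dense by blast
    then obtain a where a: "d = ennreal a" "0 \<le> a" by (cases d) auto
    then have "0 < a" using d(1) by (cases "a = 0") auto
    then have "d \<in> X" using a d unfolding X_def by (auto intro: less_imp_le)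
    then show "c \<le> Sup X" using d by (meson Sup_upper less_imp_le order_trans)
  qed
  show ?thesis
  proof (cases "X = {}")
    case True
    then have "f x = 0" for x using fX[of x] by (simp add: bot_ennreal)
    then show ?thesis by simp
  next
    case False
    obtain s :: "nat \<Rightarrow> ennreal" where s: "incseq s" "range s \<subseteq> X" "Sup X = (SUP n. s n)"
      using ennreal_Sup_countable_SUP[OF False] by auto
    have "(\<integral>\<^sup>+x. f x \<partial>M) = (\<integral>\<^sup>+x. (SUP n. min (f x) (s n)) \<partial>M)"
    proof (rule nn_integral_cong)
      fix x
      have "(SUP n. min (f x) (s n)) = min (f x) (SUP n. s n)"
        by (simp add: inf_min[symmetric] inf_SUP)
      then show "f x = (SUP n. min (f x) (s n))" using fX[of x] s(3) by (simp add: min_def)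
    qed
    also have "\<dots> = (SUP n. \<integral>\<^sup>+x. min (f x) (s n) \<partial>M)"
      using s(1) by (intro nn_integral_monotone_convergence_SUP)
        (auto simp: incseq_def le_fun_def intro: min.coboundedI2)
    finally have eq: "(\<integral>\<^sup>+x. f x \<partial>M) * C = (SUP n. (\<integral>\<^sup>+x. min (f x) (s n) \<partial>M) * C)"
      by (simp add: SUP_mult_right_ennreal)
    have "(\<integral>\<^sup>+x. min (f x) (s n) \<partial>M) * C \<le> D" for n
    proof -
      have "s n \<in> X" using s(2) by auto
      then obtain a x where "s n = ennreal a" "0 < a" "ennreal a \<le> f x" by (auto simp: X_def)
      then show ?thesis using le by auto
    qed
    then show ?thesis unfolding eq by (rule SUP_least)
  qed
qed

lemma prekopa_leindler_real:
  fixes f g h :: "real \<Rightarrow> ennreal"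
  assumes [measurable]: "f \<in> borel_measurable borel" "g \<in> borel_measurable borel" "h \<in> borel_measurable borel"
    and mid: "\<And>x y. f x * g y \<le> (h ((x + y) / 2))\<^sup>2"
  shows "(\<integral>\<^sup>+x. f x \<partial>lborel) * (\<integral>\<^sup>+x. g x \<partial>lborel) \<le> (\<integral>\<^sup>+x. h x \<partial>lborel)\<^sup>2"
proof (rule nn_integral_le_of_truncations)
  fix a x assume a: "0 < a" "ennreal a \<le> f x"
  have "(\<integral>\<^sup>+x. g x \<partial>lborel) * (\<integral>\<^sup>+x. min (f x) (ennreal a) \<partial>lborel) \<le> (\<integral>\<^sup>+x. h x \<partial>lborel)\<^sup>2"
  proof (rule nn_integral_le_of_truncations)
    fix b y assume b: "0 < b" "ennreal b \<le> g y"
    show "(\<integral>\<^sup>+x. min (g x) (ennreal b) \<partial>lborel) * (\<integral>\<^sup>+x. min (f x) (ennreal a) \<partial>lborel)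
      \<le> (\<integral>\<^sup>+x. h x \<partial>lborel)\<^sup>2"
      using prekopa_leindler_truncated[OF assms a(1) b(1) a(2) b(2)] by (simp add: mult.commute)
  qed measurable
  then show "(\<integral>\<^sup>+x. min (f x) (ennreal a) \<partial>lborel) * (\<integral>\<^sup>+x. g x \<partial>lborel) \<le> (\<integral>\<^sup>+x. h x \<partial>lborel)\<^sup>2"
    by (simp add: mult.commute)
qed measurable

definition gauss :: "real measure" where
  "gauss = density lborel std_normal_density"

lemma sets_gauss[simp, measurable_cong]: "sets gauss = sets borel"
  by (simp add: gauss_def)

lemma space_gauss[simp]: "space gauss = UNIV"
  by (simp add: gauss_def)

lemma prob_space_gauss: "prob_space gauss"
  unfolding gauss_def by (rule prob_space_normal_density) simp

interpretation gauss: prob_space gauss by (rule prob_space_gauss)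

text \<open>By the parallelogram law, the product of the densities at \<open>x\<close> and \<open>y\<close> is the square of the density at
  the midpoint, up to the factor \<open>exp (- (x - y)\<^sup>2 / 4)\<close>. In this form the inequality tensorises
  without any reference to densities.\<close>

lemma prekopa_leindler_gauss:
  fixes f g h :: "real \<Rightarrow> ennreal"
  assumes [measurable]: "f \<in> borel_measurable borel" "g \<in> borel_measurable borel" "h \<in> borel_measurable borel"
    and mid: "\<And>x y. f x * g y \<le> (h ((x + y) / 2))\<^sup>2 * ennreal (exp ((x - y)\<^sup>2 / 4))"
  shows "(\<integral>\<^sup>+x. f x \<partial>gauss) * (\<integral>\<^sup>+x. g x \<partial>gauss) \<le> (\<integral>\<^sup>+x. h x \<partial>gauss)\<^sup>2"
proof -
  let ?\<phi> = "\<lambda>x. ennreal (std_normal_density x)"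
  have par: "?\<phi> x * ?\<phi> y * ennreal (exp ((x - y)\<^sup>2 / 4)) = (?\<phi> ((x + y) / 2))\<^sup>2" for x y
  proof -
    have "- (x\<^sup>2 / 2) + - (y\<^sup>2 / 2) + (x - y)\<^sup>2 / 4 = 2 * (- (((x + y) / 2)\<^sup>2 / 2))"
      by (simp add: power2_eq_square field_simps)
    then have "exp (- (x\<^sup>2 / 2)) * exp (- (y\<^sup>2 / 2)) * exp ((x - y)\<^sup>2 / 4) = (exp (- (((x + y) / 2)\<^sup>2 / 2)))\<^sup>2"
      by (simp flip: exp_add exp_double)
    then have "std_normal_density x * std_normal_density y * exp ((x - y)\<^sup>2 / 4) = (std_normal_density ((x + y) / 2))\<^sup>2"
      by (simp add: std_normal_density_def power_divide power2_eq_square)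
    then show ?thesis by (simp add: ennreal_mult[symmetric] ennreal_power)
  qed
  have "(\<integral>\<^sup>+x. ?\<phi> x * f x \<partial>lborel) * (\<integral>\<^sup>+x. ?\<phi> x * g x \<partial>lborel) \<le> (\<integral>\<^sup>+x. ?\<phi> x * h x \<partial>lborel)\<^sup>2"
  proof (rule prekopa_leindler_real)
    fix x y
    have "?\<phi> x * f x * (?\<phi> y * g y) = ?\<phi> x * ?\<phi> y * (f x * g y)" by (simp add: mult_ac)
    also have "\<dots> \<le> ?\<phi> x * ?\<phi> y * ((h ((x + y) / 2))\<^sup>2 * ennreal (exp ((x - y)\<^sup>2 / 4)))"
      by (intro mult_left_mono mid) simp
    also have "\<dots> = (?\<phi> x * ?\<phi> y * ennreal (exp ((x - y)\<^sup>2 / 4))) * (h ((x + y) / 2))\<^sup>2" by (simp add: mult_ac)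
    also have "\<dots> = (?\<phi> ((x + y) / 2) * h ((x + y) / 2))\<^sup>2" unfolding par by (simp add: power_mult_distrib)
    finally show "?\<phi> x * f x * (?\<phi> y * g y) \<le> \<dots>" .
  qed measurable
  then show ?thesis unfolding gauss_def by (simp add: nn_integral_density)
qed

text \<open>Induction on the number of coordinates: the integrals over the other coordinates, as functions of
  the new coordinate, satisfy the hypothesis of the one-dimensional inequality.\<close>

lemma prekopa_leindler_gauss_PiM:
  fixes f g h :: "('i \<Rightarrow> real) \<Rightarrow> ennreal"
  assumes "finite I"
    and "f \<in> borel_measurable (PiM I (\<lambda>_. gauss))" "g \<in> borel_measurable (PiM I (\<lambda>_. gauss))"
      "h \<in> borel_measurable (PiM I (\<lambda>_. gauss))"
    and "\<And>x y. x \<in> space (PiM I (\<lambda>_. gauss)) \<Longrightarrow> y \<in> space (PiM I (\<lambda>_. gauss)) \<Longrightarrow>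
       f x * g y \<le> (h (\<lambda>i. (x i + y i) / 2))\<^sup>2 * ennreal (exp ((\<Sum>i\<in>I. (x i - y i)\<^sup>2) / 4))"
  shows "(\<integral>\<^sup>+x. f x \<partial>PiM I (\<lambda>_. gauss)) * (\<integral>\<^sup>+x. g x \<partial>PiM I (\<lambda>_. gauss))
    \<le> (\<integral>\<^sup>+x. h x \<partial>PiM I (\<lambda>_. gauss))\<^sup>2"
  using assms
proof (induction I arbitrary: f g h rule: finite_induct)
  case empty
  interpret product_sigma_finite "\<lambda>_::'i. gauss" by standard
  have u: "(\<lambda>_. undefined) \<in> space (PiM {} (\<lambda>_::'i. gauss))" by (simp add: space_PiM)
  from empty.prems(4)[OF u u]
  show ?case by (simp add: PiM_empty nn_integral_count_space_finite)
next
  case (insert i I)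
  interpret product_sigma_finite "\<lambda>_::'i. gauss" by standard
  note [measurable] = insert.prems(1-3)
  let ?M = "PiM I (\<lambda>_. gauss)"
  have upd: "x \<in> space ?M \<Longrightarrow> x(i := t) \<in> space (PiM (insert i I) (\<lambda>_. gauss))" for x t
    by (auto simp: space_PiM PiE_def extensional_def)
  have m2: "(\<lambda>(x, t). x(i := t)) \<in> measurable (?M \<Otimes>\<^sub>M borel) (PiM (insert i I) (\<lambda>_. gauss))"
    using measurable_add_dim[of i I "\<lambda>_. gauss"] by (simp cong: measurable_cong_sets)
  have m1[measurable]: "(\<lambda>x. x(i := t)) \<in> measurable ?M (PiM (insert i I) (\<lambda>_. gauss))" for t
    using measurable_compose[OF _ m2, of "\<lambda>x. (x, t)" ?M] by simp
  interpret PM: prob_space ?M by (intro prob_space_PiM prob_space_gauss)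
  have marg: "(\<lambda>t. \<integral>\<^sup>+x. u (x(i := t)) \<partial>?M) \<in> borel_measurable borel"
    if u: "u \<in> borel_measurable (PiM (insert i I) (\<lambda>_. gauss))" for u :: "('i \<Rightarrow> real) \<Rightarrow> ennreal"
  proof (rule PM.borel_measurable_nn_integral)
    have "(\<lambda>z. u (case (snd z, fst z) of (x, t) \<Rightarrow> x(i := t))) \<in> borel_measurable (borel \<Otimes>\<^sub>M ?M)"
      by (rule measurable_compose[OF measurable_compose[OF _ m2] u]) measurable
    then show "(\<lambda>(t, x). u (x(i := t))) \<in> borel_measurable (borel \<Otimes>\<^sub>M ?M)"
      by (simp add: case_prod_beta')
  qed
  have "(\<integral>\<^sup>+t. (\<integral>\<^sup>+x. f (x(i := t)) \<partial>?M) \<partial>gauss) * (\<integral>\<^sup>+t. (\<integral>\<^sup>+x. g (x(i := t)) \<partial>?M) \<partial>gauss)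
    \<le> (\<integral>\<^sup>+t. (\<integral>\<^sup>+x. h (x(i := t)) \<partial>?M) \<partial>gauss)\<^sup>2"
  proof (rule prekopa_leindler_gauss)
    fix s t :: real
    \<comment> \<open>The factor is absorbed into \<open>h\<close>, which enters squared; hence 8 instead of 4.\<close>
    let ?e = "exp ((s - t)\<^sup>2 / 8)"
    have "(\<integral>\<^sup>+x. f (x(i := s)) \<partial>?M) * (\<integral>\<^sup>+x. g (x(i := t)) \<partial>?M)
       \<le> (\<integral>\<^sup>+x. ennreal ?e * h (x(i := (s + t) / 2)) \<partial>?M)\<^sup>2"
    proof (rule insert.IH)
      fix x y assume xy: "x \<in> space ?M" "y \<in> space ?M"
      have mid: "(\<lambda>j. ((x(i := s)) j + (y(i := t)) j) / 2) = (\<lambda>j. (x j + y j) / 2)(i := (s + t) / 2)"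
        by auto
      have sum: "(\<Sum>j\<in>insert i I. ((x(i := s)) j - (y(i := t)) j)\<^sup>2) = (s - t)\<^sup>2 + (\<Sum>j\<in>I. (x j - y j)\<^sup>2)"
        using insert.hyps by (auto intro!: sum.cong)
      have e: "exp (((s - t)\<^sup>2 + (\<Sum>j\<in>I. (x j - y j)\<^sup>2)) / 4) = ?e\<^sup>2 * exp ((\<Sum>j\<in>I. (x j - y j)\<^sup>2) / 4)"
        by (simp add: add_divide_distrib exp_add flip: exp_double)
      show "f (x(i := s)) * g (y(i := t)) \<le> (ennreal ?e * h ((\<lambda>i. (x i + y i) / 2)(i := (s + t) / 2)))\<^sup>2
         * ennreal (exp ((\<Sum>i\<in>I. (x i - y i)\<^sup>2) / 4))"
        using insert.prems(4)[OF upd[OF xy(1)] upd[OF xy(2)], of s t]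
        unfolding mid sum e by (simp add: fun_upd_def ennreal_mult ennreal_power power_mult_distrib mult_ac)
    qed measurable
    also have "\<dots> = (\<integral>\<^sup>+x. h (x(i := (s + t) / 2)) \<partial>?M)\<^sup>2 * ennreal (exp ((s - t)\<^sup>2 / 4))"
      by (subst nn_integral_cmult) (simp_all add: power_mult_distrib ennreal_power mult_ac flip: exp_double)
    finally show "(\<integral>\<^sup>+x. f (x(i := s)) \<partial>?M) * (\<integral>\<^sup>+x. g (x(i := t)) \<partial>?M) \<le> \<dots>" .
  qed (use insert.prems in \<open>auto intro: marg\<close>)
  then show ?case
    using insert.hyps insert.prems by (simp add: product_nn_integral_insert_rev)
qed

section \<open>Concentration for Gaussian product measures\<close>

abbreviation gaussP :: "'i set \<Rightarrow> ('i \<Rightarrow> real) measure" where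
  "gaussP I \<equiv> PiM I (\<lambda>_. gauss)"

lemma prob_space_gaussP: "prob_space (gaussP I)"
  by (intro prob_space_PiM prob_space_gauss)

lemma borel_measurable_component_gaussP[measurable (raw)]:
  "i \<in> I \<Longrightarrow> (\<lambda>x. x i) \<in> borel_measurable (gaussP I)"
  using measurable_component_singleton[of i I "\<lambda>_. gauss"] by (simp cong: measurable_cong_sets)

text \<open>The integrand times the standard density is a multiple of the normal density with variance
  \<open>1 / (1 + c)\<close>.\<close>

lemma nn_integral_gauss_exp_square:
  assumes "c > -1"
  shows "(\<integral>\<^sup>+u. ennreal (exp (- c * u\<^sup>2 / 2)) \<partial>gauss) = ennreal (1 / sqrt (1 + c))"
proof -
  define \<sigma> where "\<sigma> = 1 / sqrt (1 + c)"
  have \<sigma>: "\<sigma> > 0" "\<sigma>\<^sup>2 = 1 / (1 + c)" using assms by (auto simp: \<sigma>_def power_divide)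
  have pt: "std_normal_density u * exp (- c * u\<^sup>2 / 2) = \<sigma> * normal_density 0 \<sigma> u" for u
  proof -
    have "sqrt (2 * pi * \<sigma>\<^sup>2) = sqrt (2 * pi) * \<sigma>" using \<sigma>(1) by (simp add: real_sqrt_mult)
    moreover have "exp (- u\<^sup>2 / 2) * exp (- c * u\<^sup>2 / 2) = exp (- (u\<^sup>2) / (2 * \<sigma>\<^sup>2))"
      unfolding \<sigma>(2) by (simp add: field_simps flip: exp_add)
    ultimately show ?thesis using \<sigma>(1) by (simp add: normal_density_def field_simps)
  qed
  have "(\<integral>\<^sup>+u. ennreal (exp (- c * u\<^sup>2 / 2)) \<partial>gauss) = (\<integral>\<^sup>+u. ennreal (std_normal_density u * exp (- c * u\<^sup>2 / 2)) \<partial>lborel)"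
    unfolding gauss_def by (subst nn_integral_density) (auto simp: ennreal_mult)
  also have "\<dots> = ennreal \<sigma> * (\<integral>\<^sup>+u. ennreal (normal_density 0 \<sigma> u) \<partial>lborel)"
    unfolding pt using \<sigma> by (subst nn_integral_cmult[symmetric]) (auto simp: ennreal_mult)
  also have "(\<integral>\<^sup>+u. ennreal (normal_density 0 \<sigma> u) \<partial>lborel) = 1"
    using \<sigma>(1) by (subst nn_integral_eq_integral) auto
  finally show ?thesis by (simp add: \<sigma>_def)
qed

text \<open>The source of all concentration below. Prekopa-Leindler is applied to the indicators of \<open>A\<close> and \<open>B\<close>;
  the hypothesis says exactly that a centred Gaussian function \<open>h\<close>, whose integral is explicit, is
  admissible. With \<open>s = 1\<close> it says that the sets are at distance at least \<open>sqrt (2 * w)\<close>; with \<open>w = 0\<close>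
  it says that midpoints are short compared with differences.\<close>

lemma gaussP_two_sets:
  fixes A B :: "('i \<Rightarrow> real) set"
  assumes I: "finite I" and A: "A \<in> sets (gaussP I)" and B: "B \<in> sets (gaussP I)" and s: "s \<ge> 1"
    and sep: "\<And>x y. x \<in> A \<Longrightarrow> y \<in> B \<Longrightarrow>
       (s - 1) * (\<Sum>i\<in>I. ((x i + y i) / 2)\<^sup>2) + w / 2 \<le> (\<Sum>i\<in>I. (x i - y i)\<^sup>2) / 4"
  shows "measure (gaussP I) A * measure (gaussP I) B \<le> exp (- w / 2) * (1 / s) ^ card I"
proof -
  interpret prob_space "gaussP I" by (rule prob_space_gaussP)
  interpret P: product_sigma_finite "\<lambda>_::'i. gauss" by standard
  note [measurable] = A B
  \<comment> \<open>\<open>h\<close> squared is the exponential of minus the left side of \<open>sep\<close>; it is a product over the coordinates.\<close>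
  define h where "h z = ennreal (exp (- w / 4)) * (\<Prod>i\<in>I. ennreal (exp (- (s - 1) * (z i)\<^sup>2 / 2)))" for z :: "'i \<Rightarrow> real"
  have h_eq: "h z = ennreal (exp (- w / 4 - (s - 1) * (\<Sum>i\<in>I. (z i)\<^sup>2) / 2))" for z
  proof -
    have "(\<Prod>i\<in>I. exp (- (s - 1) * (z i)\<^sup>2 / 2)) = exp (- (s - 1) * (\<Sum>i\<in>I. (z i)\<^sup>2) / 2)"
      by (simp add: sum_distrib_left sum_divide_distrib I exp_sum)
    then have "h z = ennreal (exp (- w / 4)) * ennreal (exp (- (s - 1) * (\<Sum>i\<in>I. (z i)\<^sup>2) / 2))"
      unfolding h_def by (simp only: prod_ennreal exp_ge_zero)
    also have "\<dots> = ennreal (exp (- w / 4 + - (s - 1) * (\<Sum>i\<in>I. (z i)\<^sup>2) / 2))"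
      unfolding exp_add by (rule ennreal_mult[symmetric]) auto
    also have "- w / 4 + - (s - 1) * (\<Sum>i\<in>I. (z i)\<^sup>2) / 2 = - w / 4 - (s - 1) * (\<Sum>i\<in>I. (z i)\<^sup>2) / 2"
      by (simp only: mult_minus_left minus_divide_left[symmetric] add_uminus_conv_diff)
    finally show ?thesis .
  qed
  have hm[measurable]: "h \<in> borel_measurable (gaussP I)" unfolding h_def using I by measurable
  have "(\<integral>\<^sup>+x. indicator A x \<partial>gaussP I) * (\<integral>\<^sup>+x. indicator B x \<partial>gaussP I) \<le> (\<integral>\<^sup>+x. h x \<partial>gaussP I)\<^sup>2"
  proof (rule prekopa_leindler_gauss_PiM[OF I])
    fix x y :: "'i \<Rightarrow> real"
    show "indicator A x * indicator B y \<le> (h (\<lambda>i. (x i + y i) / 2))\<^sup>2 * ennreal (exp ((\<Sum>i\<in>I. (x i - y i)\<^sup>2) / 4))"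
    proof (cases "x \<in> A \<and> y \<in> B")
      case True
      then have "0 \<le> 2 * (- w / 4 - (s - 1) * (\<Sum>i\<in>I. ((x i + y i) / 2)\<^sup>2) / 2) + (\<Sum>i\<in>I. (x i - y i)\<^sup>2) / 4"
        using sep[of x y] by simp
      then have "1 \<le> (exp (- w / 4 - (s - 1) * (\<Sum>i\<in>I. ((x i + y i) / 2)\<^sup>2) / 2))\<^sup>2 * exp ((\<Sum>i\<in>I. (x i - y i)\<^sup>2) / 4)"
        unfolding exp_double[symmetric] exp_add[symmetric] by simp
      then have "ennreal 1 \<le> ennreal \<dots>" by (rule ennreal_leI)
      then show ?thesis using True unfolding h_eq by (simp add: ennreal_mult ennreal_power)
    qed auto
  qed measurable
  then have "emeasure (gaussP I) A * emeasure (gaussP I) B \<le> (\<integral>\<^sup>+x. h x \<partial>gaussP I)\<^sup>2" by simp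
  also have "(\<integral>\<^sup>+x. h x \<partial>gaussP I) = ennreal (exp (- w / 4)) * (\<Prod>i\<in>I. ennreal (1 / sqrt s))"
  proof -
    have "(\<integral>\<^sup>+x. h x \<partial>gaussP I) = ennreal (exp (- w / 4)) * (\<integral>\<^sup>+z. (\<Prod>i\<in>I. ennreal (exp (- (s - 1) * (z i)\<^sup>2 / 2))) \<partial>gaussP I)"
      unfolding h_def using I by (subst nn_integral_cmult) auto
    also have "(\<integral>\<^sup>+z. (\<Prod>i\<in>I. ennreal (exp (- (s - 1) * (z i)\<^sup>2 / 2))) \<partial>gaussP I)
       = (\<Prod>i\<in>I. (\<integral>\<^sup>+u. ennreal (exp (- (s - 1) * u\<^sup>2 / 2)) \<partial>gauss))"
      by (rule P.product_nn_integral_prod[OF I]) auto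
    also have "\<dots> = (\<Prod>i\<in>I. ennreal (1 / sqrt s))"
      using s nn_integral_gauss_exp_square[of "s - 1"] by simp
    finally show ?thesis .
  qed
  also have "(ennreal (exp (- w / 4)) * (\<Prod>i\<in>I. ennreal (1 / sqrt s)))\<^sup>2 = ennreal (exp (- w / 2) * (1 / s) ^ card I)"
  proof -
    have "(exp (- w / 4))\<^sup>2 = exp (- w / 2)" by (simp flip: exp_double)
    moreover have "((1 / sqrt s) ^ card I)\<^sup>2 = (1 / s) ^ card I"
      using s by (simp add: power_divide power_mult[symmetric] mult.commute[of "card I"]) (simp add: power_mult)
    ultimately show ?thesis using s
      by (simp add: prod_ennreal ennreal_power ennreal_mult[symmetric] power_mult_distrib)
  qed
  finally have "ennreal (prob A * prob B) \<le> ennreal (exp (- w / 2) * (1 / s) ^ card I)"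
    by (simp add: emeasure_eq_measure ennreal_mult)
  then show ?thesis by (subst (asm) ennreal_le_iff) (use s in auto)
qed

text \<open>Exponential Markov inequality; the exponential of the sum has a product as its integral.\<close>

lemma gaussP_chernoff:
  fixes \<phi> :: "real \<Rightarrow> real"
  assumes I: "finite I" and [measurable]: "\<phi> \<in> borel_measurable borel"
    and K: "(\<integral>\<^sup>+u. ennreal (exp (\<phi> u)) \<partial>gauss) \<le> ennreal K" "K \<ge> 0"
  shows "measure (gaussP I) {x\<in>space (gaussP I). b \<le> (\<Sum>i\<in>I. \<phi> (x i))} \<le> exp (- b) * K ^ card I"
proof -
  interpret prob_space "gaussP I" by (rule prob_space_gaussP)
  interpret P: product_sigma_finite "\<lambda>_. gauss" by standard
  let ?S = "{x\<in>space (gaussP I). b \<le> (\<Sum>i\<in>I. \<phi> (x i))}"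
  have [measurable]: "?S \<in> sets (gaussP I)" using I by measurable
  have "emeasure (gaussP I) ?S = (\<integral>\<^sup>+x. indicator ?S x \<partial>gaussP I)" by simp
  also have "\<dots> \<le> (\<integral>\<^sup>+x. ennreal (exp (- b)) * (\<Prod>i\<in>I. ennreal (exp (\<phi> (x i)))) \<partial>gaussP I)"
  proof (rule nn_integral_mono)
    fix x
    have "(\<Prod>i\<in>I. exp (\<phi> (x i))) = exp (\<Sum>i\<in>I. \<phi> (x i))" using I by (simp add: exp_sum)
    then have "ennreal (exp (- b)) * (\<Prod>i\<in>I. ennreal (exp (\<phi> (x i)))) = ennreal (exp ((\<Sum>i\<in>I. \<phi> (x i)) - b))"
      by (simp add: prod_ennreal ennreal_mult[symmetric] exp_add[symmetric])
    moreover have "ennreal 1 \<le> ennreal (exp ((\<Sum>i\<in>I. \<phi> (x i)) - b))" if "x \<in> ?S"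
      using that by (intro ennreal_leI) simp
    ultimately show "indicator ?S x \<le> ennreal (exp (- b)) * (\<Prod>i\<in>I. ennreal (exp (\<phi> (x i))))"
      by (auto simp: indicator_def)
  qed
  also have "\<dots> = ennreal (exp (- b)) * (\<integral>\<^sup>+x. (\<Prod>i\<in>I. ennreal (exp (\<phi> (x i)))) \<partial>gaussP I)"
    using I by (subst nn_integral_cmult) auto
  also have "(\<integral>\<^sup>+x. (\<Prod>i\<in>I. ennreal (exp (\<phi> (x i)))) \<partial>gaussP I) = (\<Prod>i\<in>I. \<integral>\<^sup>+u. ennreal (exp (\<phi> u)) \<partial>gauss)"
    by (rule P.product_nn_integral_prod[OF I]) auto
  also have "\<dots> \<le> (\<Prod>i\<in>I. ennreal K)" using K(1) by (simp add: power_mono)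
  finally have "emeasure (gaussP I) ?S \<le> ennreal (exp (- b)) * (\<Prod>i\<in>I. ennreal K)" by (simp add: mult_left_mono)
  also have "\<dots> = ennreal (exp (- b) * K ^ card I)" using K(2) by (simp add: prod_ennreal ennreal_mult ennreal_power)
  finally show ?thesis using K(2) by (simp add: emeasure_eq_measure)
qed

lemma nn_integral_gauss_exp_abs:
  "(\<integral>\<^sup>+u. ennreal (exp (- (4 * \<bar>u\<bar>))) \<partial>gauss) \<le> ennreal (1 / 5)"
proof -
  have dens: "std_normal_density u \<le> 2 / 5" for u
  proof -
    have "(5/2)\<^sup>2 \<le> 2 * pi" using pi_gt3 pi_approx by (simp add: power2_eq_square)
    then have "5/2 \<le> sqrt (2 * pi)" by (intro real_le_rsqrt)
    then have "1 / sqrt (2 * pi) \<le> 2/5" by (simp add: field_simps)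
    moreover have "exp (- u\<^sup>2 / 2) \<le> 1" by simp
    ultimately have "(1 / sqrt (2 * pi)) * exp (- u\<^sup>2 / 2) \<le> 2/5 * 1" by (intro mult_mono) auto
    then show ?thesis by (simp add: std_normal_density_def)
  qed
  have e1: "(\<integral>\<^sup>+u. ennreal (exponential_density 4 u) \<partial>lborel) = 1"
    using prob_space.emeasure_space_1[OF prob_space_exponential_density[of 4]] by (simp add: emeasure_density)
  have e2: "(\<integral>\<^sup>+u. ennreal (exponential_density 4 (- u)) \<partial>lborel) = 1"
    using nn_integral_real_affine[of "\<lambda>u. ennreal (exponential_density 4 u)" "-1" 0] e1 by simp
  have "(\<integral>\<^sup>+u. ennreal (exp (- (4 * \<bar>u\<bar>))) \<partial>gauss) = (\<integral>\<^sup>+u. ennreal (std_normal_density u * exp (- (4 * \<bar>u\<bar>))) \<partial>lborel)"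
    unfolding gauss_def by (subst nn_integral_density) (auto simp: ennreal_mult)
  also have "\<dots> \<le> (\<integral>\<^sup>+u. ennreal (1/10) * (ennreal (exponential_density 4 u) + ennreal (exponential_density 4 (- u))) \<partial>lborel)"
  proof (rule nn_integral_mono)
    fix u :: real
    have "std_normal_density u * exp (- (4 * \<bar>u\<bar>)) \<le> 2/5 * exp (- (4 * \<bar>u\<bar>))" by (intro mult_right_mono dens) auto
    also have "\<dots> \<le> 1/10 * (exponential_density 4 u + exponential_density 4 (- u))"
      by (auto simp: exponential_density_def abs_if mult.commute)
    finally have "ennreal (std_normal_density u * exp (- (4 * \<bar>u\<bar>))) \<le> ennreal (1/10 * (exponential_density 4 u + exponential_density 4 (- u)))"
      by (rule ennreal_leI)
    also have "\<dots> = ennreal (1/10) * (ennreal (exponential_density 4 u) + ennreal (exponential_density 4 (- u)))"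
      using exponential_density_nonneg[of 4 u] exponential_density_nonneg[of 4 "- u"] by (subst ennreal_mult) auto
    finally show "ennreal (std_normal_density u * exp (- (4 * \<bar>u\<bar>)))
      \<le> ennreal (1/10) * (ennreal (exponential_density 4 u) + ennreal (exponential_density 4 (- u)))" .
  qed
  also have "\<dots> = ennreal (1/10) * (1 + 1)"
    by (subst nn_integral_cmult, measurable, subst nn_integral_add, measurable) (simp add: e1 e2)
  also have "\<dots> = ennreal (1/10) * ennreal 2" by simp
  also have "\<dots> = ennreal (1/10 * 2)" by (rule ennreal_mult[symmetric]) auto
  also have "\<dots> = ennreal (1/5)" by simp
  finally show ?thesis .
qed

text \<open>The infimum of the levels at which the distribution function is at least one half.\<close>

lemma (in prob_space) median_exists:
  fixes F :: "'a \<Rightarrow> real"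
  assumes [measurable]: "F \<in> borel_measurable M"
  shows "\<exists>a. prob {x\<in>space M. F x \<le> a} \<ge> 1/2 \<and> prob {x\<in>space M. a \<le> F x} \<ge> 1/2"
proof -
  interpret D: real_distribution "distr M borel F" by (rule real_distribution_distr) simp
  let ?c = "cdf (distr M borel F)"
  have cdf: "?c t = prob {x\<in>space M. F x \<le> t}" for t
    by (simp add: cdf_def measure_distr vimage_def Int_def conj_commute)
  define S where "S = {t. 1/2 \<le> ?c t}"
  have "eventually (\<lambda>t. 1/2 < ?c t) at_top"
    using D.cdf_lim_at_top_prob by (rule order_tendstoD) simp
  then have ne: "S \<noteq> {}" unfolding S_def by (auto simp: eventually_at_top_linorder intro: less_imp_le)
  have "eventually (\<lambda>t. ?c t < 1/2) at_bot"
    using D.cdf_lim_at_bot by (rule order_tendstoD) simp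
  then obtain l where l: "\<And>t. t \<le> l \<Longrightarrow> ?c t < 1/2" by (auto simp: eventually_at_bot_linorder)
  have bdd: "bdd_below S" using l unfolding S_def by (intro bdd_belowI[of _ l]) (auto simp: not_le[symmetric] intro: leI)
  define a where "a = Inf S"
  have above: "1/2 \<le> ?c t" if t: "a < t" for t
  proof -
    obtain s where "s \<in> S" "s < t" using t ne bdd unfolding a_def by (auto simp: cInf_less_iff)
    then show ?thesis using D.cdf_nondecreasing[of s t] unfolding S_def by auto
  qed
  have "1/2 \<le> ?c a"
  proof (rule tendsto_lowerbound[where F="at_right a"])
    show "(?c \<longlongrightarrow> ?c a) (at_right a)" using D.cdf_is_right_cont[of a] by (simp add: continuous_within)
    show "eventually (\<lambda>t. 1/2 \<le> ?c t) (at_right a)" using above by (auto simp: eventually_at_right_field intro: exI[of _ "a+1"])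
  qed simp
  moreover have "prob {x\<in>space M. a \<le> F x} \<ge> 1/2"
  proof -
    have below: "?c t < 1/2" if "t < a" for t
      using that cInf_lower[OF _ bdd, of t] unfolding a_def S_def by force
    have "measure (distr M borel F) {..<a} \<le> 1/2"
    proof (rule tendsto_upperbound[where F="at_left a"])
      show "(?c \<longlongrightarrow> measure (distr M borel F) {..<a}) (at_left a)" by (rule D.cdf_at_left)
      show "eventually (\<lambda>t. ?c t \<le> 1/2) (at_left a)" using below
        by (auto simp: eventually_at_left_field intro!: exI[of _ "a-1"] less_imp_le)
    qed simp
    then have "prob {x\<in>space M. F x < a} \<le> 1/2" by (simp add: measure_distr vimage_def Int_def conj_commute)
    moreover have "prob {x\<in>space M. a \<le> F x} = 1 - prob {x\<in>space M. F x < a}"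
      using prob_neg[of "\<lambda>x. F x < a"] by (simp add: not_less)
    ultimately show ?thesis by simp
  qed
  ultimately show ?thesis unfolding cdf by auto
qed

text \<open>Where \<open>F\<close> exceeds \<open>\<mu> + t\<close> it is separated by the gap \<open>t\<close> from the set \<open>F \<le> \<mu>\<close>, which has measure at least
  one half; symmetrically below the median.\<close>

lemma gaussP_deviation_from_median:
  fixes F :: "('i \<Rightarrow> real) \<Rightarrow> real"
  assumes I: "finite I" and F[measurable]: "F \<in> borel_measurable (gaussP I)" and s: "s \<ge> 1"
    and sep: "\<And>x y. F x + t < F y \<Longrightarrow>
       (s - 1) * (\<Sum>i\<in>I. ((x i + y i) / 2)\<^sup>2) + w / 2 \<le> (\<Sum>i\<in>I. (x i - y i)\<^sup>2) / 4"
    and med: "measure (gaussP I) {x\<in>space (gaussP I). F x \<le> \<mu>} \<ge> 1/2"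
      "measure (gaussP I) {x\<in>space (gaussP I). \<mu> \<le> F x} \<ge> 1/2"
  shows "measure (gaussP I) {x\<in>space (gaussP I). t < \<bar>F x - \<mu>\<bar>} \<le> 4 * (exp (- w / 2) * (1 / s) ^ card I)"
proof -
  interpret prob_space "gaussP I" by (rule prob_space_gaussP)
  let ?S = "space (gaussP I)" and ?e = "exp (- w / 2) * (1 / s) ^ card I"
  have up: "prob {x\<in>?S. \<mu> + t < F x} \<le> 2 * ?e"
  proof -
    have "1/2 * prob {x\<in>?S. \<mu> + t < F x} \<le> prob {x\<in>?S. F x \<le> \<mu>} * prob {x\<in>?S. \<mu> + t < F x}"
      using med by (intro mult_right_mono) auto
    also have "\<dots> \<le> ?e" by (rule gaussP_two_sets[OF I _ _ s sep]) auto
    finally show ?thesis by simp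
  qed
  have down: "prob {x\<in>?S. F x < \<mu> - t} \<le> 2 * ?e"
  proof -
    have "prob {x\<in>?S. F x < \<mu> - t} * (1/2) \<le> prob {x\<in>?S. F x < \<mu> - t} * prob {x\<in>?S. \<mu> \<le> F x}"
      using med by (intro mult_left_mono) auto
    also have "\<dots> \<le> ?e" by (rule gaussP_two_sets[OF I _ _ s sep]) auto
    finally show ?thesis by simp
  qed
  have "prob {x\<in>?S. t < \<bar>F x - \<mu>\<bar>} \<le> prob ({x\<in>?S. \<mu> + t < F x} \<union> {x\<in>?S. F x < \<mu> - t})"
    by (rule finite_measure_mono) auto
  also have "\<dots> \<le> prob {x\<in>?S. \<mu> + t < F x} + prob {x\<in>?S. F x < \<mu> - t}"
    by (rule measure_Un_le) auto
  finally show ?thesis using up down by simp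
qed

section \<open>Functions of the direction of a Gaussian vector\<close>

lemma lp_norm_2: "lp_norm 2 k x = L2_set x {..<k}"
  by (simp add: lp_norm_def L2_set_def powr_half_sqrt sum_nonneg)

lemma lp_dist_2: "lp_dist 2 k x y = L2_set (\<lambda>i. x i - y i) {..<k}"
  by (simp add: lp_dist_def lp_norm_2)

text \<open>The direction of a vector of length zero is the zero vector. All statements about directions
  exclude this case, which has Gaussian measure zero.\<close>

definition direction :: "nat \<Rightarrow> (nat \<Rightarrow> real) \<Rightarrow> nat \<Rightarrow> real" where
  "direction k x = (\<lambda>i. if i < k then x i / L2_set x {..<k} else 0)"

lemma L2_set_direction:
  assumes "L2_set x {..<k} \<noteq> 0"
  shows "L2_set (direction k x) {..<k} = 1"
proof -
  have "L2_set (direction k x) {..<k} = L2_set (\<lambda>i. (1 / L2_set x {..<k}) * x i) {..<k}"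
    by (intro L2_set_cong) (auto simp: direction_def)
  also have "\<dots> = (1 / L2_set x {..<k}) * L2_set x {..<k}"
    by (rule L2_set_right_distrib[symmetric]) (simp add: L2_set_nonneg)
  finally show ?thesis using assms by simp
qed

lemma direction_in_unit_sphere:
  assumes "L2_set x {..<k} \<noteq> 0"
  shows "direction k x \<in> unit_sphere k"
  using L2_set_direction[OF assms] unfolding unit_sphere_def Rn_def lp_norm_2 by (auto simp: direction_def[of k x])

lemma L2_set_sq: "(L2_set x A)\<^sup>2 = (\<Sum>i\<in>A. (x i)\<^sup>2)"
  by (simp add: L2_set_def sum_nonneg)

text \<open>For unit vectors at distance at least \<open>T\<close> the inner product is at most \<open>1 - T\<^sup>2 / 2\<close>.\<close>

lemma inner_le_of_directions_apart:
  assumes T: "0 \<le> T" "T \<le> 1"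
    and far: "L2_set x {..<k} \<noteq> 0 \<Longrightarrow> L2_set y {..<k} \<noteq> 0 \<Longrightarrow> T \<le> L2_set (\<lambda>i. direction k x i - direction k y i) {..<k}"
  shows "(\<Sum>i<k. x i * y i) \<le> (1 - T\<^sup>2 / 2) * (L2_set x {..<k} * L2_set y {..<k})"
proof (cases "L2_set x {..<k} = 0 \<or> L2_set y {..<k} = 0")
  case True
  then have "(\<Sum>i<k. x i * y i) = 0" by (auto simp: L2_set_eq_0_iff intro!: sum.neutral)
  then show ?thesis using True by auto
next
  case False
  let ?a = "L2_set x {..<k}" and ?b = "L2_set y {..<k}"
  have ab: "?a > 0" "?b > 0" using False by (auto simp: less_le L2_set_nonneg)
  let ?u = "direction k x" and ?v = "direction k y"
  have "T\<^sup>2 \<le> (L2_set (\<lambda>i. ?u i - ?v i) {..<k})\<^sup>2" using far False T by (intro power_mono) auto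
  also have "\<dots> = (\<Sum>i<k. (?u i - ?v i)\<^sup>2)" by (rule L2_set_sq)
  also have "\<dots> = (\<Sum>i<k. (?u i)\<^sup>2) + (\<Sum>i<k. (?v i)\<^sup>2) - 2 * (\<Sum>i<k. ?u i * ?v i)"
    by (simp add: power2_diff sum.distrib sum_subtractf sum_distrib_left mult.assoc)
  also have "\<dots> = 2 - 2 * (\<Sum>i<k. ?u i * ?v i)"
    using L2_set_direction[of x k] L2_set_direction[of y k] False unfolding L2_set_sq[symmetric] by simp
  also have "(\<Sum>i<k. ?u i * ?v i) = (\<Sum>i<k. x i * y i) / (?a * ?b)"
    by (simp add: direction_def sum_divide_distrib)
  finally have "(\<Sum>i<k. x i * y i) / (?a * ?b) \<le> 1 - T\<^sup>2 / 2" by simp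
  then show ?thesis using ab by (simp add: divide_le_eq)
qed

text \<open>The estimate behind the two-line proof of spherical concentration through cones: if the angle
  between \<open>x\<close> and \<open>y\<close> is not small, then \<open>x + y\<close> is short compared with \<open>x - y\<close>, whatever the lengths of
  \<open>x\<close> and \<open>y\<close>. The factor is the one needed in \<open>gaussP_two_sets\<close> for \<open>s = 1 / (1 - T\<^sup>2 / 4)\<close>.\<close>

lemma cone_separation:
  fixes x y :: "nat \<Rightarrow> real"
  assumes T: "0 \<le> T" "T \<le> 1"
    and far: "L2_set x {..<k} \<noteq> 0 \<Longrightarrow> L2_set y {..<k} \<noteq> 0 \<Longrightarrow> T \<le> L2_set (\<lambda>i. direction k x i - direction k y i) {..<k}"
  shows "(1 / (1 - T\<^sup>2 / 4) - 1) * (\<Sum>i<k. ((x i + y i) / 2)\<^sup>2) \<le> (\<Sum>i<k. (x i - y i)\<^sup>2) / 4"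
proof -
  let ?a = "L2_set x {..<k}" and ?b = "L2_set y {..<k}"
  define d where "d = (\<Sum>i<k. x i * y i)"
  have T2: "T\<^sup>2 \<le> 1" using T by (simp add: power_le_one)
  have d: "d \<le> (1 - T\<^sup>2 / 2) * (?a * ?b)" unfolding d_def by (rule inner_le_of_directions_apart[OF assms])
  also have "\<dots> \<le> (1 - T\<^sup>2 / 2) * ((?a\<^sup>2 + ?b\<^sup>2) / 2)"
    using T2 sum_squares_bound[of ?a ?b] by (intro mult_left_mono) auto
  finally have d2: "2 * d \<le> (1 - T\<^sup>2 / 2) * (?a\<^sup>2 + ?b\<^sup>2)" by simp
  have plus: "(\<Sum>i<k. ((x i + y i) / 2)\<^sup>2) = (?a\<^sup>2 + ?b\<^sup>2 + 2 * d) / 4"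
    unfolding L2_set_sq d_def
    by (simp add: power_divide power2_sum sum.distrib sum_distrib_left sum_divide_distrib mult.assoc add_divide_distrib)
  have minus: "(\<Sum>i<k. (x i - y i)\<^sup>2) = ?a\<^sup>2 + ?b\<^sup>2 - 2 * d"
    unfolding L2_set_sq d_def by (simp add: power2_diff sum.distrib sum_subtractf sum_distrib_left mult.assoc)
  have pos: "1 - T\<^sup>2 / 4 > 0" using T2 by simp
  have "(1 / (1 - T\<^sup>2 / 4) - 1) = (T\<^sup>2 / 4) / (1 - T\<^sup>2 / 4)" using pos by (simp add: field_simps)
  moreover have "(T\<^sup>2 / 4) * (?a\<^sup>2 + ?b\<^sup>2 + 2 * d) \<le> (1 - T\<^sup>2 / 4) * (?a\<^sup>2 + ?b\<^sup>2 - 2 * d)"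
    using d2 by (simp add: algebra_simps)
  ultimately show ?thesis unfolding plus minus using pos by (simp add: field_simps)
qed

lemma gauss_uminus: "distr gauss gauss uminus = gauss"
proof (rule measure_eqI)
  fix A assume "A \<in> sets (distr gauss gauss uminus)"
  then have A[measurable]: "A \<in> sets borel" by simp
  have "emeasure (distr gauss gauss uminus) A = (\<integral>\<^sup>+u. indicator A u \<partial>distr gauss gauss uminus)"
    by simp
  also have "\<dots> = (\<integral>\<^sup>+u. indicator A (- u) \<partial>gauss)"
    by (rule nn_integral_distr) auto
  also have "\<dots> = (\<integral>\<^sup>+u. ennreal (std_normal_density u) * indicator A (- u) \<partial>lborel)"
    unfolding gauss_def by (rule nn_integral_density) measurable
  also have "\<dots> = (\<integral>\<^sup>+u. ennreal (std_normal_density (- u)) * indicator A (- u) \<partial>lborel)"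
    by (simp add: std_normal_density_def)
  also have "\<dots> = (\<integral>\<^sup>+u. ennreal (std_normal_density u) * indicator A u \<partial>lborel)"
    using nn_integral_real_affine[of "\<lambda>u. ennreal (std_normal_density u) * indicator A u" "-1" 0]
    by simp
  also have "\<dots> = emeasure gauss A" unfolding gauss_def by (rule emeasure_density[symmetric]) auto
  finally show "emeasure (distr gauss gauss uminus) A = emeasure gauss A" .
qed simp

lemma gaussP_uminus:
  assumes "finite I"
  shows "distr (gaussP I) (gaussP I) (\<lambda>x. \<lambda>i\<in>I. - x i) = gaussP I"
proof -
  have m: "uminus \<in> measurable gauss gauss"
    unfolding measurable_cong_sets[OF sets_gauss sets_gauss] by simp
  have "distr (gaussP I) (gaussP I) (compose I uminus) = PiM I (\<lambda>i. distr gauss gauss uminus)"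
    by (rule distr_PiM_finite_prob_space'[OF assms prob_space_gauss prob_space_gauss m])
  then show ?thesis unfolding gauss_uminus compose_def .
qed

text \<open>\<open>F\<close> may depend on the whole vector. The hypothesis only asks that values that differ by more than \<open>r\<close>
  are taken at vectors with directions at least \<open>T\<close> apart, as is the case for a Hoelder
  function of the direction, even if it is known only up to an error.\<close>

lemma gaussP_direction_concentration:
  fixes F :: "(nat \<Rightarrow> real) \<Rightarrow> real"
  assumes F[measurable]: "F \<in> borel_measurable (gaussP {..<k})" and T: "0 \<le> T" "T \<le> 1"
    and far: "\<And>x y. \<lbrakk>L2_set x {..<k} \<noteq> 0; L2_set y {..<k} \<noteq> 0; F x + r < F y\<rbrakk>
       \<Longrightarrow> T \<le> L2_set (\<lambda>i. direction k x i - direction k y i) {..<k}"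
  shows "\<exists>a. measure (gaussP {..<k}) {x\<in>space (gaussP {..<k}). r < \<bar>F x - a\<bar>} \<le> 4 * exp (- (real k * T\<^sup>2 / 4))"
proof -
  have T2: "T\<^sup>2 \<le> 1" using T by (simp add: power_le_one)
  obtain a where a: "measure (gaussP {..<k}) {x\<in>space (gaussP {..<k}). F x \<le> a} \<ge> 1/2"
    "measure (gaussP {..<k}) {x\<in>space (gaussP {..<k}). a \<le> F x} \<ge> 1/2"
    using prob_space.median_exists[OF prob_space_gaussP F] by blast
  have "measure (gaussP {..<k}) {x\<in>space (gaussP {..<k}). r < \<bar>F x - a\<bar>}
    \<le> 4 * (exp (- 0 / 2) * (1 / (1 / (1 - T\<^sup>2 / 4))) ^ card {..<k})"
  proof (rule gaussP_deviation_from_median[OF _ F _ _ a])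
    show "1 \<le> 1 / (1 - T\<^sup>2 / 4)" using T2 by (simp add: field_simps)
    show "(1 / (1 - T\<^sup>2 / 4) - 1) * (\<Sum>i<k. ((x i + y i) / 2)\<^sup>2) + 0 / 2 \<le> (\<Sum>i<k. (x i - y i)\<^sup>2) / 4"
      if "F x + r < F y" for x y using cone_separation[OF T far] that by simp
  qed simp
  also have "\<dots> = 4 * (1 - T\<^sup>2 / 4) ^ k" by simp
  also have "\<dots> \<le> 4 * (exp (- (T\<^sup>2 / 4))) ^ k"
    using T2 exp_ge_add_one_self[of "- (T\<^sup>2 / 4)"] by (intro mult_left_mono power_mono) auto
  also have "\<dots> = 4 * exp (- (real k * T\<^sup>2 / 4))" by (simp flip: exp_of_nat_mult)
  finally show ?thesis by blast
qed

text \<open>Both \<open>F x\<close> and \<open>F (- x)\<close> are within \<open>r\<close> of the same median with high probability, since the Gaussian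
  measure is symmetric.\<close>

lemma gaussP_antipodal_concentration:
  fixes F :: "(nat \<Rightarrow> real) \<Rightarrow> real"
  assumes F[measurable]: "F \<in> borel_measurable (gaussP {..<k})" and T: "0 \<le> T" "T \<le> 1"
    and far: "\<And>x y. \<lbrakk>L2_set x {..<k} \<noteq> 0; L2_set y {..<k} \<noteq> 0; F x + r < F y\<rbrakk>
       \<Longrightarrow> T \<le> L2_set (\<lambda>i. direction k x i - direction k y i) {..<k}"
  shows "measure (gaussP {..<k}) {x\<in>space (gaussP {..<k}). 2 * r < \<bar>F x - F (\<lambda>i\<in>{..<k}. - x i)\<bar>}
    \<le> 8 * exp (- (real k * T\<^sup>2 / 4))"
proof -
  interpret prob_space "gaussP {..<k}" by (rule prob_space_gaussP)
  let ?S = "space (gaussP {..<k})" and ?n = "\<lambda>x. \<lambda>i\<in>{..<k}. - x i :: real"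
  have n[measurable]: "?n \<in> measurable (gaussP {..<k}) (gaussP {..<k})"
    by (rule measurable_restrict) (simp cong: measurable_cong_sets)
  obtain a where a: "prob {x\<in>?S. r < \<bar>F x - a\<bar>} \<le> 4 * exp (- (real k * T\<^sup>2 / 4))"
    using gaussP_direction_concentration[OF assms] by auto
  have m[measurable]: "(\<lambda>x. F (?n x)) \<in> borel_measurable (gaussP {..<k})"
    by (rule measurable_compose[OF n F])
  have "prob {x\<in>?S. r < \<bar>F (?n x) - a\<bar>} = measure (distr (gaussP {..<k}) (gaussP {..<k}) ?n) {x\<in>?S. r < \<bar>F x - a\<bar>}"
    by (subst measure_distr) (auto intro!: arg_cong[where f=prob] simp: space_PiM)
  also have "\<dots> = prob {x\<in>?S. r < \<bar>F x - a\<bar>}" by (simp add: gaussP_uminus)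
  finally have neg: "prob {x\<in>?S. r < \<bar>F (?n x) - a\<bar>} = prob {x\<in>?S. r < \<bar>F x - a\<bar>}" .
  have "prob {x\<in>?S. 2 * r < \<bar>F x - F (?n x)\<bar>} \<le> prob ({x\<in>?S. r < \<bar>F x - a\<bar>} \<union> {x\<in>?S. r < \<bar>F (?n x) - a\<bar>})"
    by (rule finite_measure_mono) auto
  also have "\<dots> \<le> prob {x\<in>?S. r < \<bar>F x - a\<bar>} + prob {x\<in>?S. r < \<bar>F (?n x) - a\<bar>}"
    by (rule measure_Un_le) auto
  finally show ?thesis using a neg by simp
qed

section \<open>The lower bound for the dimension\<close>

text \<open>A dense sequence of the metric space \<open>M\<close> is still \<open>e'\<close>-dense in the sphere for every \<open>e' > e\<close>.
  Choosing the first good member of the sequence then gives a measurable selection.\<close>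

lemma eps_dense_sequence:
  assumes dense: "eps_dense e M S (lp_dist 2 k)" and S: "S \<noteq> {}" and e: "e < e'"
  obtains q :: "nat \<Rightarrow> nat \<Rightarrow> real"
  where "\<And>n. q n \<in> M" "\<And>x. x \<in> S \<Longrightarrow> \<exists>n. lp_dist 2 k x (q n) < e'"
proof -
  obtain Q where Q: "countable Q" "Q \<subseteq> M" "M \<subseteq> closure Q" using separable by blast
  have near: "\<exists>y\<in>Q. lp_dist 2 k x y < e'" if x: "x \<in> S" for x
  proof -
    obtain y where y: "y \<in> M" "lp_dist 2 k x y \<le> e" using dense x unfolding eps_dense_def by blast
    have "continuous_on UNIV (\<lambda>y. lp_dist 2 k x y)"
      unfolding lp_dist_2 L2_set_def by (intro continuous_intros continuous_on_product_coordinates)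
    then have "open {y. lp_dist 2 k x y < e'}" by (intro open_Collect_less continuous_on_const)
    moreover have "y \<in> {y. lp_dist 2 k x y < e'} \<inter> closure Q" using y e Q by auto
    ultimately have "{y. lp_dist 2 k x y < e'} \<inter> Q \<noteq> {}" 
      using open_Int_closure_eq_empty[of "{y. lp_dist 2 k x y < e'}" Q] by (metis empty_iff)
    then show ?thesis by auto
  qed
  have Qne: "Q \<noteq> {}" using near S by blast
  show ?thesis
  proof (rule that[of "from_nat_into Q"])
    show "from_nat_into Q n \<in> M" for n using from_nat_into[OF Qne] Q(2) by auto
    fix x assume "x \<in> S"
    then obtain y where "y \<in> Q" "lp_dist 2 k x y < e'" using near by blast
    then show "\<exists>n. lp_dist 2 k x (from_nat_into Q n) < e'" using Q(1) by (metis from_nat_into_surj)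
  qed
qed

lemma lp_norm_powr: "p \<ge> 1 \<Longrightarrow> lp_norm p m x powr p = (\<Sum>i<m. \<bar>x i\<bar> powr p)"
  by (simp add: lp_norm_def powr_powr sum_nonneg)

lemma abs_le_lp_norm:
  assumes "p \<ge> 1" "i < m"
  shows "\<bar>x i\<bar> \<le> lp_norm p m x"
proof -
  have "\<bar>x i\<bar> = (\<bar>x i\<bar> powr p) powr (1 / p)" using assms by (simp add: powr_powr)
  also have "\<dots> \<le> lp_norm p m x" unfolding lp_norm_def
    using assms by (intro powr_mono2 member_le_sum) auto
  finally show ?thesis .
qed

lemma powr_superadditive:
  fixes x y p :: real
  assumes "x \<ge> 0" "y \<ge> 0" "p \<ge> 1"
  shows "x powr p + y powr p \<le> (x + y) powr p"
proof -
  have *: "u powr p = u * u powr (p - 1)" if "u \<ge> 0" for u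
    using that by (cases "u = 0") (auto simp: powr_mult_base)
  have "x powr p + y powr p \<le> x * (x + y) powr (p - 1) + y * (x + y) powr (p - 1)"
    using assms unfolding *[OF assms(1)] *[OF assms(2)]
    by (intro add_mono mult_left_mono powr_mono2) auto
  also have "\<dots> = (x + y) powr p" using *[of "x + y"] assms by (simp add: algebra_simps)
  finally show ?thesis .
qed

text \<open>The numerical inequality that produces the constant 4. The weighted inequality of
  arithmetic and geometric means bounds the two powers by affine functions of \<open>\<theta>\<close>, and superadditivity of \<open>u powr p\<close> reduces the claim to \<open>p = 1\<close>.\<close>

lemma lower_bound_bracket:
  fixes q \<theta> p :: real
  assumes q: "0 < q" "q \<le> 29/50" and \<theta>: "0 < \<theta>" "\<theta> \<le> 1" and p: "p \<ge> 1"
  shows "(2 * (1 + 11/10 * q) powr \<theta>) powr p + 11/10 * (q powr \<theta>) powr p \<le> 4 powr p"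
proof -
  have young: "x powr \<theta> \<le> \<theta> * x + (1 - \<theta>)" if "x > 0" for x
    using Youngs_inequality_0[of \<theta> "1 - \<theta>" x 1] \<theta> that by simp
  let ?x = "2 * (1 + 11/10 * q) powr \<theta>" and ?y = "11/10 * q powr \<theta>"
  have "(11/10::real) \<le> (11/10) powr p" using powr_mono[of 1 p "11/10::real"] p by simp
  then have "11/10 * (q powr \<theta>) powr p \<le> (11/10) powr p * (q powr \<theta>) powr p" by (rule mult_right_mono) simp
  also have "\<dots> = ?y powr p" by (simp only: powr_mult)
  finally have "?x powr p + 11/10 * (q powr \<theta>) powr p \<le> ?x powr p + ?y powr p" by simp
  also have "\<dots> \<le> (?x + ?y) powr p" using p by (intro powr_superadditive) auto
  also have "\<dots> \<le> 4 powr p"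
  proof (rule powr_mono2)
    have "?x + ?y \<le> 2 * (\<theta> * (1 + 11/10 * q) + (1 - \<theta>)) + 11/10 * (\<theta> * q + (1 - \<theta>))"
      using young[of "1 + 11/10 * q"] young[of q] q by (intro add_mono mult_left_mono) auto
    also have "\<dots> = 31/10 + \<theta> * (33/10 * q - 11/10)" by (simp add: field_simps)
    also have "\<dots> \<le> 31/10 + \<theta> * (9/10)" using q \<theta> by (intro add_left_mono mult_left_mono) auto
    also have "\<dots> \<le> 4" using \<theta> by simp
    finally show "?x + ?y \<le> 4" .
  qed (use p q in auto)
  finally show ?thesis .
qed

lemma L2_set_diff_triangle:
  "L2_set (\<lambda>i. x i - z i) A \<le> L2_set (\<lambda>i. x i - y i) A + L2_set (\<lambda>i. y i - z i) A"
proof -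
  have "L2_set (\<lambda>i. x i - z i) A = L2_set (\<lambda>i. (x i - y i) + (y i - z i)) A" by simp
  also have "\<dots> \<le> L2_set (\<lambda>i. x i - y i) A + L2_set (\<lambda>i. y i - z i) A" by (rule L2_set_triangle_ineq)
  finally show ?thesis .
qed

lemma L2_set_diff_commute: "L2_set (\<lambda>i. x i - y i) A = L2_set (\<lambda>i. y i - x i) A"
  by (simp add: L2_set_def power2_commute)

lemma L2_set_uminus: "L2_set (\<lambda>i. - x i) A = L2_set x A"
  by (simp add: L2_set_def)

lemma AE_gauss_nonzero: "AE u in gauss. u \<noteq> 0"
proof -
  have "AE u in lborel. u \<noteq> (0::real)" by (rule AE_lborel_singleton)
  then show ?thesis unfolding gauss_def by (subst AE_density) auto
qed

lemma AE_gaussP_nonzero: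
  fixes k :: nat
  assumes "0 < k"
  shows "AE x in gaussP {..<k}. L2_set x {..<k} \<noteq> 0"
proof -
  have "AE x in gaussP {..<k}. x 0 \<noteq> 0"
    using AE_PiM_component[of "{..<k}" "\<lambda>_. gauss" 0 "\<lambda>u. u \<noteq> 0"] AE_gauss_nonzero prob_space_gauss assms by simp
  then show ?thesis
  proof eventually_elim
    case (elim x)
    show ?case
    proof
      assume "L2_set x {..<k} = 0"
      then have "\<forall>i\<in>{..<k}. x i = 0" by (subst (asm) L2_set_eq_0_iff) auto
      then show False using elim assms by auto
    qed
  qed
qed

lemma measurable_L2_set[measurable]:
  assumes "finite A" "\<And>i. i \<in> A \<Longrightarrow> (\<lambda>x. f x i) \<in> borel_measurable N"
  shows "(\<lambda>x. L2_set (f x) A) \<in> borel_measurable N"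
  unfolding L2_set_def using assms by measurable

text \<open>The situation of the lower bound: \<open>f\<close> has distortion \<open>D\<close> at scale \<open>s\<close> on the dense set \<open>M\<close>.\<close>

locale sphere_embedding =
  fixes p \<theta> D s :: real and k m :: nat and M :: "(nat \<Rightarrow> real) set" and f :: "(nat \<Rightarrow> real) \<Rightarrow> nat \<Rightarrow> real"
  assumes p: "p \<ge> 1" and k: "k \<ge> 4" and \<theta>: "0 < \<theta>" "\<theta> \<le> 1"
    and dense: "eps_dense (1 / sqrt (real k)) M (unit_sphere k) (lp_dist 2 k)"
    and D: "D \<ge> 1" and s: "s > 0"
    and lower: "\<And>x y. x \<in> M \<Longrightarrow> y \<in> M \<Longrightarrow> s * lp_dist 2 k x y powr \<theta> \<le> lp_dist p m (f x) (f y)"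
    and upper: "\<And>x y. x \<in> M \<Longrightarrow> y \<in> M \<Longrightarrow> lp_dist p m (f x) (f y) \<le> D * s * lp_dist 2 k x y powr \<theta>"
begin

text \<open>The density radius, enlarged by ten per cent to make room for passing to a countable set.\<close>

definition r where "r = 11/10 / sqrt (real k)"

lemma sqrt_k: "sqrt (real k) \<ge> 2"
  using k by (intro real_le_rsqrt) auto

lemma r_le: "r \<le> 11/20"
proof -
  have "11/10 / sqrt (real k) \<le> 11/10 / 2" by (rule divide_left_mono) (use sqrt_k k in auto)
  then show ?thesis by (simp add: r_def)
qed

lemma sphere_ne: "unit_sphere k \<noteq> {}"
proof -
  have "L2_set (\<lambda>i. if i = 0 then 1 else 0) {..<k} \<noteq> (0::real)"
    using k by (auto simp: L2_set_eq_0_iff)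
  from direction_in_unit_sphere[OF this] show ?thesis by blast
qed

lemma ex_q: "\<exists>q::nat \<Rightarrow> nat \<Rightarrow> real. (\<forall>n. q n \<in> M) \<and> (\<forall>x\<in>unit_sphere k. \<exists>n. lp_dist 2 k x (q n) < r)"
proof -
  have "1 / sqrt (real k) < r" using k by (simp add: r_def field_simps)
  from eps_dense_sequence[OF dense sphere_ne this] show ?thesis by metis
qed

definition q :: "nat \<Rightarrow> nat \<Rightarrow> real" where "q = (SOME q. (\<forall>n. q n \<in> M) \<and> (\<forall>x\<in>unit_sphere k. \<exists>n. lp_dist 2 k x (q n) < r))"

lemma q_M: "q n \<in> M" and q_near: "x \<in> unit_sphere k \<Longrightarrow> \<exists>n. lp_dist 2 k x (q n) < r"
  using someI_ex[OF ex_q] unfolding q_def[symmetric] by auto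

text \<open>A measurable substitute for the nearest point of \<open>M\<close>.\<close>

definition \<pi> :: "(nat \<Rightarrow> real) \<Rightarrow> nat \<Rightarrow> real" where "\<pi> x = q (LEAST n. lp_dist 2 k (direction k x) (q n) < r)"

lemma \<pi>_M: "\<pi> x \<in> M" unfolding \<pi>_def by (rule q_M)

lemma \<pi>_near: "L2_set x {..<k} \<noteq> 0 \<Longrightarrow> L2_set (\<lambda>i. direction k x i - \<pi> x i) {..<k} < r"
  using LeastI_ex[OF q_near[OF direction_in_unit_sphere, of x]] unfolding \<pi>_def lp_dist_2 by simp

lemma M_sphere: "x \<in> M \<Longrightarrow> L2_set x {..<k} = 1"
  using dense unfolding eps_dense_def unit_sphere_def lp_norm_2 by blast

definition L where "L = D * s"

lemma L_pos: "L > 0" using D s by (simp add: L_def)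

lemma f_coord_le:
  assumes "i < m"
  shows "\<bar>f (\<pi> x) i - f (\<pi> y) i\<bar> \<le> L * L2_set (\<lambda>i. \<pi> x i - \<pi> y i) {..<k} powr \<theta>"
  using abs_le_lp_norm[OF p assms, of "\<lambda>i. f (\<pi> x) i - f (\<pi> y) i"] upper[OF \<pi>_M \<pi>_M, of x y]
  unfolding lp_dist_2 by (simp add: lp_dist_def L_def)

lemma \<pi>_dist_le2: "L2_set (\<lambda>i. \<pi> x i - \<pi> y i) {..<k} \<le> 2"
  using L2_set_diff_triangle[of "\<pi> x" "\<pi> y" "{..<k}" "\<lambda>_. 0"] M_sphere[OF \<pi>_M]
  by (simp add: L2_set_uminus)

abbreviation neg :: "(nat \<Rightarrow> real) \<Rightarrow> nat \<Rightarrow> real" where "neg x \<equiv> (\<lambda>i\<in>{..<k}. - x i)"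

text \<open>Antipodal points have distance 2, and \<open>\<pi>\<close> moves directions by less than \<open>r\<close>.\<close>

lemma \<pi>_antipodal:
  assumes x: "L2_set x {..<k} \<noteq> 0"
  shows "2 - 2 * r \<le> L2_set (\<lambda>i. \<pi> x i - \<pi> (neg x) i) {..<k}"
proof -
  have n: "L2_set (neg x) {..<k} = L2_set x {..<k}" by (simp add: L2_set_def)
  have "L2_set (\<lambda>i. direction k x i - direction k (neg x) i) {..<k} = L2_set (\<lambda>i. 2 * direction k x i) {..<k}"
    by (rule L2_set_cong) (auto simp: direction_def n)
  also have "\<dots> = 2" using L2_set_right_distrib[of 2 "direction k x" "{..<k}"] L2_set_direction[OF x] by simp
  finally have "2 = L2_set (\<lambda>i. direction k x i - direction k (neg x) i) {..<k}" by simp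
  also have "\<dots> \<le> L2_set (\<lambda>i. direction k x i - \<pi> x i) {..<k}
     + (L2_set (\<lambda>i. \<pi> x i - \<pi> (neg x) i) {..<k} + L2_set (\<lambda>i. \<pi> (neg x) i - direction k (neg x) i) {..<k})"
    by (intro order_trans[OF L2_set_diff_triangle[where y="\<pi> x"]] add_left_mono L2_set_diff_triangle)
  also have "\<dots> \<le> r + (L2_set (\<lambda>i. \<pi> x i - \<pi> (neg x) i) {..<k} + r)"
    using \<pi>_near[OF x] \<pi>_near[of "neg x"] x n L2_set_diff_commute[of "\<pi> (neg x)" "direction k (neg x)"]
    by (intro add_mono) auto
  finally show ?thesis by simp
qed

text \<open>\<open>M\<close> contains two points at positive distance, whose images must be distinct; but \<open>Rn 0\<close> is a point.\<close>

lemma m_pos: "m \<ge> 1"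
proof (rule ccontr)
  assume "\<not> m \<ge> 1"
  then have m: "m = 0" by simp
  let ?x = "\<lambda>i. if i = 0 then 1 else 0 :: real"
  have "L2_set ?x {..<k} \<noteq> 0" using k by (auto simp: L2_set_eq_0_iff)
  from \<pi>_antipodal[OF this] have "L2_set (\<lambda>i. \<pi> ?x i - \<pi> (neg ?x) i) {..<k} > 0"
    using r_le by simp
  then have "0 < s * lp_dist 2 k (\<pi> ?x) (\<pi> (neg ?x)) powr \<theta>" using s unfolding lp_dist_2 by simp
  also have "\<dots> \<le> lp_dist p m (f (\<pi> ?x)) (f (\<pi> (neg ?x)))" by (rule lower[OF \<pi>_M \<pi>_M])
  also have "\<dots> = 0" using m by (simp add: lp_dist_def lp_norm_def)
  finally show False by simp
qed

lemma measurable_coord[measurable]: "(\<lambda>x. f (\<pi> x) i) \<in> borel_measurable (gaussP {..<k})"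
proof -
  have d: "(\<lambda>x. lp_dist 2 k (direction k x) (q n)) \<in> borel_measurable (gaussP {..<k})" for n
    unfolding lp_dist_2 direction_def by measurable
  have "(\<lambda>x. LEAST n. lp_dist 2 k (direction k x) (q n) < r) \<in> measurable (gaussP {..<k}) (count_space UNIV)"
    using d by measurable
  then show ?thesis unfolding \<pi>_def by (rule measurable_compose) simp
qed

text \<open>Chosen so that the tail \<open>exp (- k * T\<^sup>2 / 4)\<close> is at most of the order of \<open>T powr (p * \<theta>)\<close>.\<close>

definition T where "T = sqrt ((2 * p * \<theta> * ln (real k) + 8) / real k)"

lemma ln_k: "ln (real k) > 0" using k by simp

lemma T_pos: "T > 0" using k p \<theta> ln_k by (simp add: T_def add_pos_pos)

lemma T_sq: "T\<^sup>2 = (2 * p * \<theta> * ln (real k) + 8) / real k"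
  using k p \<theta> ln_k by (simp add: T_def)

lemma T_exp: "exp (- (real k * T\<^sup>2 / 4)) = real k powr (- (p * \<theta> / 2)) * exp (- 2)"
proof -
  have "- (real k * T\<^sup>2 / 4) = (- (p * \<theta> / 2)) * ln (real k) + (- 2)"
    unfolding T_sq using k by (simp add: field_simps)
  then show ?thesis using k by (simp add: powr_def exp_add[symmetric])
qed

text \<open>A bound for the difference of a coordinate at two points of \<open>M\<close> at distance \<open>T + 2 * r\<close>, that is, over two
  directions at distance \<open>T\<close>.\<close>

definition rad where "rad = L * (T + 2 * r) powr \<theta>"

lemma coord_tail:
  assumes i: "i < m" and T1: "T \<le> 1"
  shows "measure (gaussP {..<k}) {x\<in>space (gaussP {..<k}). 2 * rad < \<bar>f (\<pi> x) i - f (\<pi> (neg x)) i\<bar>}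
    \<le> 8 * exp (- (real k * T\<^sup>2 / 4))"
proof (rule gaussP_antipodal_concentration)
  show "0 \<le> T" using T_pos by simp
  show "T \<le> 1" by (rule T1)
  fix x y
  assume x: "L2_set x {..<k} \<noteq> 0" and y: "L2_set y {..<k} \<noteq> 0" and lt: "f (\<pi> x) i + rad < f (\<pi> y) i"
  let ?d = "L2_set (\<lambda>i. \<pi> x i - \<pi> y i) {..<k}"
  have "L * (T + 2 * r) powr \<theta> < L * ?d powr \<theta>"
    using lt f_coord_le[OF i, of x y] unfolding rad_def by linarith
  then have "(T + 2 * r) powr \<theta> < ?d powr \<theta>" using L_pos by simp
  then have "T + 2 * r < ?d"
    using powr_mono2[of \<theta> ?d "T + 2 * r"] \<theta> L2_set_nonneg by (meson less_imp_le not_less)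
  also have "?d \<le> L2_set (\<lambda>i. \<pi> x i - direction k x i) {..<k}
     + (L2_set (\<lambda>i. direction k x i - direction k y i) {..<k} + L2_set (\<lambda>i. direction k y i - \<pi> y i) {..<k})"
    by (intro order_trans[OF L2_set_diff_triangle[where y="direction k x"]] add_left_mono L2_set_diff_triangle)
  also have "\<dots> \<le> r + (L2_set (\<lambda>i. direction k x i - direction k y i) {..<k} + r)"
    using \<pi>_near[OF x] \<pi>_near[OF y] L2_set_diff_commute[of "\<pi> x" "direction k x"]
    by (intro add_mono) auto
  finally show "T \<le> L2_set (\<lambda>i. direction k x i - direction k y i) {..<k}" by simp
qed measurable

text \<open>The left side is a lower bound for the \<open>p\<close>-th power of the distance of the images of antipodal
  points, the right side an upper bound for its expectation: each coordinate contributes at most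
  \<open>2 * rad\<close>, except on the tail event, where the diameter of the sphere gives the trivial bound.\<close>

lemma moment_bound:
  assumes T1: "T \<le> 1" and r1: "r \<le> 1 / 2"
  shows "s powr p \<le> real m * ((2 * rad) powr p + (L * 2 powr \<theta>) powr p * (8 * exp (- (real k * T\<^sup>2 / 4))))"
proof -
  let ?G = "gaussP {..<k}"
  interpret prob_space ?G by (rule prob_space_gaussP)
  let ?c = "(L * 2 powr \<theta>) powr p"
  define Bad where "Bad i = {x\<in>space ?G. 2 * rad < \<bar>f (\<pi> x) i - f (\<pi> (neg x)) i\<bar>}" for i
  have n: "neg \<in> measurable ?G ?G"
    by (rule measurable_restrict) (simp cong: measurable_cong_sets)
  have [measurable]: "(\<lambda>x. f (\<pi> (neg x)) i) \<in> borel_measurable ?G" for i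
    using measurable_compose[OF n measurable_coord] .
  have Bad[measurable]: "Bad i \<in> events" for i unfolding Bad_def by measurable
  have pt: "s powr p \<le> (\<Sum>i<m. (2 * rad) powr p + ?c * indicator (Bad i) x)"
    if x: "L2_set x {..<k} \<noteq> 0" "x \<in> space ?G" for x
  proof -
    let ?d = "L2_set (\<lambda>i. \<pi> x i - \<pi> (neg x) i) {..<k}"
    have d: "1 \<le> ?d" "?d \<le> 2" using \<pi>_antipodal[OF x(1)] \<pi>_dist_le2 r1 by auto
    have "s * 1 \<le> s * ?d powr \<theta>" using d s \<theta> by (intro mult_left_mono ge_one_powr_ge_zero) auto
    also have "\<dots> \<le> lp_norm p m (\<lambda>i. f (\<pi> x) i - f (\<pi> (neg x)) i)"
      using lower[OF \<pi>_M \<pi>_M, of x "neg x"] unfolding lp_dist_2 by (simp add: lp_dist_def)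
    finally have "s powr p \<le> lp_norm p m (\<lambda>i. f (\<pi> x) i - f (\<pi> (neg x)) i) powr p"
      using s p by (intro powr_mono2) auto
    also have "\<dots> = (\<Sum>i<m. \<bar>f (\<pi> x) i - f (\<pi> (neg x)) i\<bar> powr p)" by (rule lp_norm_powr[OF p])
    also have "\<dots> \<le> (\<Sum>i<m. (2 * rad) powr p + ?c * indicator (Bad i) x)"
    proof (rule sum_mono)
      fix i assume "i \<in> {..<m}"
      then have i: "i < m" by simp
      show "\<bar>f (\<pi> x) i - f (\<pi> (neg x)) i\<bar> powr p \<le> (2 * rad) powr p + ?c * indicator (Bad i) x"
      proof (cases "x \<in> Bad i")
        case True
        have "L * ?d powr \<theta> \<le> L * 2 powr \<theta>"
          using L_pos d \<theta> by (intro mult_left_mono powr_mono2) auto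
        then have "\<bar>f (\<pi> x) i - f (\<pi> (neg x)) i\<bar> \<le> L * 2 powr \<theta>"
          using f_coord_le[OF i, of x "neg x"] by linarith
        then have "\<bar>f (\<pi> x) i - f (\<pi> (neg x)) i\<bar> powr p \<le> ?c" using p by (intro powr_mono2) auto
        then show ?thesis using True by (simp add: add_increasing)
      next
        case False
        then have "\<bar>f (\<pi> x) i - f (\<pi> (neg x)) i\<bar> \<le> 2 * rad" using x by (auto simp: Bad_def)
        then show ?thesis using False p by (simp add: powr_mono2)
      qed
    qed
    finally show ?thesis .
  qed
  have ind: "integrable ?G (indicat_real (Bad i))" for i
    using Bad by (auto simp: emeasure_eq_measure)
  have "s powr p = (\<integral>x. s powr p \<partial>?G)" by (simp add: prob_space)
  also have "\<dots> \<le> (\<integral>x. (\<Sum>i<m. (2 * rad) powr p + ?c * indicator (Bad i) x) \<partial>?G)"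
  proof (rule integral_mono_AE)
    show "AE x in ?G. s powr p \<le> (\<Sum>i<m. (2 * rad) powr p + ?c * indicator (Bad i) x)"
      using AE_gaussP_nonzero[of k] AE_space k by (auto intro: pt elim: eventually_elim2)
  qed (use ind in auto)
  also have "\<dots> = (\<Sum>i<m. \<integral>x. (2 * rad) powr p + ?c * indicator (Bad i) x \<partial>?G)"
    by (rule Bochner_Integration.integral_sum) (use ind in auto)
  also have "\<dots> = (\<Sum>i<m. (2 * rad) powr p + ?c * prob (Bad i))"
  proof (rule sum.cong[OF refl])
    fix i
    have "(\<integral>x. (2 * rad) powr p + ?c * indicator (Bad i) x \<partial>?G)
       = (\<integral>x. (2 * rad) powr p \<partial>?G) + (\<integral>x. ?c * indicator (Bad i) x \<partial>?G)"
      by (rule Bochner_Integration.integral_add) (use ind in auto)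
    also have "\<dots> = (2 * rad) powr p + ?c * prob (Bad i)" by (simp add: prob_space)
    finally show "(\<integral>x. (2 * rad) powr p + ?c * indicator (Bad i) x \<partial>?G) = \<dots>" .
  qed
  also have "\<dots> \<le> (\<Sum>i<m. (2 * rad) powr p + ?c * (8 * exp (- (real k * T\<^sup>2 / 4))))"
    using coord_tail[OF _ T1] unfolding Bad_def by (intro sum_mono add_left_mono mult_left_mono) auto
  finally show ?thesis by simp
qed

theorem dimension_lower_bound:
  "real m \<ge> 1 / (4 * D) powr p * (real k / (2 * p * \<theta> * ln (real k) + 8)) powr (p * \<theta> / 2)"
proof -
  have rhs: "1 / (4 * D) powr p * (real k / (2 * p * \<theta> * ln (real k) + 8)) powr (p * \<theta> / 2)
     = 1 / (4 * D * T powr \<theta>) powr p"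
  proof -
    have "real k / (2 * p * \<theta> * ln (real k) + 8) = 1 / T powr 2" unfolding T_sq using T_pos by (simp add: T_sq)
    moreover have "(1 / T powr 2) powr (p * \<theta> / 2) = 1 / (T powr \<theta>) powr p"
      by (simp only: powr_divide powr_powr powr_one_eq_one) (simp add: mult.commute)
    ultimately have "(real k / (2 * p * \<theta> * ln (real k) + 8)) powr (p * \<theta> / 2) = 1 / (T powr \<theta>) powr p"
      by (simp only:)
    then show ?thesis by (simp add: powr_mult)
  qed
  show ?thesis
  \<comment> \<open>Otherwise the asserted bound is at most 1.\<close>
  proof (cases "T powr \<theta> < 1 / 4")
    case False
    then have "1 \<le> 4 * 1 * T powr \<theta>" by simp
    also have "\<dots> \<le> 4 * D * T powr \<theta>" using D by (intro mult_right_mono) auto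
    finally have "1 \<le> (4 * D * T powr \<theta>) powr p" using p by (intro ge_one_powr_ge_zero) auto
    then have "1 / (4 * D * T powr \<theta>) powr p \<le> 1" by (subst divide_le_eq_1_pos; linarith)
    then show ?thesis unfolding rhs using m_pos by linarith
  next
    case True
    have T_less: "T < 1 / 4"
    proof (cases "T \<ge> 1")
      case T1: True
      then show ?thesis using True ge_one_powr_ge_zero[of T \<theta>] \<theta> by simp
    next
      case False
      then have "T powr 1 \<le> T powr \<theta>" using T_pos \<theta> by (intro powr_mono') auto
      then show ?thesis using True T_pos by simp
    qed
    have kT: "real k * T\<^sup>2 = 2 * p * \<theta> * ln (real k) + 8" unfolding T_sq using k by simp
    have k16: "real k \<ge> 16"
    proof -
      have "T\<^sup>2 \<le> (1 / 4)\<^sup>2" using T_less T_pos by (intro power_mono) auto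
      then have "real k * T\<^sup>2 \<le> real k * (1 / 4)\<^sup>2" by (intro mult_left_mono) auto
      moreover have "8 \<le> real k * T\<^sup>2" unfolding kT using p \<theta> ln_k by simp
      ultimately show ?thesis by (simp add: power2_eq_square)
    qed
    have "sqrt 16 \<le> sqrt (real k)" using k16 by (rule real_sqrt_le_mono)
    then have "r \<le> 11/10 / 4" unfolding r_def using k by (intro divide_left_mono) auto
    then have r1: "r \<le> 1 / 2" by simp
    \<comment> \<open>\<open>T powr \<theta> < 1 / 4\<close> forces \<open>k powr \<theta> > 16\<close>.\<close>
    have \<theta>k: "2 \<le> p * \<theta> * ln (real k)"
    proof -
      have "1 \<le> real k * T\<^sup>2" unfolding kT using p \<theta> ln_k by simp
      then have "sqrt 1 \<le> sqrt (real k * T\<^sup>2)" by (rule real_sqrt_le_mono)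
      then have "1 \<le> sqrt (real k) * T" using T_pos by (simp add: real_sqrt_mult)
      then have "ln 1 \<le> ln (sqrt (real k) * T)" by (intro ln_mono) auto
      also have "\<dots> = ln (real k) / 2 + ln T" using k T_pos by (simp add: ln_mult ln_sqrt)
      finally have "0 \<le> \<theta> * (ln (real k) / 2 + ln T)" using \<theta> by simp
      then have "- (\<theta> * ln T) \<le> \<theta> * ln (real k) / 2" by (simp add: algebra_simps)
      moreover have "ln (T powr \<theta>) < ln (1 / 4)" using True T_pos by (subst ln_less_cancel_iff) auto
      then have "\<theta> * ln T < - ln 4" using T_pos by (simp add: ln_powr ln_div)
      moreover have "1 \<le> ln (4::real)" using exp_le by (simp add: ln_ge_iff)
      ultimately have "2 \<le> \<theta> * ln (real k)" by simp
      also have "1 * (\<theta> * ln (real k)) \<le> p * (\<theta> * ln (real k))" using p \<theta> ln_k by (intro mult_right_mono) auto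
      finally show ?thesis by (simp add: mult.assoc)
    qed
    \<comment> \<open>In terms of \<open>q0\<close> both the enlarged radius and the tail are multiples of \<open>T\<close>.\<close>
    define q0 where "q0 = 2 / (T * sqrt (real k))"
    have q0_pos: "q0 > 0" using T_pos k by (simp add: q0_def)
    have q0_le: "q0 \<le> 29 / 50"
    proof -
      have "12 \<le> real k * T\<^sup>2" unfolding kT using \<theta>k by (simp add: mult_ac)
      moreover have "(100/29)\<^sup>2 \<le> (12::real)" by (simp add: power2_eq_square)
      ultimately have "(100/29)\<^sup>2 \<le> real k * T\<^sup>2" by linarith
      then have "100/29 \<le> sqrt (real k * T\<^sup>2)" by (rule real_le_rsqrt)
      also have "\<dots> = T * sqrt (real k)" using T_pos by (simp add: real_sqrt_mult)
      finally have "2 / (T * sqrt (real k)) \<le> 2 / (100/29)" by (intro divide_left_mono) auto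
      then show ?thesis by (simp add: q0_def)
    qed
    have Tq0: "T * q0 = 2 / sqrt (real k)" using T_pos by (simp add: q0_def)
    have rad_eq: "2 * rad = (L * T powr \<theta>) * (2 * (1 + 11/10 * q0) powr \<theta>)"
    proof -
      have "T + 2 * r = T * (1 + 11/10 * q0)" using Tq0 by (simp add: r_def algebra_simps)
      then show ?thesis using T_pos q0_pos by (simp add: rad_def powr_mult)
    qed
    have tail_eq: "(L * 2 powr \<theta>) powr p * real k powr (- (p * \<theta> / 2)) = (L * T powr \<theta>) powr p * (q0 powr \<theta>) powr p"
    proof -
      have "real k powr (- (p * \<theta> / 2)) = ((1 / sqrt (real k)) powr \<theta>) powr p"
        using k by (simp add: powr_powr powr_divide powr_minus_divide powr_half_sqrt[symmetric] mult_ac)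
      then have "(L * 2 powr \<theta>) powr p * real k powr (- (p * \<theta> / 2)) = (L * (2 * (1 / sqrt (real k))) powr \<theta>) powr p"
        by (simp only: powr_mult mult.assoc)
      also have "2 * (1 / sqrt (real k)) = T * q0" using Tq0 by simp
      finally show ?thesis by (simp only: powr_mult mult.assoc)
    qed
    \<comment> \<open>The constant 8 in \<open>T\<close> enters here, through the tail probability.\<close>
    have e2: "8 * exp (- 2 :: real) \<le> 11/10"
    proof -
      have "(61/50 :: real) \<le> exp (1/5)" using exp_lower_Taylor_quadratic[of "1/5"] by (simp add: power2_eq_square)
      then have "(61/50 :: real) ^ 10 \<le> exp (1/5) ^ 10" by (intro power_mono) auto
      also have "\<dots> = exp 2" by (simp flip: exp_of_nat_mult)
      finally have "(80/11 :: real) \<le> exp 2" by (simp add: power_numeral_even power_numeral_odd)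
      then show ?thesis by (simp add: exp_minus field_simps)
    qed
    have "s powr p \<le> real m * ((2 * rad) powr p + (L * 2 powr \<theta>) powr p * (8 * exp (- (real k * T\<^sup>2 / 4))))"
      using T_less by (intro moment_bound r1) auto
    also have "(L * 2 powr \<theta>) powr p * (8 * exp (- (real k * T\<^sup>2 / 4)))
       = (L * T powr \<theta>) powr p * (q0 powr \<theta>) powr p * (8 * exp (- 2))"
      unfolding T_exp tail_eq[symmetric] by (simp add: mult_ac)
    also have "real m * ((2 * rad) powr p + \<dots>)
       \<le> real m * ((2 * rad) powr p + (L * T powr \<theta>) powr p * (q0 powr \<theta>) powr p * (11/10))"
      by (intro mult_left_mono add_left_mono e2) auto
    also have "\<dots> = real m * (L * T powr \<theta>) powr p * ((2 * (1 + 11/10 * q0) powr \<theta>) powr p + 11/10 * (q0 powr \<theta>) powr p)"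
      unfolding rad_eq powr_mult[of "L * T powr \<theta>"] by (simp add: algebra_simps)
    also have "\<dots> \<le> real m * (L * T powr \<theta>) powr p * 4 powr p"
      by (intro mult_left_mono lower_bound_bracket q0_pos q0_le \<theta> p) auto
    also have "\<dots> = real m * (4 * D * T powr \<theta>) powr p * s powr p"
      unfolding L_def by (simp only: powr_mult mult_ac)
    finally have "1 \<le> real m * (4 * D * T powr \<theta>) powr p" using s by simp
    moreover have "0 < (4 * D * T powr \<theta>) powr p" using D T_pos by simp
    ultimately show ?thesis unfolding rhs by (simp add: divide_le_eq)
  qed
qed

end

section \<open>Norms of sequences and nets of the sphere\<close>

lemma powr_convex_combination:
  fixes a b t p :: real
  assumes "a \<ge> 0" "b \<ge> 0" "0 \<le> t" "t \<le> 1" "p \<ge> 1"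
  shows "(t * a + (1 - t) * b) powr p \<le> t * a powr p + (1 - t) * b powr p"
proof (cases "a = 0 \<or> b = 0")
  case True
  have t: "u powr p \<le> u" if "0 \<le> u" "u \<le> 1" for u
    using powr_mono'[of 1 p u] that assms by (cases "u = 0") auto
  have "t powr p * a powr p \<le> t * a powr p" "(1 - t) powr p * b powr p \<le> (1 - t) * b powr p"
    using assms t by (auto intro!: mult_right_mono)
  then show ?thesis using True by (auto simp: powr_mult)
next
  case False
  then show ?thesis
    using convex_onD[OF powr_convex[of p], of t b a] assms by (auto simp: algebra_simps)
qed

lemma lp_norm_nonneg: "lp_norm p m x \<ge> 0"
  by (simp add: lp_norm_def)

lemma lp_norm_scale:
  assumes "p \<ge> 1"
  shows "lp_norm p m (\<lambda>i. c * x i) = \<bar>c\<bar> * lp_norm p m x"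
proof -
  have "(\<Sum>i<m. \<bar>c * x i\<bar> powr p) = \<bar>c\<bar> powr p * (\<Sum>i<m. \<bar>x i\<bar> powr p)"
    by (simp add: abs_mult powr_mult sum_distrib_left)
  then show ?thesis using assms by (simp add: lp_norm_def powr_mult powr_powr)
qed

text \<open>Minkowski: after normalisation, the sum of the vectors is a convex combination of unit vectors,
  and \<open>u powr p\<close> is convex.\<close>

lemma lp_norm_triangle:
  assumes p: "p \<ge> 1"
  shows "lp_norm p m (\<lambda>i. x i + y i) \<le> lp_norm p m x + lp_norm p m y"
proof -
  let ?A = "lp_norm p m x" and ?B = "lp_norm p m y"
  have zero: "u i = 0" if "lp_norm p m u = 0" "i < m" for u i
    using abs_le_lp_norm[OF p that(2), of u] that(1) by simp
  consider "?A = 0" | "?B = 0" | "?A > 0" "?B > 0"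
    using lp_norm_nonneg[of p m x] lp_norm_nonneg[of p m y] by linarith
  then show ?thesis
  proof cases
    case 1
    then have "lp_norm p m (\<lambda>i. x i + y i) = ?B" using zero[OF 1] unfolding lp_norm_def by simp
    then show ?thesis using 1 by simp
  next
    case 2
    then have "lp_norm p m (\<lambda>i. x i + y i) = ?A" using zero[OF 2] unfolding lp_norm_def by simp
    then show ?thesis using 2 by simp
  next
    case 3
    let ?t = "?A / (?A + ?B)"
    have t: "0 \<le> ?t" "?t \<le> 1" "1 - ?t = ?B / (?A + ?B)" using 3 by (auto simp: field_simps)
    have pt: "\<bar>x i + y i\<bar> powr p \<le> (?A + ?B) powr p * (?t * (\<bar>x i\<bar> / ?A) powr p + (1 - ?t) * (\<bar>y i\<bar> / ?B) powr p)" for i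
    proof -
      have "\<bar>x i + y i\<bar> \<le> (?A + ?B) * (?t * (\<bar>x i\<bar> / ?A) + (1 - ?t) * (\<bar>y i\<bar> / ?B))"
      proof -
        have e: "?t * (\<bar>x i\<bar> / ?A) = \<bar>x i\<bar> / (?A + ?B)" "?B / (?A + ?B) * (\<bar>y i\<bar> / ?B) = \<bar>y i\<bar> / (?A + ?B)"
          using 3 by auto
        show ?thesis unfolding t(3) e add_divide_distrib[symmetric] using 3 by simp
      qed
      then have "\<bar>x i + y i\<bar> powr p \<le> ((?A + ?B) * (?t * (\<bar>x i\<bar> / ?A) + (1 - ?t) * (\<bar>y i\<bar> / ?B))) powr p"
        using p by (intro powr_mono2) auto
      also have "\<dots> = (?A + ?B) powr p * (?t * (\<bar>x i\<bar> / ?A) + (1 - ?t) * (\<bar>y i\<bar> / ?B)) powr p"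
        by (rule powr_mult)
      also have "\<dots> \<le> (?A + ?B) powr p * (?t * (\<bar>x i\<bar> / ?A) powr p + (1 - ?t) * (\<bar>y i\<bar> / ?B) powr p)"
        using 3 t p by (intro mult_left_mono powr_convex_combination) auto
      finally show ?thesis .
    qed
    have one: "(\<Sum>i<m. (\<bar>u i\<bar> / lp_norm p m u) powr p) = 1" if "lp_norm p m u > 0" for u
    proof -
      have "(\<Sum>i<m. (\<bar>u i\<bar> / lp_norm p m u) powr p) = (\<Sum>i<m. \<bar>u i\<bar> powr p) / lp_norm p m u powr p"
        by (simp add: powr_divide sum_divide_distrib)
      also have "\<dots> = 1" unfolding lp_norm_powr[OF p, symmetric] using that by simp
      finally show ?thesis .
    qed
    have "(\<Sum>i<m. \<bar>x i + y i\<bar> powr p) \<le> (\<Sum>i<m. (?A + ?B) powr p * (?t * (\<bar>x i\<bar> / ?A) powr p + (1 - ?t) * (\<bar>y i\<bar> / ?B) powr p))"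
      by (intro sum_mono pt)
    also have "\<dots> = (?A + ?B) powr p * (?t * (\<Sum>i<m. (\<bar>x i\<bar> / ?A) powr p) + (1 - ?t) * (\<Sum>i<m. (\<bar>y i\<bar> / ?B) powr p))"
      by (simp only: sum_distrib_left[symmetric] sum.distrib)
    also have "\<dots> = (?A + ?B) powr p" unfolding one[OF 3(1)] one[OF 3(2)] by simp
    finally have "lp_norm p m (\<lambda>i. x i + y i) \<le> ((?A + ?B) powr p) powr (1 / p)"
      unfolding lp_norm_def using p by (intro powr_mono2 sum_nonneg) auto
    then show ?thesis using p 3 by (simp add: powr_powr)
  qed
qed

lemma lp_norm_le_lp_norm_2:
  assumes p: "p \<ge> 2"
  shows "lp_norm p m x \<le> L2_set x {..<m}"
proof (cases "L2_set x {..<m} = 0")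
  case True
  then have "x i = 0" if "i < m" for i using that by (simp add: L2_set_eq_0_iff)
  then show ?thesis by (simp add: lp_norm_def L2_set_nonneg)
next
  case False
  let ?B = "L2_set x {..<m}"
  have B: "?B > 0" using False L2_set_nonneg[of x "{..<m}"] by linarith
  have "(\<Sum>i<m. \<bar>x i\<bar> powr p) \<le> (\<Sum>i<m. ?B powr (p - 2) * (x i)\<^sup>2)"
  proof (rule sum_mono)
    fix i assume i: "i \<in> {..<m}"
    then have le: "\<bar>x i\<bar> \<le> ?B" using member_le_L2_set[of "{..<m}" i "\<lambda>i. \<bar>x i\<bar>"] by (simp add: L2_set_def)
    have "\<bar>x i\<bar> powr p = \<bar>x i\<bar> powr (p - 2) * \<bar>x i\<bar> powr 2" by (simp only: powr_add[symmetric]) simp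
    also have "\<dots> \<le> ?B powr (p - 2) * \<bar>x i\<bar> powr 2" using le p by (intro mult_right_mono powr_mono2) auto
    finally show "\<bar>x i\<bar> powr p \<le> ?B powr (p - 2) * (x i)\<^sup>2" by simp
  qed
  also have "\<dots> = ?B powr (p - 2) * ?B powr 2" using B by (simp add: sum_distrib_left[symmetric] L2_set_sq)
  also have "\<dots> = ?B powr p" by (simp only: powr_add[symmetric]) simp
  finally have "lp_norm p m x \<le> (?B powr p) powr (1 / p)"
    unfolding lp_norm_def using p by (intro powr_mono2 sum_nonneg) auto
  then show ?thesis using p B by (simp add: powr_powr)
qed

lemma lp_norm_1: "lp_norm 1 m x = (\<Sum>i<m. \<bar>x i\<bar>)"
  by (simp add: lp_norm_def sum_nonneg)

lemma l1_le_sqrt_l2: "(\<Sum>i<m. \<bar>x i\<bar>) \<le> sqrt (real m) * L2_set x {..<m}"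
  using L2_set_mult_ineq[of "\<lambda>_. 1" x "{..<m}"] by (simp add: L2_set_def)

text \<open>The net consists of lattice points of mesh \<open>1 / (8 * sqrt k)\<close>, obtained by rounding the coordinates
  towards zero. By Cauchy-Schwarz the integer coordinates of such a point have sum of absolute values
  at most \<open>8 * k\<close>. Giving the integer vector \<open>z\<close> the weight \<open>2 ^ (- sum of |z i|)\<close>, all weights add up to at
  most \<open>3 ^ k\<close>, and every point of the net has weight at least \<open>2 ^ (- 8 * k)\<close>.\<close>

lemma sphere_net:
  assumes k: "k \<ge> 1"
  shows "\<exists>Y. finite Y \<and> card Y \<le> 768 ^ k \<and>
    (\<forall>x. L2_set x {..<k} = 1 \<longrightarrow> (\<exists>y\<in>Y. L2_set (\<lambda>i. x i - y i) {..<k} \<le> 1 / 8))"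
proof -
  define n :: int where "n = 8 * int k"
  define Z where "Z = {z \<in> PiE {..<k} (\<lambda>_. {-n..n}). (\<Sum>i<k. \<bar>z i\<bar>) \<le> 8 * int k}"
  define h where "h = 8 * sqrt (real k)"
  have h: "h > 0" using k by (simp add: h_def)
  have finP: "finite (PiE {..<k} (\<lambda>_. {-n..n}))" by (intro finite_PiE) auto
  have finZ: "finite Z" unfolding Z_def using finP by simp
  have cardZ: "card Z \<le> 768 ^ k"
  proof -
    have geo: "(\<Sum>z\<in>{-n..n}. (1/2 :: real) ^ nat \<bar>z\<bar>) \<le> 3"
    proof -
      have "(\<Sum>z\<in>{0..n}. (1/2 :: real) ^ nat \<bar>z\<bar>) = (\<Sum>i\<in>{0..nat n}. (1/2) ^ i)"
        by (rule sum.reindex_bij_witness[of _ int nat]) (auto simp: n_def)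
      also have "\<dots> \<le> 2" using sum_gp0[of "1/2::real" "nat n"] by (simp add: atLeast0AtMost)
      finally have a: "(\<Sum>z\<in>{0..n}. (1/2 :: real) ^ nat \<bar>z\<bar>) \<le> 2" .
      have "(\<Sum>z\<in>{-n..-1}. (1/2 :: real) ^ nat \<bar>z\<bar>) = (\<Sum>z\<in>{1..n}. (1/2 :: real) ^ nat \<bar>z\<bar>)"
        by (rule sum.reindex_bij_witness[of _ uminus uminus]) auto
      also have "\<dots> = (\<Sum>z\<in>{0..n}. (1/2 :: real) ^ nat \<bar>z\<bar>) - 1"
      proof -
        have "{0..n} = insert 0 {1..n}" unfolding n_def by auto
        then show ?thesis by simp
      qed
      finally have b: "(\<Sum>z\<in>{-n..-1}. (1/2 :: real) ^ nat \<bar>z\<bar>) \<le> 1" using a by simp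
      have "{-n..n} = {-n..-1} \<union> {0..n}" unfolding n_def by auto
      then have "(\<Sum>z\<in>{-n..n}. (1/2 :: real) ^ nat \<bar>z\<bar>) = (\<Sum>z\<in>{-n..-1}. (1/2) ^ nat \<bar>z\<bar>) + (\<Sum>z\<in>{0..n}. (1/2) ^ nat \<bar>z\<bar>)"
        by (simp add: sum.union_disjoint)
      then show ?thesis using a b by linarith
    qed
    have "real (card Z) * (1/2) ^ (8 * k) = (\<Sum>z\<in>Z. (1/2) ^ (8 * k))" by simp
    also have "\<dots> \<le> (\<Sum>z\<in>Z. \<Prod>i<k. (1/2) ^ nat \<bar>z i\<bar>)"
    proof (rule sum_mono)
      fix z assume "z \<in> Z"
      then have "(\<Sum>i<k. \<bar>z i\<bar>) \<le> 8 * int k" by (simp add: Z_def)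
      then have "int (\<Sum>i<k. nat \<bar>z i\<bar>) \<le> 8 * int k" by simp
      then have "(\<Sum>i<k. nat \<bar>z i\<bar>) \<le> 8 * k" by linarith
      then have "(1/2 :: real) ^ (8 * k) \<le> (1/2) ^ (\<Sum>i<k. nat \<bar>z i\<bar>)" by (intro power_decreasing) auto
      then show "(1/2 :: real) ^ (8 * k) \<le> (\<Prod>i<k. (1/2) ^ nat \<bar>z i\<bar>)" by (simp add: power_sum)
    qed
    also have "\<dots> \<le> (\<Sum>z\<in>PiE {..<k} (\<lambda>_. {-n..n}). \<Prod>i<k. (1/2) ^ nat \<bar>z i\<bar>)"
    proof (rule sum_mono2[OF finP])
      show "Z \<subseteq> PiE {..<k} (\<lambda>_. {-n..n})" unfolding Z_def by blast
      show "0 \<le> (\<Prod>i<k. (1/2 :: real) ^ nat \<bar>z i\<bar>)" for z by (rule prod_nonneg) simp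
    qed
    also have "\<dots> = (\<Prod>i<k. \<Sum>z\<in>{-n..n}. (1/2) ^ nat \<bar>z\<bar>)" by (rule prod_sum_PiE[symmetric]) auto
    also have "\<dots> \<le> (\<Prod>i<k. 3)" using geo by (intro prod_mono) (auto intro: sum_nonneg)
    finally have "real (card Z) * (1/2) ^ (8 * k) \<le> 3 ^ k" by simp
    then have "real (card Z) \<le> 3 ^ k * 2 ^ (8 * k)" by (simp add: power_one_over divide_le_eq)
    also have "\<dots> = 768 ^ k" by (simp add: power_mult power_mult_distrib[symmetric])
    finally show ?thesis by (metis of_nat_le_iff of_nat_numeral of_nat_power)
  qed
  define Y where "Y = (\<lambda>z i. of_int (z i) / h) ` Z"
  have "\<exists>y\<in>Y. L2_set (\<lambda>i. x i - y i) {..<k} \<le> 1 / 8" if x: "L2_set x {..<k} = 1" for x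
  proof -
    have tr: "\<exists>z::int. \<bar>of_int z\<bar> \<le> \<bar>v\<bar> \<and> \<bar>v - of_int z\<bar> \<le> 1" for v :: real
    proof -
      obtain z :: int where z: "of_int z \<le> \<bar>v\<bar>" "\<bar>v\<bar> < of_int (z + 1)" using floor_exists by blast
      then have "0 < real_of_int (z + 1)" using abs_ge_zero[of v] by linarith
      then have "0 \<le> z" by simp
      with z have "\<bar>of_int z\<bar> \<le> \<bar>v\<bar> \<and> \<bar>\<bar>v\<bar> - of_int z\<bar> \<le> 1" by (simp add: abs_le_iff)
      then show ?thesis by (intro exI[of _ "if v \<ge> 0 then z else - z"]) (auto simp: abs_if split: if_splits)
    qed
    obtain z0 :: "nat \<Rightarrow> int" where z0: "\<And>i. \<bar>of_int (z0 i)\<bar> \<le> \<bar>h * x i\<bar>" "\<And>i. \<bar>h * x i - of_int (z0 i)\<bar> \<le> 1"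
    proof -
      have "\<forall>i. \<exists>z::int. \<bar>of_int z\<bar> \<le> \<bar>h * x i\<bar> \<and> \<bar>h * x i - of_int z\<bar> \<le> 1" using tr by blast
      from choice[OF this] show ?thesis using that by blast
    qed
    define z where "z = restrict z0 {..<k}"
    have "real_of_int (\<Sum>i<k. \<bar>z i\<bar>) = (\<Sum>i<k. \<bar>of_int (z0 i)\<bar>)" by (simp add: z_def)
    also have "\<dots> \<le> (\<Sum>i<k. h * \<bar>x i\<bar>)" using z0(1) h by (intro sum_mono) (simp add: abs_mult)
    also have "\<dots> = h * (\<Sum>i<k. \<bar>x i\<bar>)" by (simp add: sum_distrib_left)
    also have "\<dots> \<le> h * (sqrt (real k) * L2_set x {..<k})" using h by (intro mult_left_mono l1_le_sqrt_l2) auto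
    also have "\<dots> = real_of_int (8 * int k)" unfolding x h_def by simp
    finally have sum: "(\<Sum>i<k. \<bar>z i\<bar>) \<le> 8 * int k" by linarith
    have "z i \<in> {-n..n}" if i: "i < k" for i
    proof -
      have "\<bar>z i\<bar> \<le> (\<Sum>i<k. \<bar>z i\<bar>)" using i by (intro member_le_sum) auto
      then show ?thesis using sum unfolding n_def by auto
    qed
    then have zZ: "z \<in> Z" unfolding Z_def using sum by (auto simp: z_def)
    have "L2_set (\<lambda>i. x i - of_int (z i) / h) {..<k} \<le> L2_set (\<lambda>i. 1 / h) {..<k}"
      unfolding L2_set_def
    proof (intro real_sqrt_le_mono sum_mono)
      fix i assume "i \<in> {..<k}"
      then have "x i - of_int (z i) / h = (h * x i - of_int (z0 i)) / h" using h by (simp add: z_def field_simps)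
      then have "\<bar>x i - of_int (z i) / h\<bar> \<le> \<bar>1 / h\<bar>" using z0(2)[of i] h by (simp add: abs_divide divide_right_mono)
      then show "(x i - of_int (z i) / h)\<^sup>2 \<le> (1 / h)\<^sup>2" by (subst (asm) abs_le_square_iff)
    qed
    also have "\<dots> = sqrt (real k) / h" using h by (simp add: L2_set_def real_sqrt_mult real_sqrt_divide power_divide)
    also have "\<dots> = 1 / 8" unfolding h_def using k by simp
    finally have near: "L2_set (\<lambda>i. x i - of_int (z i) / h) {..<k} \<le> 1 / 8" .
    show ?thesis
    proof (rule bexI)
      show "(\<lambda>i. of_int (z i) / h) \<in> Y" unfolding Y_def using zZ by (rule imageI)
    qed (rule near)
  qed
  moreover have "finite Y" unfolding Y_def using finZ by simp
  moreover have "card Y \<le> 768 ^ k" unfolding Y_def using card_image_le[OF finZ] cardZ by (rule order_trans)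
  ultimately show ?thesis by blast
qed

text \<open>Coordinates with vanishing coefficient are dropped first, since a degenerate normal distribution has
  no density.\<close>

lemma gaussP_linear_form:
  fixes x :: "'i \<Rightarrow> real"
  assumes K: "finite K" and x: "(\<Sum>a\<in>K. (x a)\<^sup>2) = 1"
  shows "distr (gaussP K) gauss (\<lambda>g. \<Sum>a\<in>K. x a * g a) = gauss"
proof -
  interpret prob_space "gaussP K" by (rule prob_space_gaussP)
  define J where "J = {a \<in> K. x a \<noteq> 0}"
  have J: "finite J" "J \<subseteq> K" using K by (auto simp: J_def)
  have sumJ: "(\<Sum>a\<in>K. (x a)\<^sup>2) = (\<Sum>a\<in>J. (x a)\<^sup>2)" "(\<Sum>a\<in>K. x a * g a) = (\<Sum>a\<in>J. x a * g a)" for g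
    unfolding J_def using K by (auto intro: sum.mono_neutral_right)
  have Jne: "J \<noteq> {}" using x unfolding sumJ by auto
  have Kne: "K \<noteq> {}" using Jne J by auto
  have comp: "distr (gaussP K) borel (\<lambda>g. g a) = gauss" if "a \<in> K" for a
    using distr_PiM_component[of K "\<lambda>_. gauss" a] that prob_space_gauss
    by (simp cong: distr_cong)
  have "indep_vars (\<lambda>_. borel) (\<lambda>a g. g a) K"
  proof (subst indep_vars_iff_distr_eq_PiM'[OF Kne])
    show "random_variable borel (\<lambda>g. g a)" if "a \<in> K" for a using that by measurable
    have "distr (gaussP K) (PiM K (\<lambda>_. borel)) (\<lambda>g. restrict g K) = distr (gaussP K) (gaussP K) (\<lambda>g. g)"
      by (rule distr_cong) (auto simp: space_PiM PiE_def extensional_restrict intro!: sets_PiM_cong)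
    also have "\<dots> = gaussP K" by (rule distr_id)
    also have "\<dots> = PiM K (\<lambda>a. distr (gaussP K) borel (\<lambda>g. g a))"
      using comp by (intro PiM_cong) auto
    finally show "distr (gaussP K) (PiM K (\<lambda>_. borel)) (\<lambda>g. \<lambda>a\<in>K. g a) = PiM K (\<lambda>a. distr (gaussP K) borel (\<lambda>g. g a))" .
  qed
  then have "indep_vars (\<lambda>_. borel) (\<lambda>a g. g a) J" using J(2) by (rule indep_vars_subset)
  then have indep: "indep_vars (\<lambda>_. borel) (\<lambda>a g. x a * g a) J"
    by (rule indep_vars_compose2[where Y="\<lambda>a u. x a * u"]) auto
  have normal: "distributed (gaussP K) lborel (\<lambda>g. x a * g a) (normal_density 0 \<bar>x a\<bar>)" if "a \<in> J" for a
  proof -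
    have "distributed (gaussP K) lborel (\<lambda>g. g a) (normal_density 0 1)"
    proof -
      have "a \<in> K" using that J by auto
      then show ?thesis
        unfolding distributed_def using comp[of a] by (auto simp: gauss_def cong: distr_cong)
    qed
    from normal_density_affine[OF this, of "x a" 0] that show ?thesis by (auto simp: J_def)
  qed
  have "distributed (gaussP K) lborel (\<lambda>g. \<Sum>a\<in>J. x a * g a) (normal_density (\<Sum>a\<in>J. 0) (sqrt (\<Sum>a\<in>J. \<bar>x a\<bar>\<^sup>2)))"
    by (rule sum_indep_normal[OF J(1) Jne indep]) (use normal in \<open>auto simp: J_def\<close>)
  then have d: "distributed (gaussP K) lborel (\<lambda>g. \<Sum>a\<in>K. x a * g a) (normal_density 0 1)"
    using x unfolding sumJ by simp
  have "distr (gaussP K) gauss (\<lambda>g. \<Sum>a\<in>K. x a * g a) = distr (gaussP K) lborel (\<lambda>g. \<Sum>a\<in>K. x a * g a)"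
    by (rule distr_cong) auto
  also have "\<dots> = gauss" using d unfolding distributed_def gauss_def by simp
  finally show ?thesis .
qed

section \<open>Gaussian matrices and the theorem of Dvoretzky\<close>

definition matv :: "nat \<Rightarrow> (nat \<Rightarrow> nat \<Rightarrow> real) \<Rightarrow> (nat \<Rightarrow> real) \<Rightarrow> nat \<Rightarrow> real" where
  "matv k G x = (\<lambda>i. \<Sum>a<k. x a * G i a)"

definition gaussM :: "nat \<Rightarrow> nat \<Rightarrow> (nat \<Rightarrow> nat \<Rightarrow> real) measure" where
  "gaussM m k = PiM {..<m} (\<lambda>_. gaussP {..<k})"

lemma prob_space_gaussM: "prob_space (gaussM m k)"
  unfolding gaussM_def by (intro prob_space_PiM prob_space_gaussP)

lemma matv_add: "matv k G (\<lambda>a. x a + y a) = (\<lambda>i. matv k G x i + matv k G y i)"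
  by (simp add: matv_def algebra_simps sum.distrib)

lemma matv_diff: "matv k G (\<lambda>a. x a - y a) = (\<lambda>i. matv k G x i - matv k G y i)"
  by (simp add: matv_def algebra_simps sum_subtractf)

lemma matv_scale: "matv k G (\<lambda>a. c * x a) = (\<lambda>i. c * matv k G x i)"
  by (simp add: matv_def algebra_simps sum_distrib_left)

lemma measurable_row_form:
  "(\<lambda>g. \<Sum>a<k. x a * g a) \<in> measurable (gaussP {..<k}) gauss"
  unfolding measurable_cong_sets[OF refl sets_gauss] by measurable

lemma restrict_matv: "(\<lambda>G. restrict (matv k G x) {..<m}) = compose {..<m} (\<lambda>g. \<Sum>a<k. x a * g a)"
  by (simp add: fun_eq_iff compose_def matv_def restrict_def)

lemma measurable_matv: "(\<lambda>G. restrict (matv k G x) {..<m}) \<in> measurable (gaussM m k) (gaussP {..<m})"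
  unfolding restrict_matv gaussM_def compose_def
  by (rule measurable_restrict, rule measurable_compose[OF _ measurable_row_form], rule measurable_component_singleton)

text \<open>A Gaussian matrix maps every unit vector to a standard Gaussian vector, because its rows are
  independent.\<close>

lemma distr_matv:
  assumes "L2_set x {..<k} = 1"
  shows "distr (gaussM m k) (gaussP {..<m}) (\<lambda>G. restrict (matv k G x) {..<m}) = gaussP {..<m}"
proof -
  have "(\<Sum>a<k. (x a)\<^sup>2) = 1" using L2_set_sq[of x "{..<k}"] assms by simp
  then have row: "distr (gaussP {..<k}) gauss (\<lambda>g. \<Sum>a<k. x a * g a) = gauss"
    by (intro gaussP_linear_form) auto
  have "distr (gaussM m k) (gaussP {..<m}) (compose {..<m} (\<lambda>g. \<Sum>a<k. x a * g a))
     = PiM {..<m} (\<lambda>_. distr (gaussP {..<k}) gauss (\<lambda>g. \<Sum>a<k. x a * g a))"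
    unfolding gaussM_def
    by (rule distr_PiM_finite_prob_space'[OF _ prob_space_gaussP prob_space_gauss measurable_row_form]) simp
  then show ?thesis unfolding restrict_matv row .
qed

text \<open>A seminorm on the first \<open>m\<close> coordinates with Lipschitz constant \<open>b\<close> for the Euclidean norm.\<close>

locale coordinate_norm =
  fixes m :: nat and N :: "(nat \<Rightarrow> real) \<Rightarrow> real" and b :: real
  assumes triangle: "N (\<lambda>i. x i + y i) \<le> N x + N y"
    and scale: "N (\<lambda>i. c * x i) = \<bar>c\<bar> * N x"
    and le_L2: "N x \<le> b * L2_set x {..<m}"
    and measurable_N[measurable]: "N \<in> borel_measurable (gaussP {..<m})"
    and b_pos: "b > 0"
begin

lemma lipschitz: "N x \<le> N y + b * L2_set (\<lambda>i. x i - y i) {..<m}"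
proof -
  have "N x = N (\<lambda>i. y i + (x i - y i))" by simp
  also have "\<dots> \<le> N y + N (\<lambda>i. x i - y i)" by (rule triangle)
  also have "\<dots> \<le> N y + b * L2_set (\<lambda>i. x i - y i) {..<m}" using le_L2 by (intro add_left_mono)
  finally show ?thesis .
qed

lemma N_restrict: "N (restrict x {..<m}) = N x"
proof (rule antisym)
  have "L2_set (\<lambda>i. restrict x {..<m} i - x i) {..<m} = 0" "L2_set (\<lambda>i. x i - restrict x {..<m} i) {..<m} = 0"
    by (simp_all add: L2_set_def)
  then show "N (restrict x {..<m}) \<le> N x" "N x \<le> N (restrict x {..<m})"
    using lipschitz[of "restrict x {..<m}" x] lipschitz[of x "restrict x {..<m}"] by auto
qed

definition is_median :: "real \<Rightarrow> bool" where
  "is_median \<mu> \<longleftrightarrow> measure (gaussP {..<m}) {x\<in>space (gaussP {..<m}). N x \<le> \<mu>} \<ge> 1/2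
     \<and> measure (gaussP {..<m}) {x\<in>space (gaussP {..<m}). \<mu> \<le> N x} \<ge> 1/2"

lemma ex_median: "\<exists>\<mu>. is_median \<mu>"
  unfolding is_median_def by (rule prob_space.median_exists[OF prob_space_gaussP measurable_N])

lemma concentration:
  assumes \<mu>: "is_median \<mu>" and t: "t \<ge> 0"
  shows "measure (gaussP {..<m}) {x\<in>space (gaussP {..<m}). t < \<bar>N x - \<mu>\<bar>} \<le> 4 * exp (- (t\<^sup>2 / (4 * b\<^sup>2)))"
proof -
  have "measure (gaussP {..<m}) {x\<in>space (gaussP {..<m}). t < \<bar>N x - \<mu>\<bar>}
    \<le> 4 * (exp (- (t\<^sup>2 / (2 * b\<^sup>2)) / 2) * (1 / 1) ^ card {..<m})"
  proof (rule gaussP_deviation_from_median[OF _ measurable_N])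
    fix x y assume "N x + t < N y"
    then have "t \<le> b * L2_set (\<lambda>i. x i - y i) {..<m}"
      using lipschitz[of y x] L2_set_diff_commute[of x y "{..<m}"] by auto
    then have "t / b \<le> L2_set (\<lambda>i. x i - y i) {..<m}" using b_pos by (simp add: divide_le_eq mult.commute)
    then have "(t / b)\<^sup>2 \<le> (\<Sum>i<m. (x i - y i)\<^sup>2)"
      unfolding L2_set_sq[symmetric] using t b_pos by (intro power_mono) auto
    then show "(1 - 1) * (\<Sum>i<m. ((x i + y i) / 2)\<^sup>2) + t\<^sup>2 / (2 * b\<^sup>2) / 2 \<le> (\<Sum>i<m. (x i - y i)\<^sup>2) / 4"
      by (simp add: power_divide)
  qed (use \<mu> in \<open>auto simp: is_median_def\<close>)
  then show ?thesis by simp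
qed

text \<open>Let \<open>S\<close> be the supremum of the seminorm \<open>N (G x)\<close> over the unit sphere. Every \<open>x\<close> is within \<open>1 / 8\<close> of a
  point of the net, so \<open>N (G x)\<close> differs by at most \<open>S / 8\<close> from a value on the net. Applied to the
  supremum this bounds \<open>S\<close>, and then it gives the lower bound.\<close>

lemma net_to_sphere:
  assumes M: "M > 0"
    and net: "\<And>x. L2_set x {..<k} = 1 \<Longrightarrow> \<exists>y\<in>Y. L2_set (\<lambda>i. x i - y i) {..<k} \<le> 1 / 8"
    and onY: "\<And>y. y \<in> Y \<Longrightarrow> L2_set y {..<k} \<noteq> 0 \<Longrightarrow> 3/4 * M * L2_set y {..<k} \<le> N (matv k G y) \<and> N (matv k G y) \<le> 5/4 * M * L2_set y {..<k}"
    and x: "L2_set x {..<k} = 1"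
  shows "2/5 * M \<le> N (matv k G x) \<and> N (matv k G x) \<le> 2 * M"
proof -
  define F where "F x = N (matv k G x)" for x
  define K where "K = b * (\<Sum>i<m. \<Sum>a<k. \<bar>G i a\<bar>)"
  have F_tri: "F (\<lambda>a. x a + y a) \<le> F x + F y" for x y unfolding F_def matv_add by (rule triangle)
  have F_scale: "F (\<lambda>a. c * x a) = \<bar>c\<bar> * F x" for c x unfolding F_def matv_scale by (rule scale)
  have F_bound: "F x \<le> K * L2_set x {..<k}" for x
  proof -
    have "F x \<le> b * L2_set (matv k G x) {..<m}" unfolding F_def by (rule le_L2)
    also have "\<dots> \<le> b * (\<Sum>i<m. \<bar>matv k G x i\<bar>)" using b_pos L2_set_le_sum_abs by (intro mult_left_mono) auto
    also have "\<dots> \<le> b * (\<Sum>i<m. \<Sum>a<k. \<bar>G i a\<bar> * L2_set x {..<k})"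
    proof (intro mult_left_mono sum_mono)
      fix i
      have "\<bar>matv k G x i\<bar> \<le> (\<Sum>a<k. \<bar>x a * G i a\<bar>)" unfolding matv_def by (rule sum_abs)
      also have "\<dots> \<le> (\<Sum>a<k. \<bar>G i a\<bar> * L2_set x {..<k})"
      proof (rule sum_mono)
        fix a assume "a \<in> {..<k}"
        then have "\<bar>x a\<bar> \<le> L2_set x {..<k}" using member_le_L2_set[of "{..<k}" a "\<lambda>i. \<bar>x i\<bar>"] by (simp add: L2_set_def)
        then show "\<bar>x a * G i a\<bar> \<le> \<bar>G i a\<bar> * L2_set x {..<k}" 
            unfolding abs_mult mult.commute[of "\<bar>x a\<bar>"] by (rule mult_left_mono) simp
      qed
      finally show "\<bar>matv k G x i\<bar> \<le> \<dots>" .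
    qed (use b_pos in auto)
    also have "\<dots> = K * L2_set x {..<k}" unfolding K_def by (simp add: sum_distrib_right mult.assoc)
    finally show ?thesis .
  qed
  define U where "U = F ` {x. L2_set x {..<k} = 1}"
  have bdd: "bdd_above U"
  proof (rule bdd_aboveI[of _ K])
    fix v assume "v \<in> U"
    then obtain x where "v = F x" "L2_set x {..<k} = 1" unfolding U_def by blast
    then show "v \<le> K" using F_bound[of x] by simp
  qed
  have FS: "F z \<le> Sup U * L2_set z {..<k}" for z
  proof (cases "L2_set z {..<k} = 0")
    case True
    then show ?thesis using F_bound[of z] by simp
  next
    case False
    let ?c = "L2_set z {..<k}"
    have c: "?c > 0" using False L2_set_nonneg[of z "{..<k}"] by linarith
    let ?u = "\<lambda>a. (1 / ?c) * z a"
    have "L2_set ?u {..<k} = 1" using L2_set_right_distrib[of "1 / ?c" z "{..<k}"] c by simp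
    then have "F ?u \<le> Sup U" using bdd unfolding U_def by (intro cSup_upper) auto
    then show ?thesis unfolding F_scale using c by (simp add: field_simps)
  qed
  have key: "F x \<le> 45/32 * M + Sup U / 8 \<and> 3/4 * M * (7/8) - Sup U / 8 \<le> F x \<and> 0 \<le> Sup U" if x: "L2_set x {..<k} = 1" for x
  proof -
    obtain y where y: "y \<in> Y" "L2_set (\<lambda>i. x i - y i) {..<k} \<le> 1 / 8" using net[OF x] by blast
    let ?y = "L2_set y {..<k}"
    have "L2_set x {..<k} \<le> L2_set (\<lambda>i. x i - y i) {..<k} + ?y"
      using L2_set_triangle_ineq[of "\<lambda>i. x i - y i" y "{..<k}"] by simp
    then have y1: "7/8 \<le> ?y" using x y by simp
    have "?y \<le> L2_set (\<lambda>i. y i - x i) {..<k} + L2_set x {..<k}"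
      using L2_set_triangle_ineq[of "\<lambda>i. y i - x i" x "{..<k}"] by simp
    then have y2: "?y \<le> 9/8" using x y L2_set_diff_commute[of x y "{..<k}"] by simp
    have Fy: "3/4 * M * ?y \<le> F y" "F y \<le> 5/4 * M * ?y" using onY[OF y(1)] y1 unfolding F_def by auto
    have "3/4 * M * (7/8) \<le> 3/4 * M * ?y" "5/4 * M * ?y \<le> 5/4 * M * (9/8)" using y1 y2 M by auto
    then have Fy': "3/4 * M * (7/8) \<le> F y" "F y \<le> 45/32 * M" using Fy by auto
    have S0: "0 \<le> Sup U"
    proof -
      have "0 < F y" using Fy'(1) M by linarith
      then have "0 < Sup U * ?y" using FS[of y] by linarith
      then show ?thesis using y1 by (simp add: zero_less_mult_iff)
    qed
    have d: "F (\<lambda>i. x i - y i) \<le> Sup U / 8"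
    proof -
      have "Sup U * L2_set (\<lambda>i. x i - y i) {..<k} \<le> Sup U * (1 / 8)" using y(2) S0 by (rule mult_left_mono)
      then show ?thesis using FS[of "\<lambda>i. x i - y i"] by linarith
    qed
    have d': "F (\<lambda>i. y i - x i) = F (\<lambda>i. x i - y i)" using F_scale[of "-1" "\<lambda>i. x i - y i"] by simp
    have "F x \<le> F y + F (\<lambda>i. x i - y i)" "F y \<le> F x + F (\<lambda>i. y i - x i)"
      using F_tri[of y "\<lambda>i. x i - y i"] F_tri[of x "\<lambda>i. y i - x i"] by simp_all
    then show ?thesis using Fy' d d' S0 by linarith
  qed
  have "Sup U \<le> 45/32 * M + Sup U / 8"
    by (rule cSup_least) (use x key in \<open>auto simp: U_def\<close>)
  then show ?thesis using key[OF x] M unfolding F_def by linarith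
qed

text \<open>For a single unit vector \<open>x\<close>, \<open>N (G x)\<close> is distributed like \<open>N\<close> of a Gaussian vector, and deviates
  from the median by a quarter of it only with probability \<open>4 * exp (- 16 * k)\<close>, which is small enough
  for the \<open>768 ^ k\<close> points of the net. The conclusion is stated with an exceptional event, so that several
  norms can be treated with the same matrix.\<close>

lemma dvoretzky:
  assumes k: "k \<ge> 1" and \<mu>: "is_median \<mu>" and big: "32 * b * sqrt (real k) \<le> \<mu>"
  shows "\<exists>B\<in>sets (gaussM m k). measure (gaussM m k) B \<le> 1/3 \<and>
    (\<forall>G\<in>space (gaussM m k) - B. \<forall>x. L2_set x {..<k} = 1 \<longrightarrow>
       2/5 * \<mu> \<le> N (matv k G x) \<and> N (matv k G x) \<le> 2 * \<mu>)"
proof -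
  interpret M: prob_space "gaussM m k" by (rule prob_space_gaussM)
  have \<mu>0: "\<mu> > 0"
  proof -
    have "0 < 32 * b * sqrt (real k)" using b_pos k by simp
    then show ?thesis using big by linarith
  qed
  obtain Y where Y: "finite Y" "card Y \<le> 768 ^ k"
    "\<And>x. L2_set x {..<k} = 1 \<Longrightarrow> \<exists>y\<in>Y. L2_set (\<lambda>i. x i - y i) {..<k} \<le> 1 / 8"
    using sphere_net[OF k] by blast
  define Y' where "Y' = {y \<in> Y. L2_set y {..<k} \<noteq> 0}"
  define u where "u y = (\<lambda>a. (1 / L2_set y {..<k}) * y a)" for y :: "nat \<Rightarrow> real"
  have u1: "L2_set (u y) {..<k} = 1" if "y \<in> Y'" for y
    using L2_set_right_distrib[of "1 / L2_set y {..<k}" y "{..<k}"] that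
    unfolding u_def by (simp add: Y'_def L2_set_nonneg)
  define B where "B y = {G\<in>space (gaussM m k). \<mu> / 4 < \<bar>N (restrict (matv k G (u y)) {..<m}) - \<mu>\<bar>}" for y
  have ev: "{x\<in>space (gaussP {..<m}). \<mu> / 4 < \<bar>N x - \<mu>\<bar>} \<in> sets (gaussP {..<m})" by measurable
  have B_eq: "B y = (\<lambda>G. restrict (matv k G (u y)) {..<m}) -` {x\<in>space (gaussP {..<m}). \<mu> / 4 < \<bar>N x - \<mu>\<bar>} \<inter> space (gaussM m k)" for y
    unfolding B_def by (auto simp: space_PiM)
  have B_sets: "B y \<in> M.events" for y unfolding B_eq by (rule measurable_sets[OF measurable_matv ev])
  have B_prob: "M.prob (B y) \<le> 4 * exp (- 16 * real k)" if y: "y \<in> Y'" for y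
  proof -
    have "M.prob (B y) = measure (distr (gaussM m k) (gaussP {..<m}) (\<lambda>G. restrict (matv k G (u y)) {..<m})) {x\<in>space (gaussP {..<m}). \<mu> / 4 < \<bar>N x - \<mu>\<bar>}"
      unfolding B_eq by (rule measure_distr[OF measurable_matv ev, symmetric])
    also have "\<dots> = measure (gaussP {..<m}) {x\<in>space (gaussP {..<m}). \<mu> / 4 < \<bar>N x - \<mu>\<bar>}"
      unfolding distr_matv[OF u1[OF y]] ..
    also have "\<dots> \<le> 4 * exp (- ((\<mu> / 4)\<^sup>2 / (4 * b\<^sup>2)))" using \<mu>0 by (intro concentration \<mu>) auto
    also have "\<dots> \<le> 4 * exp (- 16 * real k)"
    proof -
      have "(32 * b * sqrt (real k))\<^sup>2 \<le> \<mu>\<^sup>2" using big b_pos by (intro power_mono) auto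
      then have "1024 * b\<^sup>2 * real k \<le> \<mu>\<^sup>2" by (simp add: power_mult_distrib)
      then have "16 * real k \<le> (\<mu> / 4)\<^sup>2 / (4 * b\<^sup>2)" using b_pos by (simp add: power_divide field_simps)
      then show ?thesis by simp
    qed
    finally show ?thesis .
  qed
  have fin: "finite Y'" using Y(1) by (simp add: Y'_def)
  have "card Y' \<le> card Y" unfolding Y'_def using Y(1) by (intro card_mono) auto
  then have cardY': "real (card Y') \<le> 768 ^ k" using Y(2) by (metis of_nat_le_iff of_nat_numeral of_nat_power order_trans)
  have "M.prob (\<Union>y\<in>Y'. B y) \<le> (\<Sum>y\<in>Y'. M.prob (B y))"
    using fin B_sets by (intro M.finite_measure_subadditive_finite) auto
  also have "\<dots> \<le> (\<Sum>y\<in>Y'. 4 * exp (- 16 * real k))" by (intro sum_mono B_prob)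
  also have "\<dots> = real (card Y') * (4 * exp (- 16 * real k))" by simp
  also have "\<dots> \<le> 768 ^ k * (4 * exp (- 16 * real k))" using cardY' by (intro mult_right_mono) auto
  also have "\<dots> \<le> 1 / 3"
  proof -
    have "(2 :: real) ^ 16 \<le> exp 1 ^ 16" using exp_ge_add_one_self[of 1] by (intro power_mono) auto
    also have "\<dots> = exp 16" by (simp flip: exp_of_nat_mult)
    finally have e16: "65536 \<le> exp (16 :: real)" by simp
    have "768 ^ k * (4 * exp (- 16 * real k)) = 4 * (768 * exp (- 16)) ^ k"
      by (simp add: power_mult_distrib exp_of_nat_mult[symmetric] mult.commute)
    also have "\<dots> \<le> 4 * (768 * (1 / 65536)) ^ k"
      using e16 by (intro mult_left_mono power_mono) (auto simp: exp_minus field_simps)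
    also have "\<dots> \<le> 4 * (768 * (1 / 65536)) ^ 1" using k by (intro mult_left_mono power_decreasing) auto
    also have "\<dots> \<le> 1 / 3" by simp
    finally show ?thesis .
  qed
  finally have P: "M.prob (\<Union>y\<in>Y'. B y) \<le> 1 / 3" .
  have "2/5 * \<mu> \<le> N (matv k G x) \<and> N (matv k G x) \<le> 2 * \<mu>"
    if G: "G \<in> space (gaussM m k) - (\<Union>y\<in>Y'. B y)" and x: "L2_set x {..<k} = 1" for G x
  proof (rule net_to_sphere[OF \<mu>0 Y(3) _ x])
    fix y assume y: "y \<in> Y" "L2_set y {..<k} \<noteq> 0"
    then have y': "y \<in> Y'" by (simp add: Y'_def)
    have c: "L2_set y {..<k} > 0" using y(2) L2_set_nonneg[of y "{..<k}"] by linarith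
    have near: "\<bar>N (matv k G (u y)) - \<mu>\<bar> \<le> \<mu> / 4"
      using G y' unfolding B_def N_restrict by (auto simp: not_less)
    have "matv k G y = (\<lambda>i. L2_set y {..<k} * matv k G (u y) i)"
      unfolding matv_scale[symmetric] u_def using c by simp
    then have eq: "N (matv k G y) = L2_set y {..<k} * N (matv k G (u y))" using c by (simp add: scale)
    have "3/4 * \<mu> \<le> N (matv k G (u y))" "N (matv k G (u y)) \<le> 5/4 * \<mu>" using near by linarith+
    then show "3/4 * \<mu> * L2_set y {..<k} \<le> N (matv k G y) \<and> N (matv k G y) \<le> 5/4 * \<mu> * L2_set y {..<k}"
      unfolding eq using c by (simp add: mult.commute mult_left_mono)
  qed
  then show ?thesis using P B_sets fin by (intro bexI[of _ "\<Union>y\<in>Y'. B y"]) auto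
qed

end

section \<open>Sums of zigzags over geometric scales\<close>

text \<open>Tents of height 1 and half-width 1 around the even integers, multiplied by the signs \<open>c n\<close>.\<close>

definition zigzag :: "(int \<Rightarrow> real) \<Rightarrow> real \<Rightarrow> real" where
  "zigzag c u = c \<lfloor>(u + 1) / 2\<rfloor> * (1 - \<bar>u - 2 * of_int \<lfloor>(u + 1) / 2\<rfloor>\<bar>)"

lemma zigzag_cell: "2 * of_int \<lfloor>(u + 1) / 2\<rfloor> - 1 \<le> u \<and> u < 2 * of_int \<lfloor>(u + 1) / 2\<rfloor> + (1::real)"
proof -
  have "of_int \<lfloor>(u + 1) / 2\<rfloor> \<le> (u + 1) / 2 \<and> (u + 1) / 2 < of_int \<lfloor>(u + 1) / 2\<rfloor> + 1"
    using floor_correct[of "(u + 1) / 2"] by linarith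
  then show ?thesis by (auto simp: field_simps)
qed

lemma zigzag_abs_le:
  assumes "\<And>n. \<bar>c n\<bar> \<le> 1"
  shows "\<bar>zigzag c u\<bar> \<le> 1 - \<bar>u - 2 * of_int \<lfloor>(u + 1) / 2\<rfloor>\<bar>"
proof -
  have "0 \<le> 1 - \<bar>u - 2 * of_int \<lfloor>(u + 1) / 2\<rfloor>\<bar>" using zigzag_cell[of u] by (simp add: abs_le_iff)
  then show ?thesis using mult_right_mono[OF assms[of "\<lfloor>(u + 1) / 2\<rfloor>"]]
    by (simp add: zigzag_def abs_mult)
qed

lemma zigzag_bounded:
  assumes "\<And>n. \<bar>c n\<bar> \<le> 1"
  shows "\<bar>zigzag c u\<bar> \<le> 1"
  using order_trans[OF zigzag_abs_le[of c u, OF assms]] by simp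

text \<open>Points in different tents are separated by a zero of the function, so each value is bounded by the
  distance to the boundary of its own tent.\<close>

lemma zigzag_lipschitz:
  assumes c: "\<And>n. \<bar>c n\<bar> \<le> 1"
  shows "\<bar>zigzag c u - zigzag c v\<bar> \<le> \<bar>u - v\<bar>"
proof -
  define a where "a = \<lfloor>(u + 1) / 2\<rfloor>"
  define b where "b = \<lfloor>(v + 1) / 2\<rfloor>"
  have ca: "2 * of_int a - 1 \<le> u" "u < 2 * of_int a + (1::real)" using zigzag_cell[of u] by (auto simp: a_def)
  have cb: "2 * of_int b - 1 \<le> v" "v < 2 * of_int b + (1::real)" using zigzag_cell[of v] by (auto simp: b_def)
  show ?thesis
  proof (cases "a = b")
    case True
    have "zigzag c u - zigzag c v = c a * (\<bar>v - 2 * of_int a\<bar> - \<bar>u - 2 * of_int a\<bar>)"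
      using True unfolding zigzag_def a_def[symmetric] b_def[symmetric] by (simp add: algebra_simps)
    also have "\<bar>\<dots>\<bar> \<le> 1 * \<bar>u - v\<bar>" unfolding abs_mult by (intro mult_mono c) auto
    finally show ?thesis by simp
  next
    case False
    have ua: "\<bar>zigzag c u\<bar> \<le> 1 - \<bar>u - 2 * of_int a\<bar>" and vb: "\<bar>zigzag c v\<bar> \<le> 1 - \<bar>v - 2 * of_int b\<bar>"
      using zigzag_abs_le[of c u] zigzag_abs_le[of c v] c unfolding a_def b_def by auto
    have "(1 - \<bar>u - 2 * of_int a\<bar>) + (1 - \<bar>v - 2 * of_int b\<bar>) \<le> \<bar>u - v\<bar>"
    proof (cases "a < b")
      case True
      then have "of_int a + 1 \<le> (of_int b :: real)" by linarith
      then show ?thesis using ca cb by linarith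
    next
      case False
      with \<open>a \<noteq> b\<close> have "of_int b + 1 \<le> (of_int a :: real)" by linarith
      then show ?thesis using ca cb by linarith
    qed
    then show ?thesis using ua vb by linarith
  qed
qed

lemma has_sum_geometric_pos_int:
  fixes b :: real
  assumes "b > 1"
  shows "((\<lambda>j::int. b powr (- of_int j)) has_sum (1 / (b - 1))) {1..}"
proof -
  have "(\<lambda>n. (1 / b) ^ n) sums (1 / (1 - 1 / b))" using assms by (intro geometric_sums) auto
  then have "(\<lambda>n. (1 / b) * (1 / b) ^ n) sums ((1 / b) * (1 / (1 - 1 / b)))" by (rule sums_mult)
  also have "(1 / b) * (1 / (1 - 1 / b)) = 1 / (b - 1)" using assms by (simp add: field_simps)
  finally have "((\<lambda>n::nat. (1 / b) * (1 / b) ^ n) has_sum (1 / (b - 1))) UNIV"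
    using assms by (intro sums_nonneg_imp_has_sum) auto
  also have "?this \<longleftrightarrow> ((\<lambda>j::int. b powr (- of_int j)) has_sum (1 / (b - 1))) {1..}"
  proof (rule has_sum_reindex_bij_witness[of _ "\<lambda>j. nat (j - 1)" "\<lambda>n. int n + 1"])
    fix n :: nat
    show "b powr - real_of_int (int n + 1) = 1 / b * (1 / b) ^ n"
    proof -
      have e: "real_of_int (int n + 1) = real (Suc n)" by simp
      have "b powr - real (Suc n) = inverse (b ^ Suc n)"
        using assms by (simp only: powr_minus powr_realpow)
      then show ?thesis unfolding e by (simp add: power_one_over inverse_eq_divide)
    qed
  qed auto
  finally show ?thesis .
qed

lemma has_sum_geometric_neg_int:
  fixes a :: real
  assumes "a > 1"
  shows "((\<lambda>j::int. a powr (of_int j)) has_sum (1 / (a - 1))) {..-1}"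
proof -
  have "((\<lambda>j::int. a powr (- of_int j)) has_sum (1 / (a - 1))) {1..}" by (rule has_sum_geometric_pos_int[OF assms])
  also have "?this \<longleftrightarrow> ?thesis"
    by (rule has_sum_reindex_bij_witness[of _ uminus uminus]) auto
  finally show ?thesis .
qed

text \<open>The value at 0 is subtracted for convergence at large scales, where the differences of the terms are
  controlled by the Lipschitz bound; at small scales they are controlled by the factor
  \<open>(\<rho> * L powr j) powr \<theta>\<close>.\<close>

definition scale_sum :: "(real \<Rightarrow> real) \<Rightarrow> real \<Rightarrow> real \<Rightarrow> real \<Rightarrow> real \<Rightarrow> real" where
  "scale_sum \<psi> \<theta> L \<rho> x =
     (\<Sum>\<^sub>\<infinity>j\<in>(UNIV :: int set). (\<rho> * L powr of_int j) powr \<theta> * (\<psi> (x / (\<rho> * L powr of_int j)) - \<psi> 0))"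

locale scale_profile =
  fixes \<psi> :: "real \<Rightarrow> real" and \<theta> L :: real
  assumes bounded: "\<bar>\<psi> u\<bar> \<le> 1" and lipschitz: "\<bar>\<psi> u - \<psi> v\<bar> \<le> \<bar>u - v\<bar>"
    and \<theta>: "0 < \<theta>" "\<theta> < 1" and L: "L > 1"
begin

definition tm where "tm \<rho> x j = (\<rho> * L powr of_int j) powr \<theta> * (\<psi> (x / (\<rho> * L powr of_int j)) - \<psi> 0)"

lemma L_powers: "L powr \<theta> > 1" "L powr (1 - \<theta>) > 1"
  using L \<theta> by (auto intro: gr_one_powr)

text \<open>Two geometric series: the scales below \<open>\<rho>\<close>, estimated by the bound for \<open>\<psi>\<close>, and those above
  it, estimated by the Lipschitz bound at distance \<open>\<delta>\<close>.\<close>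

definition err where
  "err \<rho> \<delta> = 2 * \<rho> powr \<theta> / (L powr \<theta> - 1) + \<delta> * \<rho> powr (\<theta> - 1) / (L powr (1 - \<theta>) - 1)"

lemma tm_diff_le:
  assumes "\<rho> > 0"
  shows "\<bar>tm \<rho> x j - tm \<rho> y j\<bar> \<le> 2 * \<rho> powr \<theta> * (L powr \<theta>) powr of_int j"
    "\<bar>tm \<rho> x j - tm \<rho> y j\<bar> \<le> \<bar>x - y\<bar> * \<rho> powr (\<theta> - 1) * (L powr (1 - \<theta>)) powr (- of_int j)"
proof -
  let ?R = "\<rho> * L powr of_int j"
  have R: "?R > 0" using assms L by simp
  have d: "tm \<rho> x j - tm \<rho> y j = ?R powr \<theta> * (\<psi> (x / ?R) - \<psi> (y / ?R))"
    by (simp add: tm_def algebra_simps)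
  have R\<theta>: "?R powr \<theta> = \<rho> powr \<theta> * (L powr \<theta>) powr of_int j"
    by (simp add: powr_mult powr_powr mult.commute)
  have "\<bar>\<psi> (x / ?R) - \<psi> (y / ?R)\<bar> \<le> 2" using bounded[of "x / ?R"] bounded[of "y / ?R"] by linarith
  then have "?R powr \<theta> * \<bar>\<psi> (x / ?R) - \<psi> (y / ?R)\<bar> \<le> ?R powr \<theta> * 2" by (rule mult_left_mono) simp
  then show "\<bar>tm \<rho> x j - tm \<rho> y j\<bar> \<le> 2 * \<rho> powr \<theta> * (L powr \<theta>) powr of_int j"
    unfolding d abs_mult R\<theta> by simp
  have "\<bar>\<psi> (x / ?R) - \<psi> (y / ?R)\<bar> \<le> \<bar>x - y\<bar> / ?R"
    using lipschitz[of "x / ?R" "y / ?R"] R by (simp add: diff_divide_distrib[symmetric] abs_divide)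
  then have "?R powr \<theta> * \<bar>\<psi> (x / ?R) - \<psi> (y / ?R)\<bar> \<le> ?R powr \<theta> * (\<bar>x - y\<bar> / ?R)" by (rule mult_left_mono) simp
  also have "\<dots> = \<bar>x - y\<bar> * ?R powr (\<theta> - 1)" using R by (simp add: powr_diff)
  also have "?R powr (\<theta> - 1) = \<rho> powr (\<theta> - 1) * (L powr (1 - \<theta>)) powr (- of_int j)"
    by (simp add: powr_mult powr_powr algebra_simps)
  finally show "\<bar>tm \<rho> x j - tm \<rho> y j\<bar> \<le> \<bar>x - y\<bar> * \<rho> powr (\<theta> - 1) * (L powr (1 - \<theta>)) powr (- of_int j)"
    unfolding d abs_mult by (simp add: mult.assoc)
qed

lemma tm_diff_has_sum:
  assumes \<rho>: "\<rho> > 0"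
  shows "\<exists>E. ((\<lambda>j. tm \<rho> x j - tm \<rho> y j) has_sum (\<rho> powr \<theta> * (\<psi> (x / \<rho>) - \<psi> (y / \<rho>)) + E)) UNIV \<and> \<bar>E\<bar> \<le> err \<rho> \<bar>x - y\<bar>"
proof -
  let ?\<delta> = "\<bar>x - y\<bar>"
  define e where "e j = (if j = 0 then 0 else tm \<rho> x j - tm \<rho> y j)" for j :: int
  define g where "g j = (if j = 0 then 0 else if j < 0 then 2 * \<rho> powr \<theta> * (L powr \<theta>) powr of_int j
     else ?\<delta> * \<rho> powr (\<theta> - 1) * (L powr (1 - \<theta>)) powr (- of_int j))" for j :: int
  have le: "norm (e j) \<le> g j" for j unfolding e_def g_def using tm_diff_le[OF \<rho>, of x j y] by auto
  have g: "(g has_sum err \<rho> ?\<delta>) UNIV"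
  proof -
    have n: "(g has_sum (2 * \<rho> powr \<theta> * (1 / (L powr \<theta> - 1)))) {..-1}"
      using has_sum_cmult_right[OF has_sum_geometric_neg_int[OF L_powers(1)], of "2 * \<rho> powr \<theta>"]
      by (rule has_sum_cong[THEN iffD1, rotated]) (auto simp: g_def)
    have p: "(g has_sum (?\<delta> * \<rho> powr (\<theta> - 1) * (1 / (L powr (1 - \<theta>) - 1)))) {1..}"
      using has_sum_cmult_right[OF has_sum_geometric_pos_int[OF L_powers(2)], of "?\<delta> * \<rho> powr (\<theta> - 1)"]
      by (rule has_sum_cong[THEN iffD1, rotated]) (auto simp: g_def)
    have dis: "{..-1::int} \<inter> {1..} = {}" by auto
    have "(g has_sum (err \<rho> ?\<delta>)) ({..-1} \<union> {1..})"
      using has_sum_Un_disjoint[OF n p dis] by (simp add: err_def)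
    then show ?thesis
      by (rule has_sum_cong_neutral[THEN iffD1, rotated -1]) (auto simp: g_def)
  qed
  have "(\<lambda>j. norm (e j)) summable_on UNIV"
    using has_sum_imp_summable[OF g] by (rule summable_on_comparison_test) (use le in auto)
  then have "e summable_on UNIV" by (rule abs_summable_summable)
  then obtain E where E: "(e has_sum E) UNIV" by (auto simp: summable_on_def)
  have "\<bar>E\<bar> \<le> err \<rho> ?\<delta>" using norm_infsum_le[OF E g] le by auto
  moreover have "((\<lambda>j. tm \<rho> x j - tm \<rho> y j) has_sum (\<rho> powr \<theta> * (\<psi> (x / \<rho>) - \<psi> (y / \<rho>)) + E)) UNIV"
  proof -
    have "((\<lambda>j. tm \<rho> x j - tm \<rho> y j) has_sum (tm \<rho> x 0 - tm \<rho> y 0)) {0::int}"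
      by (rule has_sum_finiteI) auto
    then have "((\<lambda>j::int. if j = 0 then tm \<rho> x 0 - tm \<rho> y 0 else 0) has_sum (tm \<rho> x 0 - tm \<rho> y 0)) UNIV"
      by (rule has_sum_cong_neutral[THEN iffD1, rotated -1]) auto
    from has_sum_add[OF this E] have "((\<lambda>j. tm \<rho> x j - tm \<rho> y j) has_sum (tm \<rho> x 0 - tm \<rho> y 0 + E)) UNIV"
      by (rule has_sum_cong[THEN iffD1, rotated]) (auto simp: e_def)
    moreover have "tm \<rho> x 0 - tm \<rho> y 0 = \<rho> powr \<theta> * (\<psi> (x / \<rho>) - \<psi> (y / \<rho>))"
      using \<rho> L by (simp add: tm_def algebra_simps)
    ultimately show ?thesis by simp
  qed
  ultimately show ?thesis by blast
qed

lemma tm_summable: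
  assumes "\<rho> > 0"
  shows "tm \<rho> x summable_on UNIV"
proof -
  have "tm \<rho> 0 j = 0" for j by (simp add: tm_def)
  then show ?thesis using tm_diff_has_sum[OF assms, of x 0] by (auto simp: summable_on_def)
qed

lemma scale_sum_diff:
  assumes "\<rho> > 0"
  shows "\<bar>scale_sum \<psi> \<theta> L \<rho> x - scale_sum \<psi> \<theta> L \<rho> y - \<rho> powr \<theta> * (\<psi> (x / \<rho>) - \<psi> (y / \<rho>))\<bar> \<le> err \<rho> \<bar>x - y\<bar>"
proof -
  obtain E where E: "((\<lambda>j. tm \<rho> x j - tm \<rho> y j) has_sum (\<rho> powr \<theta> * (\<psi> (x / \<rho>) - \<psi> (y / \<rho>)) + E)) UNIV"
    "\<bar>E\<bar> \<le> err \<rho> \<bar>x - y\<bar>" using tm_diff_has_sum[OF assms] by blast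
  have "scale_sum \<psi> \<theta> L \<rho> z = infsum (tm \<rho> z) UNIV" for z
    unfolding scale_sum_def tm_def[abs_def] ..
  moreover have "((\<lambda>j. tm \<rho> x j - tm \<rho> y j) has_sum (infsum (tm \<rho> x) UNIV - infsum (tm \<rho> y) UNIV)) UNIV"
    using has_sum_add[OF has_sum_infsum[OF tm_summable[OF assms, of x]]
        has_sum_cmult_right[OF has_sum_infsum[OF tm_summable[OF assms, of y]], of "-1"]]
    by simp
  ultimately show ?thesis using has_sum_unique[OF E(1)] E(2) by fastforce
qed

text \<open>The scales form a two-sided progression, so any of them may serve as the central one.\<close>

lemma scale_sum_shift:
  assumes "\<rho> > 0"
  shows "scale_sum \<psi> \<theta> L (\<rho> * L powr of_int i) = scale_sum \<psi> \<theta> L \<rho>"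
proof
  fix x
  have "scale_sum \<psi> \<theta> L \<rho> x = (\<Sum>\<^sub>\<infinity>j\<in>(UNIV :: int set). tm \<rho> x (i + j))"
    unfolding scale_sum_def tm_def
    by (rule infsum_reindex_bij_witness[of _ "\<lambda>j. i + j" "\<lambda>j. j - i"]) auto
  also have "\<dots> = scale_sum \<psi> \<theta> L (\<rho> * L powr of_int i) x"
    unfolding scale_sum_def tm_def by (simp add: powr_add mult.assoc)
  finally show "scale_sum \<psi> \<theta> L (\<rho> * L powr of_int i) x = scale_sum \<psi> \<theta> L \<rho> x" ..
qed

lemma scale_sum_center:
  assumes "\<rho> > 0" "R = \<rho> * L powr of_int i"
  shows "\<bar>scale_sum \<psi> \<theta> L \<rho> x - scale_sum \<psi> \<theta> L \<rho> y - R powr \<theta> * (\<psi> (x / R) - \<psi> (y / R))\<bar> \<le> err R \<bar>x - y\<bar>"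
  using scale_sum_diff[of R x y] scale_sum_shift[of \<rho> i] assms L by simp

text \<open>The central scale is taken to be the smallest one that exceeds \<open>|x - y|\<close>.\<close>

lemma scale_sum_holder:
  assumes \<rho>: "\<rho> > 0" and two: "L powr \<theta> \<ge> 2" "L powr (1 - \<theta>) \<ge> 2"
  shows "\<bar>scale_sum \<psi> \<theta> L \<rho> x - scale_sum \<psi> \<theta> L \<rho> y\<bar> \<le> 6 * \<bar>x - y\<bar> powr \<theta>"
proof (cases "x = y")
  case False
  define \<delta> where "\<delta> = \<bar>x - y\<bar>"
  have \<delta>: "\<delta> > 0" using False by (simp add: \<delta>_def)
  define i where "i = \<lfloor>log L (\<delta> / \<rho>)\<rfloor> + 1"
  define R where "R = \<rho> * L powr of_int i"
  have pl: "L powr log L (\<delta> / \<rho>) = \<delta> / \<rho>" using \<delta> \<rho> L by (intro powr_log_cancel) auto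
  have "L powr log L (\<delta> / \<rho>) \<le> L powr of_int i" using L unfolding i_def by (intro powr_mono) linarith+
  then have R1: "\<delta> \<le> R" unfolding R_def pl using \<rho> by (simp add: field_simps)
  have "L powr (of_int i - 1) \<le> L powr log L (\<delta> / \<rho>)" using L unfolding i_def by (intro powr_mono) linarith+
  then have R2: "R \<le> \<delta> * L" unfolding R_def pl using \<rho> L by (simp add: powr_diff field_simps)
  have R0: "R > 0" using R1 \<delta> by simp
  let ?t = "R powr \<theta> * (\<psi> (x / R) - \<psi> (y / R))"
  have c: "\<delta> * R powr (\<theta> - 1) \<le> \<delta> powr \<theta>"
  proof -
    have "\<delta> * R powr (\<theta> - 1) \<le> \<delta> * \<delta> powr (\<theta> - 1)" using R1 \<delta> \<theta> by (intro mult_left_mono powr_mono2') auto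
    also have "\<dots> = \<delta> powr \<theta>" using \<delta> by (simp add: powr_diff)
    finally show ?thesis .
  qed
  have t: "\<bar>?t\<bar> \<le> \<delta> powr \<theta>"
  proof -
    have "\<bar>\<psi> (x / R) - \<psi> (y / R)\<bar> \<le> \<delta> / R"
      using lipschitz[of "x / R" "y / R"] R0 by (simp add: \<delta>_def diff_divide_distrib[symmetric] abs_divide)
    then have "R powr \<theta> * \<bar>\<psi> (x / R) - \<psi> (y / R)\<bar> \<le> R powr \<theta> * (\<delta> / R)" by (rule mult_left_mono) simp
    also have "\<dots> = \<delta> * R powr (\<theta> - 1)" using R0 by (simp add: powr_diff)
    finally show ?thesis using c by (simp add: abs_mult)
  qed
  have "err R \<delta> \<le> 4 * \<delta> powr \<theta> + \<delta> powr \<theta>"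
    unfolding err_def
  proof (rule add_mono)
    let ?a = "L powr \<theta>"
    have "R powr \<theta> \<le> (\<delta> * L) powr \<theta>" using R2 R0 \<theta> by (intro powr_mono2) auto
    also have "\<dots> = \<delta> powr \<theta> * ?a" by (simp add: powr_mult)
    finally have "2 * R powr \<theta> / (?a - 1) \<le> 2 * (\<delta> powr \<theta> * ?a) / (?a - 1)" using two by (intro divide_right_mono) auto
    also have "\<dots> \<le> 4 * \<delta> powr \<theta>" 
    proof -
      have "?a \<le> 2 * (?a - 1)" using two by simp
      then have "\<delta> powr \<theta> * ?a \<le> \<delta> powr \<theta> * (2 * (?a - 1))" by (rule mult_left_mono) simp
      then show ?thesis using two by (simp add: divide_le_eq algebra_simps)
    qed
    finally show "2 * R powr \<theta> / (?a - 1) \<le> 4 * \<delta> powr \<theta>" .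
    have "\<delta> * R powr (\<theta> - 1) / (L powr (1 - \<theta>) - 1) \<le> \<delta> * R powr (\<theta> - 1) / 1"
      using two \<delta> by (intro divide_left_mono) auto
    then show "\<delta> * R powr (\<theta> - 1) / (L powr (1 - \<theta>) - 1) \<le> \<delta> powr \<theta>" using c by simp
  qed
  then show ?thesis using scale_sum_center[OF \<rho> R_def, of x y] t unfolding \<delta>_def[symmetric] by linarith
qed simp

end

section \<open>Codes and snowflakes of the line\<close>

text \<open>Weighting a subset \<open>D\<close> by \<open>(1 / 4) ^ card D\<close>, all weights add up to \<open>(5 / 4) ^ (8 * j)\<close>, and the sets
  counted here have weight at least \<open>(1 / 4) ^ j\<close>.\<close>

lemma card_small_subsets_le:
  "card {D. D \<subseteq> {..<8 * j} \<and> card D < j} \<le> 24 ^ j"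
proof -
  let ?n = "8 * j" and ?S = "{D. D \<subseteq> {..<8 * j} \<and> card D < j}"
  have "(\<Prod>i<?n. 1 / 4 + 1 :: real) = (\<Sum>X\<in>Pow {..<?n}. (\<Prod>i\<in>X. 1 / 4) * (\<Prod>i\<in>{..<?n} - X. 1))"
    by (rule prod_add) simp
  then have eq: "(5 / 4 :: real) ^ ?n = (\<Sum>X\<in>Pow {..<?n}. (1 / 4) ^ card X)" by simp
  have "real (card ?S) * (1 / 4) ^ j = (\<Sum>X\<in>?S. (1 / 4) ^ j)" by simp
  also have "\<dots> \<le> (\<Sum>X\<in>?S. (1 / 4) ^ card X)" by (intro sum_mono power_decreasing) auto
  also have "\<dots> \<le> (\<Sum>X\<in>Pow {..<?n}. (1 / 4) ^ card X)" by (intro sum_mono2) auto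
  also have "\<dots> = ((5 / 4) ^ 8) ^ j" unfolding eq[symmetric] by (simp add: power_mult)
  finally have "real (card ?S) \<le> ((5 / 4) ^ 8) ^ j * 4 ^ j" by (simp add: power_one_over divide_le_eq)
  also have "\<dots> = ((5 / 4) ^ 8 * 4) ^ j" by (simp add: power_mult_distrib)
  also have "\<dots> \<le> 24 ^ j" by (intro power_mono) (auto simp: power_numeral_even)
  finally show ?thesis by (metis of_nat_le_iff of_nat_numeral of_nat_power)
qed

text \<open>Greedy construction: as long as there are fewer than \<open>10 ^ j\<close> code words, the balls around them
  contain fewer than \<open>240 ^ j\<close> of the \<open>256 ^ j\<close> words.\<close>

lemma gilbert_varshamov:
  assumes "P \<le> 10 ^ j"
  shows "\<exists>c :: nat \<Rightarrow> nat set. (\<forall>a<P. c a \<subseteq> {..<8 * j}) \<and>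
    (\<forall>a<P. \<forall>b<P. a \<noteq> b \<longrightarrow> j \<le> card (sym_diff (c a) (c b)))"
  using assms
proof (induction P)
  case (Suc P)
  have "P \<le> 10 ^ j" using Suc.prems by simp
  from Suc.IH[OF this] obtain c :: "nat \<Rightarrow> nat set" where c: "\<And>a. a < P \<Longrightarrow> c a \<subseteq> {..<8 * j}"
    "\<And>a b. a < P \<Longrightarrow> b < P \<Longrightarrow> a \<noteq> b \<Longrightarrow> j \<le> card (sym_diff (c a) (c b))" by blast
  define Near where "Near a = {B. B \<subseteq> {..<8 * j} \<and> card (sym_diff (c a) B) < j}" for a
  have near: "card (Near a) \<le> 24 ^ j" if a: "a < P" for a
  proof -
    have "card (Near a) \<le> card {D. D \<subseteq> {..<8 * j} \<and> card D < j}"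
    proof (rule card_inj_on_le)
      show "inj_on (\<lambda>B. sym_diff (c a) B) (Near a)" by (rule inj_onI) blast
      show "(\<lambda>B. sym_diff (c a) B) ` Near a \<subseteq> {D. D \<subseteq> {..<8 * j} \<and> card D < j}"
        using c(1)[OF a] unfolding Near_def by blast
      show "finite {D. D \<subseteq> {..<8 * j} \<and> card D < j}" by (rule finite_subset[of _ "Pow {..<8 * j}"]) auto
    qed
    also have "\<dots> \<le> 24 ^ j" by (rule card_small_subsets_le)
    finally show ?thesis .
  qed
  have "card (\<Union>a<P. Near a) \<le> (\<Sum>a<P. card (Near a))" by (rule card_UN_le) simp
  also have "\<dots> \<le> (\<Sum>a<P. 24 ^ j)" using near by (intro sum_mono) auto
  also have "\<dots> = P * 24 ^ j" by simp
  also have "\<dots> < 10 ^ j * 24 ^ j" using Suc.prems by (intro mult_strict_right_mono) auto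
  also have "\<dots> = 240 ^ j" by (simp flip: power_mult_distrib)
  also have "\<dots> \<le> (256 :: nat) ^ j" by (intro power_mono) auto
  also have "\<dots> = card (Pow {..<8 * j})" by (simp add: card_Pow power_mult)
  finally have "card (\<Union>a<P. Near a) < card (Pow {..<8 * j})" .
  then have "\<not> Pow {..<8 * j} \<subseteq> (\<Union>a<P. Near a)"
    using card_mono[of "\<Union>a<P. Near a" "Pow {..<8 * j}"] finite_subset[of _ "Pow {..<8 * j}"]
    by (auto simp: Near_def not_less[symmetric])
  then obtain B where B0: "B \<subseteq> {..<8 * j}" "B \<notin> (\<Union>a<P. Near a)" by blast
  then have B: "B \<subseteq> {..<8 * j}" "\<And>a. a < P \<Longrightarrow> j \<le> card (sym_diff (c a) B)"
    unfolding Near_def by (simp, force simp: not_less)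
  have comm: "sym_diff X Y = sym_diff Y X" for X Y :: "nat set" by blast
  show ?case
    by (rule exI[of _ "c(P := B)"]) (use c B in \<open>auto simp: less_Suc_eq comm[of B]\<close>)
qed simp

text \<open>The factor \<open>j\<close> is independent of \<open>p\<close>. It counts the coordinates that are guaranteed to separate two
  points, so that \<open>a\<close> and \<open>b\<close> can be universal even if \<open>n\<close> is large and \<open>p\<close> is arbitrary.\<close>

definition line_snowflake :: "real \<Rightarrow> nat \<Rightarrow> nat \<Rightarrow> real \<Rightarrow> real \<Rightarrow> (nat \<Rightarrow> real \<Rightarrow> real) \<Rightarrow> bool" where
  "line_snowflake \<theta> n j a b \<Psi> \<longleftrightarrow> (\<forall>p x y. p \<ge> 1 \<longrightarrow>
     real j * (a * \<bar>x - y\<bar> powr \<theta>) powr p \<le> (\<Sum>r<n. \<bar>\<Psi> r x - \<Psi> r y\<bar> powr p)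
     \<and> (\<Sum>r<n. \<bar>\<Psi> r x - \<Psi> r y\<bar> powr p) \<le> real j * (b * \<bar>x - y\<bar> powr \<theta>) powr p)"

lemma line_snowflake_mono:
  assumes "line_snowflake \<theta> n j a b \<Psi>" "0 \<le> a'" "a' \<le> a" "0 \<le> b" "b \<le> b'"
  shows "line_snowflake \<theta> n j a' b' \<Psi>"
  unfolding line_snowflake_def
proof (intro allI impI conjI)
  fix p x y :: real assume p: "p \<ge> 1"
  let ?t = "\<bar>x - y\<bar> powr \<theta>" and ?s = "\<Sum>r<n. \<bar>\<Psi> r x - \<Psi> r y\<bar> powr p"
  have s: "real j * (a * ?t) powr p \<le> ?s" "?s \<le> real j * (b * ?t) powr p"
    using assms(1) p unfolding line_snowflake_def by blast+
  have "real j * (a' * ?t) powr p \<le> real j * (a * ?t) powr p"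
    using assms p by (intro mult_left_mono powr_mono2 mult_right_mono) auto
  then show "real j * (a' * ?t) powr p \<le> ?s" using s(1) by linarith
  have "real j * (b * ?t) powr p \<le> real j * (b' * ?t) powr p"
    using assms p by (intro mult_left_mono powr_mono2 mult_right_mono) auto
  then show "?s \<le> real j * (b' * ?t) powr p" using s(2) by linarith
qed

text \<open>\<open>K powr p \<ge> K\<close> turns the number of coordinates per separating coordinate into a factor of the
  Hoelder constant.\<close>

lemma snowflake_package:
  fixes \<Phi> :: "'e \<Rightarrow> real \<Rightarrow> real"
  assumes E: "finite E" "real (card E) \<le> K * real j" and j: "j \<ge> 1" and K: "K \<ge> 1"
    and upper: "\<And>e x y. e \<in> E \<Longrightarrow> \<bar>\<Phi> e x - \<Phi> e y\<bar> \<le> b * \<bar>x - y\<bar> powr \<theta>"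
    and lower: "\<And>x y. x \<noteq> y \<Longrightarrow> \<exists>S\<subseteq>E. j \<le> card S \<and> (\<forall>e\<in>S. a * \<bar>x - y\<bar> powr \<theta> \<le> \<bar>\<Phi> e x - \<Phi> e y\<bar>)"
    and ab: "a \<ge> 0" "b \<ge> 0"
  shows "\<exists>\<Psi> :: nat \<Rightarrow> real \<Rightarrow> real. line_snowflake \<theta> (card E) j a (K * b) \<Psi>"
proof -
  obtain h where h: "bij_betw h {..<card E} E"
    using ex_bij_betw_nat_finite[OF E(1)] by (auto simp: atLeast0LessThan)
  have "real j * (a * \<bar>x - y\<bar> powr \<theta>) powr p \<le> (\<Sum>r<card E. \<bar>\<Phi> (h r) x - \<Phi> (h r) y\<bar> powr p)
     \<and> (\<Sum>r<card E. \<bar>\<Phi> (h r) x - \<Phi> (h r) y\<bar> powr p) \<le> real j * (K * b * \<bar>x - y\<bar> powr \<theta>) powr p"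
    if p: "p \<ge> 1" for p x y
  proof -
    have eq: "(\<Sum>r<card E. \<bar>\<Phi> (h r) x - \<Phi> (h r) y\<bar> powr p) = (\<Sum>e\<in>E. \<bar>\<Phi> e x - \<Phi> e y\<bar> powr p)"
      using h by (rule sum.reindex_bij_betw)
    have lo: "real j * (a * \<bar>x - y\<bar> powr \<theta>) powr p \<le> (\<Sum>e\<in>E. \<bar>\<Phi> e x - \<Phi> e y\<bar> powr p)"
    proof (cases "x = y")
      case True
      then show ?thesis by simp
    next
      case False
      then obtain S where S: "S \<subseteq> E" "j \<le> card S" "\<And>e. e \<in> S \<Longrightarrow> a * \<bar>x - y\<bar> powr \<theta> \<le> \<bar>\<Phi> e x - \<Phi> e y\<bar>"
        using lower[of x y] by blast
      have "real j * (a * \<bar>x - y\<bar> powr \<theta>) powr p \<le> real (card S) * (a * \<bar>x - y\<bar> powr \<theta>) powr p"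
        using S(2) by (intro mult_right_mono) auto
      also have "\<dots> = (\<Sum>e\<in>S. (a * \<bar>x - y\<bar> powr \<theta>) powr p)" by simp
      also have "\<dots> \<le> (\<Sum>e\<in>S. \<bar>\<Phi> e x - \<Phi> e y\<bar> powr p)"
        using S(3) p ab by (intro sum_mono powr_mono2) auto
      also have "\<dots> \<le> (\<Sum>e\<in>E. \<bar>\<Phi> e x - \<Phi> e y\<bar> powr p)" using S(1) E by (intro sum_mono2) auto
      finally show ?thesis .
    qed
    have "(\<Sum>e\<in>E. \<bar>\<Phi> e x - \<Phi> e y\<bar> powr p) \<le> (\<Sum>e\<in>E. (b * \<bar>x - y\<bar> powr \<theta>) powr p)"
      using upper p by (intro sum_mono powr_mono2) auto
    also have "\<dots> = real (card E) * (b * \<bar>x - y\<bar> powr \<theta>) powr p" by simp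
    also have "\<dots> \<le> (K powr p * real j) * (b * \<bar>x - y\<bar> powr \<theta>) powr p"
    proof (rule mult_right_mono)
      have "K * real j \<le> K powr p * real j"
        using powr_mono[of 1 p K] K p by (intro mult_right_mono) auto
      then show "real (card E) \<le> K powr p * real j" using E(2) by linarith
    qed simp
    also have "\<dots> = real j * (K * b * \<bar>x - y\<bar> powr \<theta>) powr p" by (simp add: powr_mult mult_ac)
    finally show ?thesis unfolding eq using lo by blast
  qed
  then show ?thesis unfolding line_snowflake_def by (intro exI[of _ "\<lambda>r. \<Phi> (h r)"]) blast
qed

text \<open>At every point a tent around an even integer or one around an odd integer has height at least one half.\<close>

lemma zigzag_phase:
  fixes u :: real
  shows "\<exists>\<sigma>\<in>{0, 1::nat}. \<bar>(u + real \<sigma>) - 2 * of_int \<lfloor>(u + real \<sigma> + 1) / 2\<rfloor>\<bar> \<le> 1 / 2"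
proof -
  define m where "m = \<lfloor>(u + 1) / 2\<rfloor>"
  have m: "2 * of_int m - 1 \<le> u" "u < 2 * of_int m + (1::real)" using zigzag_cell[of u] by (auto simp: m_def)
  consider "\<bar>u - 2 * of_int m\<bar> \<le> 1 / 2" | "u - 2 * of_int m > 1 / 2" | "u - 2 * of_int m < - (1 / 2)" by linarith
  then show ?thesis
  proof cases
    case 1
    then show ?thesis unfolding m_def by auto
  next
    case 2
    have "\<lfloor>(u + real 1 + 1) / 2\<rfloor> = m + 1" using m 2 by (intro floor_unique) (auto simp: field_simps)
    then show ?thesis using m 2 by (intro bexI[of _ 1]) auto
  next
    case 3
    have "\<lfloor>(u + real 1 + 1) / 2\<rfloor> = m" using m 3 by (intro floor_unique) (auto simp: field_simps)
    then show ?thesis using m 3 by (intro bexI[of _ 1]) auto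
  qed
qed

lemma scale_profile_zigzag:
  assumes "\<And>n. \<bar>c n\<bar> \<le> 1" "0 < \<theta>" "\<theta> < 1" "L > 1"
  shows "scale_profile (\<lambda>u. zigzag c (u + t)) \<theta> L"
proof
  show "\<bar>zigzag c (u + t)\<bar> \<le> 1" for u using zigzag_bounded assms(1) by blast
  show "\<bar>zigzag c (u + t) - zigzag c (v + t)\<bar> \<le> \<bar>u - v\<bar>" for u v
    using zigzag_lipschitz[of c "u + t" "v + t"] assms(1) by simp
qed (use assms in auto)

text \<open>The scales \<open>8 powr (i / \<theta>)\<close> are distributed over four progressions according to \<open>i mod 4\<close>, each of them
  with ratio \<open>L\<close>. For two points at distance \<open>\<delta>\<close> the scale \<open>R\<close> with \<open>2 * R \<le> \<delta> < 2 * R * b\<close> is used: the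
  points lie in different tents, whose numbers differ by less than \<open>P\<close>, so they carry different code words.
  At each of the at least \<open>j\<close> coordinates where the code words differ, the tents have opposite signs and
  the values cannot cancel. The other scales of the same progression are too far away to interfere:
  the exponent is at most one half, which keeps \<open>L powr (1 - \<theta>)\<close> far above the range \<open>2 * b\<close> of \<open>\<delta> / R\<close>.\<close>

lemma snowflake_line_small_exponent:
  assumes \<theta>: "0 < \<theta>" "\<theta> \<le> 1 / 2"
  shows "\<exists>n j (\<Psi> :: nat \<Rightarrow> real \<Rightarrow> real). 1 \<le> n \<and> real n \<le> 192 / \<theta> \<and> 1 \<le> (j::nat) \<and> line_snowflake \<theta> n j (1 / 64) (64 * 6) \<Psi>"
proof -
  define b where "b = 8 powr (1 / \<theta>)"
  define L where "L = 8 powr (4 / \<theta>)"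
  define j where "j = nat \<lceil>2 / \<theta>\<rceil>"
  define P :: nat where "P = 10 ^ j"
  have jr: "2 / \<theta> \<le> real j" "real j \<le> 2 / \<theta> + 1"
  proof -
    have "0 < 2 / \<theta>" using \<theta> by simp
    then have "0 \<le> \<lceil>2 / \<theta>\<rceil>" by linarith
    then have "real j = of_int \<lceil>2 / \<theta>\<rceil>" unfolding j_def by simp
    then show "2 / \<theta> \<le> real j" "real j \<le> 2 / \<theta> + 1" by linarith+
  qed
  have t2: "2 \<le> 1 / \<theta>" using \<theta> by (simp add: field_simps)
  have j1: "1 \<le> j" 
  proof -
    have "2 / \<theta> = 2 * (1 / \<theta>)" by simp
    then have "1 \<le> real j" using jr(1) t2 by linarith
    then show ?thesis by simp
  qed
  have b64: "64 \<le> b" using powr_mono[of 2 "1 / \<theta>" "8::real"] t2 by (simp add: b_def)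
  have PB: "b + 2 \<le> real P"
  proof -
    have "b * b = 8 powr (2 / \<theta>)" unfolding b_def by (simp flip: powr_add)
    also have "\<dots> \<le> 10 powr (2 / \<theta>)" using \<theta> by (intro powr_mono2) auto
    also have "\<dots> \<le> 10 powr real j" using jr by (intro powr_mono) auto
    also have "\<dots> = real P" unfolding P_def by (simp add: powr_realpow)
    finally have "b * b \<le> real P" .
    moreover have "b + 2 \<le> b * 2" using b64 by simp
    moreover have "b * 2 \<le> b * b" using b64 by (intro mult_left_mono) auto
    ultimately show ?thesis by linarith
  qed
  have L1: "L > 1" unfolding L_def using \<theta> by (intro gr_one_powr) auto
  have L\<theta>: "L powr \<theta> = 4096" unfolding L_def using \<theta> by (simp add: powr_powr)
  have L\<theta>': "b * b \<le> L powr (1 - \<theta>)"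
  proof -
    have "b * b = 8 powr (2 / \<theta>)" unfolding b_def by (simp flip: powr_add)
    also have "\<dots> \<le> 8 powr (4 / \<theta> * (1 - \<theta>))" using \<theta> by (intro powr_mono) (auto simp: field_simps)
    finally show ?thesis unfolding L_def by (simp add: powr_powr)
  qed
  obtain c :: "nat \<Rightarrow> nat set" where c: "\<And>a. a < P \<Longrightarrow> c a \<subseteq> {..<8 * j}"
    "\<And>a b. a < P \<Longrightarrow> b < P \<Longrightarrow> a \<noteq> b \<Longrightarrow> j \<le> card (sym_diff (c a) (c b))"
    using gilbert_varshamov[of P j, OF eq_refl[OF P_def]] by blast
  define \<epsilon> where "\<epsilon> r n = (if r \<in> c (nat (n mod int P)) then 1 else - 1 :: real)" for r :: nat and n :: int
  have \<epsilon>1: "\<bar>\<epsilon> r n\<bar> \<le> 1" for r n by (simp add: \<epsilon>_def)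
  define E where "E = {..<4::nat} \<times> {0, 1::nat} \<times> {..<8 * j}"
  define \<psi> where "\<psi> \<sigma> r u = zigzag (\<epsilon> r) (u + real \<sigma>)" for \<sigma> r :: nat and u :: real
  have prof: "scale_profile (\<psi> \<sigma> r) \<theta> L" for \<sigma> r
    unfolding \<psi>_def by (rule scale_profile_zigzag) (use \<epsilon>1 \<theta> L1 in auto)
  define \<Phi> where "\<Phi> = (\<lambda>(l, \<sigma>, r). scale_sum (\<psi> \<sigma> r) \<theta> L (8 powr (real l / \<theta>)))"
  have cardE: "card E = 64 * j" unfolding E_def by (simp add: card_cartesian_product)
  have up: "\<bar>\<Phi> e x - \<Phi> e y\<bar> \<le> 6 * \<bar>x - y\<bar> powr \<theta>" for e x y
  proof -
    obtain l \<sigma> r where e: "e = (l, \<sigma>, r)" by (cases e)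
    interpret scale_profile "\<psi> \<sigma> r" \<theta> L by (rule prof)
    have "2 \<le> L powr (1 - \<theta>)" using L\<theta>' b64 mult_mono[of 64 b 64 b] by linarith
    then show ?thesis unfolding \<Phi>_def e using scale_sum_holder[of "8 powr (real l / \<theta>)" x y] L\<theta> by simp
  qed
  have lo: "\<exists>S\<subseteq>E. j \<le> card S \<and> (\<forall>e\<in>S. 1 / 64 * \<bar>x - y\<bar> powr \<theta> \<le> \<bar>\<Phi> e x - \<Phi> e y\<bar>)" if xy: "x \<noteq> y" for x y
  proof -
    define \<delta> where "\<delta> = \<bar>x - y\<bar>"
    have \<delta>: "\<delta> > 0" using xy by (simp add: \<delta>_def)
    define i where "i = \<lfloor>\<theta> * log 8 (\<delta> / 2)\<rfloor>"
    define R where "R = 8 powr (of_int i / \<theta>)"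
    have R0: "R > 0" by (simp add: R_def)
    have R1: "2 * R \<le> \<delta>"
    proof -
      have "of_int i / \<theta> \<le> log 8 (\<delta> / 2)" using \<theta> unfolding i_def by (simp add: pos_divide_le_eq mult.commute)
      then have "R \<le> 8 powr log 8 (\<delta> / 2)" unfolding R_def by (intro powr_mono) auto
      also have "\<dots> = \<delta> / 2" using \<delta> by (intro powr_log_cancel) auto
      finally show ?thesis by simp
    qed
    have R2: "\<delta> < 2 * R * b"
    proof -
      have "\<theta> * log 8 (\<delta> / 2) < of_int i + 1" unfolding i_def by linarith
      then have "log 8 (\<delta> / 2) < (of_int i + 1) / \<theta>" using \<theta> by (simp add: pos_less_divide_eq mult.commute)
      then have "8 powr log 8 (\<delta> / 2) < 8 powr ((of_int i + 1) / \<theta>)" by (intro powr_less_mono) auto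
      also have "\<dots> = R * b" unfolding R_def b_def by (simp add: add_divide_distrib powr_add)
      finally show ?thesis using \<delta> by simp
    qed
    define l where "l = nat (i mod 4)"
    have Rl: "R = 8 powr (real l / \<theta>) * L powr of_int (i div 4)"
    proof -
      have "i = 4 * (i div 4) + int l" unfolding l_def by simp
      then have "of_int i = 4 * of_int (i div 4) + real l" by (metis of_int_add of_int_mult of_int_numeral of_int_of_nat_eq)
      then have "of_int i / \<theta> = real l / \<theta> + 4 / \<theta> * of_int (i div 4)" by (simp add: add_divide_distrib)
      then show ?thesis unfolding R_def L_def by (simp add: powr_add powr_powr)
    qed
    obtain \<sigma> where \<sigma>: "\<sigma> \<in> {0, 1::nat}" "\<bar>(x / R + real \<sigma>) - 2 * of_int \<lfloor>(x / R + real \<sigma> + 1) / 2\<rfloor>\<bar> \<le> 1 / 2"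
      using zigzag_phase[of "x / R"] by blast
    define A where "A = \<lfloor>(x / R + real \<sigma> + 1) / 2\<rfloor>"
    define B where "B = \<lfloor>(y / R + real \<sigma> + 1) / 2\<rfloor>"
    have cA: "2 * of_int A - 1 \<le> x / R + real \<sigma>" "x / R + real \<sigma> < 2 * of_int A + 1" 
      using zigzag_cell[of "x / R + real \<sigma>"] by (auto simp: A_def)
    have cB: "2 * of_int B - 1 \<le> y / R + real \<sigma>" "y / R + real \<sigma> < 2 * of_int B + 1" 
      using zigzag_cell[of "y / R + real \<sigma>"] by (auto simp: B_def)
    have quot: "\<bar>x / R - y / R\<bar> = \<delta> / R" using R0 by (simp add: \<delta>_def diff_divide_distrib[symmetric] abs_divide)
    have q2: "2 \<le> \<bar>x / R - y / R\<bar>" "\<bar>x / R - y / R\<bar> < 2 * b"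
      unfolding quot using R0 R1 R2 by (auto simp: field_simps)
    have AB: "A \<noteq> B" using q2(1) cA cB by auto
    have "\<bar>of_int A - of_int B\<bar> < b + (1::real)" using q2(2) cA cB by linarith
    then have "\<bar>A - B\<bar> < int P" using PB by linarith
    \<comment> \<open>Different numbers at distance less than \<open>P\<close> remain different modulo \<open>P\<close>.\<close>
    then have modne: "A mod int P \<noteq> B mod int P"
      using AB by (metis mod_eq_dvd_iff zdvd_imp_le zero_less_abs_iff dvd_abs_iff right_minus_eq not_less)
    have P0: "0 < int P" by (simp add: P_def)
    define a' where "a' = nat (A mod int P)"
    define b' where "b' = nat (B mod int P)"
    have a'b': "a' < P" "b' < P" "a' \<noteq> b'" using modne P0 unfolding a'_def b'_def by (auto simp: nat_less_iff eq_nat_nat_iff)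
    define S where "S = (\<lambda>r. (l, \<sigma>, r)) ` sym_diff (c a') (c b')"
    have "S \<subseteq> E" unfolding S_def E_def using c(1)[OF a'b'(1)] c(1)[OF a'b'(2)] \<sigma>(1) by (auto simp: l_def)
    moreover have "j \<le> card S"
      unfolding S_def using c(2)[OF a'b'] by (subst card_image) (auto simp: inj_on_def)
    moreover have "1 / 64 * \<delta> powr \<theta> \<le> \<bar>\<Phi> e x - \<Phi> e y\<bar>" if eS: "e \<in> S" for e
    proof -
      obtain r where e: "e = (l, \<sigma>, r)" and r: "r \<in> sym_diff (c a') (c b')" using eS unfolding S_def by blast
      interpret scale_profile "\<psi> \<sigma> r" \<theta> L by (rule prof)
      have \<epsilon>AB: "\<epsilon> r B = - \<epsilon> r A" "\<bar>\<epsilon> r A\<bar> = 1" using r unfolding \<epsilon>_def a'_def b'_def by auto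
      let ?ta = "1 - \<bar>x / R + real \<sigma> - 2 * of_int A\<bar>" and ?tb = "1 - \<bar>y / R + real \<sigma> - 2 * of_int B\<bar>"
      have "\<psi> \<sigma> r (x / R) - \<psi> \<sigma> r (y / R) = \<epsilon> r A * ?ta - \<epsilon> r B * ?tb"
        unfolding \<psi>_def zigzag_def A_def B_def by simp
      also have "\<dots> = \<epsilon> r A * (?ta + ?tb)" unfolding \<epsilon>AB by (simp add: algebra_simps)
      finally have "\<bar>\<psi> \<sigma> r (x / R) - \<psi> \<sigma> r (y / R)\<bar> = \<bar>?ta + ?tb\<bar>" by (simp add: abs_mult \<epsilon>AB)
      moreover have "1 / 2 \<le> ?ta" using \<sigma>(2) unfolding A_def by linarith
      moreover have "0 \<le> ?tb" using cB by linarith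
      ultimately have "1 / 2 \<le> \<bar>\<psi> \<sigma> r (x / R) - \<psi> \<sigma> r (y / R)\<bar>" by linarith
      then have main: "R powr \<theta> * (1 / 2) \<le> \<bar>R powr \<theta> * (\<psi> \<sigma> r (x / R) - \<psi> \<sigma> r (y / R))\<bar>"
        unfolding abs_mult by (intro mult_mono) auto
      have powr_pos: "0 < (8 :: real) powr (real l / \<theta>)" by simp
      have "err R \<delta> \<le> R powr \<theta> * (1 / 4)"
      proof -
        have "\<delta> * R powr (\<theta> - 1) \<le> (2 * R * b) * R powr (\<theta> - 1)" using R2 by (intro mult_right_mono) auto
        also have "\<dots> = R powr \<theta> * (2 * b)" using R0 by (simp add: powr_diff)
        finally have n: "\<delta> * R powr (\<theta> - 1) \<le> R powr \<theta> * (2 * b)" .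
        have "64 * b \<le> b * b" using b64 by (intro mult_right_mono) auto
        then have "32 * b \<le> L powr (1 - \<theta>) - 1" using L\<theta>' b64 by linarith
        then have "\<delta> * R powr (\<theta> - 1) / (L powr (1 - \<theta>) - 1) \<le> (R powr \<theta> * (2 * b)) / (32 * b)"
          using n b64 \<delta> by (intro frac_le) auto
        also have "\<dots> = R powr \<theta> * (1 / 16)" using b64 by simp
        finally have "\<delta> * R powr (\<theta> - 1) / (L powr (1 - \<theta>) - 1) \<le> R powr \<theta> * (1 / 16)" .
        moreover have "2 * R powr \<theta> / (4096 - 1) \<le> R powr \<theta> * (1 / 8)" by simp
        moreover have "0 \<le> R powr \<theta>" by simp
        ultimately show ?thesis unfolding err_def L\<theta> by linarith
      qed
      then have "R powr \<theta> * (1 / 4) \<le> \<bar>\<Phi> e x - \<Phi> e y\<bar>"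
        using scale_sum_center[OF powr_pos Rl, of x y] main unfolding \<Phi>_def e \<delta>_def[symmetric] prod.case by linarith
      moreover have "\<delta> powr \<theta> \<le> 16 * R powr \<theta>"
      proof -
        have "\<delta> powr \<theta> \<le> (2 * R * b) powr \<theta>" using R2 \<delta> \<theta> by (intro powr_mono2) auto
        also have "\<dots> = 2 powr \<theta> * R powr \<theta> * 8" unfolding b_def using \<theta> by (simp add: powr_mult powr_powr)
        also have "\<dots> \<le> 2 * R powr \<theta> * 8" using powr_mono[of \<theta> 1 "2::real"] \<theta> by (intro mult_right_mono) auto
        finally show ?thesis by simp
      qed
      ultimately show ?thesis by linarith
    qed
    ultimately show ?thesis unfolding \<delta>_def by blast
  qed
  have "\<exists>\<Psi> :: nat \<Rightarrow> real \<Rightarrow> real. line_snowflake \<theta> (card E) j (1 / 64) (64 * 6) \<Psi>"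
  proof (rule snowflake_package[where \<Phi> = \<Phi>])
    show "finite E" by (simp add: E_def)
    show "real (card E) \<le> 64 * real j" by (simp add: cardE)
  qed (use up lo j1 in auto)
  moreover have "real (card E) \<le> 192 / \<theta>"
  proof -
    have "real (card E) \<le> 64 * (2 / \<theta> + 1)" using jr(2) by (simp add: cardE)
    also have "\<dots> \<le> 192 / \<theta>" using t2 \<theta> by (simp add: field_simps)
    finally show ?thesis .
  qed
  moreover have "1 \<le> card E" using j1 by (simp add: cardE)
  ultimately show ?thesis using j1 by blast
qed

text \<open>With alternating signs the zigzag is a triangle wave: it is linear between consecutive even integers,
  across the zero at the odd integer between them.\<close>

lemma alternating_zigzag_linear:
  fixes u v :: real and n :: int
  defines "c \<equiv> \<lambda>n :: int. if even n then 1 else - 1 :: real"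
  assumes "2 * of_int n \<le> u" "u \<le> 2 * of_int n + 2"
  shows "zigzag c u = c n * (1 + 2 * of_int n - u)"
proof (cases "u < 2 * of_int n + 1")
  case True
  then have f: "\<lfloor>(u + 1) / 2\<rfloor> = n" using assms by (intro floor_unique) (auto simp: field_simps)
  then show ?thesis using assms by (simp add: zigzag_def)
next
  case False
  then have f: "\<lfloor>(u + 1) / 2\<rfloor> = n + 1" using assms by (intro floor_unique) (auto simp: field_simps)
  have "c (n + 1) = - c n" by (simp add: c_def)
  then show ?thesis unfolding zigzag_def f using assms by (simp add: algebra_simps)
qed

text \<open>An interval of length less than 1 contains at most one integer, so one of the two triangle waves has
  no corner inside it.\<close>

lemma alternating_zigzag_isometric:
  fixes u v :: real
  defines "c \<equiv> \<lambda>n :: int. if even n then 1 else - 1 :: real"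
  assumes uv: "\<bar>u - v\<bar> < 1"
  shows "\<exists>\<sigma>\<in>{0, 1::nat}. \<bar>zigzag c (u + real \<sigma>) - zigzag c (v + real \<sigma>)\<bar> = \<bar>u - v\<bar>"
  using uv
proof (induction u v rule: linorder_wlog)
  case (le u v)
  have iso: "\<bar>zigzag c s - zigzag c t\<bar> = \<bar>s - t\<bar>"
    if "2 * of_int n \<le> s" "s \<le> 2 * of_int n + 2" "2 * of_int n \<le> t" "t \<le> 2 * of_int n + 2" for s t :: real and n :: int
  proof -
    have "zigzag c s - zigzag c t = c n * (t - s)"
      unfolding c_def using alternating_zigzag_linear[OF that(1,2)] alternating_zigzag_linear[OF that(3,4)]
      by (simp add: algebra_simps)
    then show ?thesis by (simp add: abs_mult c_def abs_minus_commute)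
  qed
  define n where "n = \<lfloor>u / 2\<rfloor>"
  have n: "2 * of_int n \<le> u" "u < 2 * of_int n + 2" unfolding n_def by linarith+
  show ?case
  proof (cases "v \<le> 2 * of_int n + 2")
    case True
    then show ?thesis using iso[of n u v] n le by (intro bexI[of _ 0]) auto
  next
    case False
    then show ?thesis using iso[of "n + 1" "u + 1" "v + 1"] n le by (intro bexI[of _ 1]) auto
  qed
next
  case (sym u v)
  then show ?case by (metis abs_minus_commute)
qed

text \<open>As \<open>\<theta>\<close> tends to 1 the slopes \<open>R powr (\<theta> - 1)\<close> vary slowly with \<open>R\<close>, so the ratio \<open>L\<close> is chosen such that
  they drop by the factor 4096 from one scale to the next. At distances between \<open>R / L powr (1 / 3)\<close> and \<open>R\<close>
  the zigzag of wavelength \<open>R\<close> is linear and dominates: larger scales have much smaller slopes, and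
  the smaller ones have amplitudes well below \<open>R powr \<theta> / L powr (1 / 3)\<close>. Three progressions, shifted by powers of
  \<open>L powr (1 / 3)\<close>, cover all distances.\<close>

lemma snowflake_line_large_exponent:
  assumes \<theta>: "1 / 2 \<le> \<theta>" "\<theta> < 1"
  shows "\<exists>n j (\<Psi> :: nat \<Rightarrow> real \<Rightarrow> real). 1 \<le> n \<and> real n \<le> 192 / \<theta> \<and> 1 \<le> (j::nat) \<and> line_snowflake \<theta> n j (1 / 32) (6 * 6) \<Psi>"
proof -
  define L where "L = 4096 powr (1 / (1 - \<theta>))"
  have L1: "L > 1" unfolding L_def using \<theta> by (intro gr_one_powr) auto
  have L\<theta>': "L powr (1 - \<theta>) = 4096" unfolding L_def using \<theta> by (simp add: powr_powr)
  have L6: "16 \<le> L powr (1 / 6)"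
  proof -
    have "(16 :: real) = (16 powr 3) powr (1 / 3)" by (simp only: powr_powr) simp
    also have "(16 :: real) powr 3 = 4096" by simp
    also have "(4096 :: real) powr (1 / 3) \<le> 4096 powr (1 / (1 - \<theta>) * (1 / 6))"
      using \<theta> by (intro powr_mono) (auto simp: field_simps)
    finally show ?thesis unfolding L_def by (simp only: powr_powr)
  qed
  have L\<theta>: "16 * L powr (1 / 3) \<le> L powr \<theta>"
  proof -
    have "16 * L powr (1 / 3) \<le> L powr (1 / 6) * L powr (1 / 3)" using L6 by (intro mult_right_mono) auto
    also have "\<dots> = L powr (1 / 2)" by (simp flip: powr_add)
    also have "\<dots> \<le> L powr \<theta>" using \<theta> L1 by (intro powr_mono) auto
    finally show ?thesis .
  qed
  have L3: "1 \<le> L powr (1 / 3)" using L1 by (intro ge_one_powr_ge_zero) auto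
  define c where "c = (\<lambda>n :: int. if even n then 1 else - 1 :: real)"
  define \<psi> where "\<psi> \<sigma> u = zigzag c (u + real \<sigma>)" for \<sigma> :: nat and u :: real
  have prof: "scale_profile (\<psi> \<sigma>) \<theta> L" for \<sigma>
    unfolding \<psi>_def by (rule scale_profile_zigzag) (use \<theta> L1 in \<open>auto simp: c_def\<close>)
  define E where "E = {..<3::nat} \<times> {0, 1::nat}"
  define \<Phi> where "\<Phi> = (\<lambda>(l, \<sigma>). scale_sum (\<psi> \<sigma>) \<theta> L (L powr (real l / 3)))"
  have cardE: "card E = 6" unfolding E_def by (simp add: card_cartesian_product)
  have up: "\<bar>\<Phi> e x - \<Phi> e y\<bar> \<le> 6 * \<bar>x - y\<bar> powr \<theta>" for e x y
  proof -
    obtain l \<sigma> where e: "e = (l, \<sigma>)" by (cases e)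
    interpret scale_profile "\<psi> \<sigma>" \<theta> L by (rule prof)
    have "2 \<le> L powr \<theta>" using L\<theta> L3 by linarith
    then show ?thesis unfolding \<Phi>_def e using scale_sum_holder[of "L powr (real l / 3)" x y] L\<theta>' L1 by simp
  qed
  have lo: "\<exists>e\<in>E. 1 / 32 * \<bar>x - y\<bar> powr \<theta> \<le> \<bar>\<Phi> e x - \<Phi> e y\<bar>" if xy: "x \<noteq> y" for x y
  proof -
    define \<delta> where "\<delta> = \<bar>x - y\<bar>"
    have \<delta>: "\<delta> > 0" using xy by (simp add: \<delta>_def)
    define i where "i = \<lfloor>3 * log L \<delta>\<rfloor> + 1"
    define R where "R = L powr (of_int i / 3)"
    have R0: "R > 0" using L1 by (simp add: R_def)
    have pl: "L powr log L \<delta> = \<delta>" using \<delta> L1 by (intro powr_log_cancel) auto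
    have i: "3 * log L \<delta> < of_int i" "of_int i \<le> 3 * log L \<delta> + 1" unfolding i_def by linarith+
    have R1: "\<delta> < R"
    proof -
      have "L powr log L \<delta> < R" unfolding R_def using i L1 by (intro powr_less_mono) auto
      then show ?thesis using pl by simp
    qed
    have R2: "R \<le> \<delta> * L powr (1 / 3)"
    proof -
      have "R \<le> L powr (log L \<delta> + 1 / 3)" unfolding R_def using i L1 by (intro powr_mono) auto
      then show ?thesis using pl by (simp add: powr_add)
    qed
    define l where "l = nat (i mod 3)"
    have Rl: "R = L powr (real l / 3) * L powr of_int (i div 3)"
    proof -
      have "i = 3 * (i div 3) + int l" unfolding l_def by simp
      then have "of_int i = 3 * of_int (i div 3) + real l" by (metis of_int_add of_int_mult of_int_numeral of_int_of_nat_eq)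
      then have "of_int i / 3 = real l / 3 + of_int (i div 3)" by simp
      then show ?thesis by (simp only: R_def powr_add)
    qed
    have quot: "\<bar>x / R - y / R\<bar> = \<delta> / R" using R0 by (simp add: \<delta>_def diff_divide_distrib[symmetric] abs_divide)
    have "\<bar>x / R - y / R\<bar> < 1" unfolding quot using R0 R1 by simp
    from alternating_zigzag_isometric[OF this] obtain \<sigma> where \<sigma>: "\<sigma> \<in> {0, 1::nat}"
      "\<bar>\<psi> \<sigma> (x / R) - \<psi> \<sigma> (y / R)\<bar> = \<delta> / R" unfolding \<psi>_def c_def quot by blast
    interpret scale_profile "\<psi> \<sigma>" \<theta> L by (rule prof)
    let ?m = "\<delta> * R powr (\<theta> - 1)"
    have main: "\<bar>R powr \<theta> * (\<psi> \<sigma> (x / R) - \<psi> \<sigma> (y / R))\<bar> = ?m"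
      unfolding abs_mult \<sigma>(2) using R0 by (simp add: powr_diff)
    have powr_pos: "0 < L powr (real l / 3)" using L1 by simp
    \<comment> \<open>One quarter for the smaller scales and one for the larger ones.\<close>
    have "err R \<delta> \<le> 1 / 4 * ?m + 1 / 4 * ?m"
      unfolding err_def
    proof (rule add_mono)
      have "R powr \<theta> = R * R powr (\<theta> - 1)" using R0 by (simp add: powr_diff)
      also have "\<dots> \<le> \<delta> * L powr (1 / 3) * R powr (\<theta> - 1)" using R2 by (intro mult_right_mono) auto
      finally have n: "2 * R powr \<theta> \<le> 2 * (?m * L powr (1 / 3))" by (simp add: mult_ac)
      have "8 * L powr (1 / 3) \<le> L powr \<theta> - 1" using L\<theta> L3 by linarith
      then have "2 * R powr \<theta> / (L powr \<theta> - 1) \<le> 2 * (?m * L powr (1 / 3)) / (8 * L powr (1 / 3))"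
        using n \<delta> L3 by (intro frac_le) auto
      also have "\<dots> = 1 / 4 * ?m" using L1 by simp
      finally show "2 * R powr \<theta> / (L powr \<theta> - 1) \<le> 1 / 4 * ?m" .
      show "?m / (L powr (1 - \<theta>) - 1) \<le> 1 / 4 * ?m" unfolding L\<theta>' using \<delta> by simp
    qed
    then have "1 / 2 * ?m \<le> \<bar>\<Phi> (l, \<sigma>) x - \<Phi> (l, \<sigma>) y\<bar>"
      using scale_sum_center[OF powr_pos Rl, of x y] main unfolding \<Phi>_def \<delta>_def[symmetric] prod.case by linarith
    moreover have "1 / 16 * \<delta> powr \<theta> \<le> ?m"
    proof -
      have "(\<delta> * L powr (1 / 3)) powr (\<theta> - 1) \<le> R powr (\<theta> - 1)"
        using R2 R0 \<theta> by (intro powr_mono2') auto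
      moreover have "(L powr (1 / 3)) powr (\<theta> - 1) = 1 / 16"
      proof -
        have e: "1 / 3 * (\<theta> - 1) = (1 - \<theta>) * (- (1 / 3))" by (simp add: field_simps)
        have "(L powr (1 / 3)) powr (\<theta> - 1) = (L powr (1 - \<theta>)) powr (- (1 / 3))"
          by (simp only: powr_powr e)
        also have "\<dots> = ((16 :: real) powr 3) powr (- (1 / 3))" unfolding L\<theta>' by simp
        also have "\<dots> = 16 powr (- 1)" by (simp only: powr_powr) simp
        also have "\<dots> = 1 / 16" by (simp add: powr_minus_divide)
        finally show ?thesis .
      qed
      ultimately have "\<delta> powr (\<theta> - 1) * (1 / 16) \<le> R powr (\<theta> - 1)" by (simp add: powr_mult)
      then have "\<delta> * (\<delta> powr (\<theta> - 1) * (1 / 16)) \<le> ?m" using \<delta> by (intro mult_left_mono) auto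
      then show ?thesis using \<delta> by (simp add: powr_diff)
    qed
    ultimately have "1 / 32 * \<bar>x - y\<bar> powr \<theta> \<le> \<bar>\<Phi> (l, \<sigma>) x - \<Phi> (l, \<sigma>) y\<bar>" unfolding \<delta>_def by linarith
    moreover have "(l, \<sigma>) \<in> E" using \<sigma>(1) unfolding E_def by (auto simp: l_def)
    ultimately show ?thesis by blast
  qed
  have "\<exists>\<Psi> :: nat \<Rightarrow> real \<Rightarrow> real. line_snowflake \<theta> (card E) 1 (1 / 32) (6 * 6) \<Psi>"
  proof (rule snowflake_package[where \<Phi> = \<Phi>])
    show "finite E" by (simp add: E_def)
    show "real (card E) \<le> 6 * real 1" by (simp add: cardE)
    show "\<exists>S\<subseteq>E. 1 \<le> card S \<and> (\<forall>e\<in>S. 1 / 32 * \<bar>x - y\<bar> powr \<theta> \<le> \<bar>\<Phi> e x - \<Phi> e y\<bar>)" if xy: "x \<noteq> y" for x y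
    proof -
      obtain e where "e \<in> E" "1 / 32 * \<bar>x - y\<bar> powr \<theta> \<le> \<bar>\<Phi> e x - \<Phi> e y\<bar>" using lo[OF xy] by blast
      then show ?thesis by (intro exI[of _ "{e}"]) auto
    qed
  qed (use up in auto)
  moreover have "real (card E) \<le> 192 / \<theta>" using \<theta> by (simp add: cardE field_simps)
  moreover have "1 \<le> card E" by (simp add: cardE)
  ultimately show ?thesis by blast
qed

lemma snowflake_line:
  assumes \<theta>: "0 < \<theta>" "\<theta> \<le> 1"
  shows "\<exists>n j (\<Psi> :: nat \<Rightarrow> real \<Rightarrow> real). 1 \<le> n \<and> real n \<le> 192 / \<theta> \<and> 1 \<le> (j::nat) \<and> line_snowflake \<theta> n j (1 / 64) (384) \<Psi>"
proof -
  consider "\<theta> \<le> 1 / 2" | "1 / 2 \<le> \<theta>" "\<theta> < 1" | "\<theta> = 1" using \<theta> by linarith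
  then show ?thesis
  proof cases
    case 1
    then show ?thesis using snowflake_line_small_exponent[OF \<theta>(1)] by simp
  next
    case 2
    from snowflake_line_large_exponent[OF this] obtain n j \<Psi> where
      h: "1 \<le> n" "real n \<le> 192 / \<theta>" "1 \<le> (j::nat)" "line_snowflake \<theta> n j (1 / 32) (6 * 6) \<Psi>"
      by blast
    have "line_snowflake \<theta> n j (1 / 64) 384 \<Psi>" by (rule line_snowflake_mono[OF h(4)]) auto
    then show ?thesis using h by blast
  next
    case 3
    have "line_snowflake \<theta> 1 1 1 1 (\<lambda>_ z. z)" using 3 by (simp add: line_snowflake_def)
    then have "line_snowflake \<theta> 1 1 (1 / 64) 384 (\<lambda>_ z. z)" by (rule line_snowflake_mono) auto
    moreover have "real 1 \<le> 192 / \<theta>" using 3 by simp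
    ultimately show ?thesis by (intro exI[of _ "1::nat"] exI[of _ "\<lambda>_ z. z"] conjI) auto
  qed
qed

section \<open>Euclidean space as a subspace of powers of the line\<close>

lemma coordinate_norm_lp:
  assumes p: "p \<ge> 1" and le: "\<And>x. lp_norm p m x \<le> b * L2_set x {..<m}" and b: "b > 0"
  shows "coordinate_norm m (lp_norm p m) b"
proof
  show "lp_norm p m (\<lambda>i. x i + y i) \<le> lp_norm p m x + lp_norm p m y" for x y by (rule lp_norm_triangle[OF p])
  show "lp_norm p m (\<lambda>i. c * x i) = \<bar>c\<bar> * lp_norm p m x" for c x by (rule lp_norm_scale[OF p])
  show "lp_norm p m \<in> borel_measurable (gaussP {..<m})" unfolding lp_norm_def[abs_def] by measurable
qed (use le b in auto)

text \<open>The inequality \<open>u \<le> 1 + u powr q\<close>, applied to the coordinates divided by their \<open>q\<close>-mean, gives the comparison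
  of means up to the factor 2.\<close>

lemma l1_le_lp_norm:
  assumes q: "q \<ge> 1" and m: "m \<ge> 1"
  shows "(\<Sum>i<m. \<bar>x i\<bar>) \<le> 2 * real m / real m powr (1 / q) * lp_norm q m x"
proof (cases "lp_norm q m x = 0")
  case True
  then have "x i = 0" if "i < m" for i using abs_le_lp_norm[OF q that, of x] by simp
  then show ?thesis using True by simp
next
  case False
  define s where "s = lp_norm q m x / real m powr (1 / q)"
  have s: "s > 0" using False lp_norm_nonneg[of q m x] m by (simp add: s_def)
  have sq: "s powr q = lp_norm q m x powr q / real m" using q by (simp add: s_def powr_divide powr_powr)
  have pt: "\<bar>x i\<bar> \<le> s * (1 + \<bar>x i\<bar> powr q / s powr q)" for i
  proof -
    have u: "u \<le> 1 + u powr q" if "u \<ge> 0" for u :: real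
    proof (cases "u \<le> 1")
      case False
      then show ?thesis using powr_mono[of 1 q u] q by simp
    qed (simp add: add_increasing2)
    have "\<bar>x i\<bar> / s \<le> 1 + (\<bar>x i\<bar> / s) powr q" using s by (intro u) auto
    then have "s * (\<bar>x i\<bar> / s) \<le> s * (1 + (\<bar>x i\<bar> / s) powr q)" using s by (intro mult_left_mono) auto
    then show ?thesis using s by (simp add: powr_divide)
  qed
  have "(\<Sum>i<m. \<bar>x i\<bar>) \<le> (\<Sum>i<m. s * (1 + \<bar>x i\<bar> powr q / s powr q))" by (intro sum_mono pt)
  also have "\<dots> = s * (real m + (\<Sum>i<m. \<bar>x i\<bar> powr q) / s powr q)"
    by (simp add: sum_distrib_left[symmetric] sum.distrib sum_divide_distrib)
  also have "\<dots> = s * (2 * real m)"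
    unfolding lp_norm_powr[OF q, symmetric] sq using False m by simp
  finally show ?thesis by (simp add: s_def mult_ac)
qed

text \<open>It suffices to treat the 1-norm: by the Chernoff bound with \<open>exp (- 4 * |u|)\<close>, the sum of \<open>m\<close> absolute values
  is smaller than \<open>m / 12\<close> with probability below one half.\<close>

lemma median_lp_norm_ge:
  assumes q: "q \<ge> 1" and m: "m \<ge> 1" and N: "coordinate_norm m (lp_norm q m) b"
    and \<mu>: "coordinate_norm.is_median m (lp_norm q m) \<mu>"
  shows "real m powr (1 / q) / 24 \<le> \<mu>"
proof (rule ccontr)
  assume "\<not> ?thesis"
  then have lt: "\<mu> < real m powr (1 / q) / 24" by simp
  interpret coordinate_norm m "lp_norm q m" b by (rule N)
  interpret prob_space "gaussP {..<m}" by (rule prob_space_gaussP)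
  let ?S = "space (gaussP {..<m})"
  have "1/2 \<le> prob {x\<in>?S. lp_norm q m x \<le> \<mu>}" using \<mu> unfolding is_median_def by blast
  also have "\<dots> \<le> prob {x\<in>?S. - (real m / 3) \<le> (\<Sum>i<m. - (4 * \<bar>x i\<bar>))}"
  proof (rule finite_measure_mono)
    show "{x\<in>?S. lp_norm q m x \<le> \<mu>} \<subseteq> {x\<in>?S. - (real m / 3) \<le> (\<Sum>i<m. - (4 * \<bar>x i\<bar>))}"
    proof safe
      fix x assume le: "lp_norm q m x \<le> \<mu>"
      have "(\<Sum>i<m. \<bar>x i\<bar>) \<le> 2 * real m / real m powr (1 / q) * lp_norm q m x" by (rule l1_le_lp_norm[OF q m])
      also have "\<dots> \<le> 2 * real m / real m powr (1 / q) * (real m powr (1 / q) / 24)"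
        using le lt by (intro mult_left_mono) auto
      also have "\<dots> = real m / 12" using m by simp
      finally have "4 * (\<Sum>i<m. \<bar>x i\<bar>) \<le> real m / 3" by simp
      then show "- (real m / 3) \<le> (\<Sum>i<m. - (4 * \<bar>x i\<bar>))" by (simp add: sum_negf sum_distrib_left)
    qed
  qed measurable
  also have "\<dots> \<le> exp (- (- (real m / 3))) * (1/5) ^ card {..<m}"
    by (rule gaussP_chernoff[OF _ _ nn_integral_gauss_exp_abs]) auto
  also have "\<dots> = (exp (1/3) * (1/5)) ^ m"
    using exp_of_nat_mult[of m "1/3 :: real"] by (simp add: power_mult_distrib power_divide)
  also have "\<dots> \<le> (3/2 * (1/5)) ^ m"
  proof -
    have "exp (1/3 :: real) ^ Suc 2 = exp 1" by (simp only: exp_of_nat_mult[symmetric]) simp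
    also have "\<dots> \<le> (3/2) ^ Suc 2" using exp_le by (simp add: power3_eq_cube)
    finally have "exp (1/3 :: real) \<le> 3/2" by (rule power_le_imp_le_base) simp
    then show ?thesis by (intro power_mono mult_right_mono) auto
  qed
  also have "\<dots> \<le> (3/2 * (1/5)) ^ 1" using m by (intro power_decreasing) auto
  finally show False by simp
qed

lemma median_l2_norm_le:
  assumes m: "m \<ge> 1" and N: "coordinate_norm m (lp_norm 2 m) b"
    and \<mu>: "coordinate_norm.is_median m (lp_norm 2 m) \<mu>"
  shows "\<mu> \<le> sqrt (8 * real m)"
proof (rule ccontr)
  assume "\<not> ?thesis"
  then have lt: "sqrt (8 * real m) < \<mu>" by simp
  interpret coordinate_norm m "lp_norm 2 m" b by (rule N)
  interpret prob_space "gaussP {..<m}" by (rule prob_space_gaussP)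
  let ?S = "space (gaussP {..<m})"
  have int: "(\<integral>\<^sup>+u. ennreal (exp (u\<^sup>2 / 4)) \<partial>gauss) \<le> ennreal (3/2)"
  proof -
    have "(\<integral>\<^sup>+u. ennreal (exp (u\<^sup>2 / 4)) \<partial>gauss) = ennreal (1 / sqrt (1 / 2))"
      using nn_integral_gauss_exp_square[of "- (1/2)"] by simp
    moreover have "1 / sqrt (1 / 2) \<le> (3/2 :: real)"
    proof -
      have "2/3 \<le> sqrt (1/2 :: real)" by (rule real_le_rsqrt) (simp add: power2_eq_square)
      then show ?thesis by (simp add: divide_le_eq)
    qed
    ultimately show ?thesis by (simp add: ennreal_leI)
  qed
  have "1/2 \<le> prob {x\<in>?S. \<mu> \<le> lp_norm 2 m x}" using \<mu> unfolding is_median_def by blast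
  also have "\<dots> \<le> prob {x\<in>?S. 2 * real m \<le> (\<Sum>i<m. (x i)\<^sup>2 / 4)}"
  proof (rule finite_measure_mono)
    show "{x\<in>?S. \<mu> \<le> lp_norm 2 m x} \<subseteq> {x\<in>?S. 2 * real m \<le> (\<Sum>i<m. (x i)\<^sup>2 / 4)}"
    proof safe
      fix x assume "\<mu> \<le> lp_norm 2 m x"
      then have "sqrt (8 * real m) \<le> L2_set x {..<m}" using lt by (simp add: lp_norm_2)
      then have "(sqrt (8 * real m))\<^sup>2 \<le> (L2_set x {..<m})\<^sup>2" by (intro power_mono) auto
      then show "2 * real m \<le> (\<Sum>i<m. (x i)\<^sup>2 / 4)" by (simp add: L2_set_sq sum_divide_distrib[symmetric])
    qed
  qed measurable
  also have "\<dots> \<le> exp (- (2 * real m)) * (3/2) ^ card {..<m}"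
    by (rule gaussP_chernoff[OF _ _ int]) auto
  also have "\<dots> = (exp (- 2) * (3/2)) ^ m" 
    using exp_of_nat_mult[of m "- 2 :: real"] by (simp add: power_mult_distrib power_divide mult.commute)
  also have "\<dots> \<le> (1/3 * (3/2 - 3/8)) ^ m"
  proof -
    have "(2 :: real) ^ 2 \<le> exp 1 ^ 2" using exp_ge_add_one_self[of 1] by (intro power_mono) auto
    also have "\<dots> = exp 2" by (simp flip: exp_of_nat_mult)
    finally have "exp (- 2 :: real) \<le> 1/4" by (simp add: exp_minus field_simps)
    then show ?thesis by (intro power_mono) auto
  qed
  also have "\<dots> \<le> (1/3 * (3/2 - 3/8)) ^ 1" using m by (intro power_decreasing) auto
  finally show False by simp
qed

text \<open>Bounds for the first and the second moment imply bounds for all moments of order between 0 and 2. A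
  fixed fraction of the coordinates must be bounded below, since otherwise the first moment would be carried by
  few coordinates and the second moment would be too large.\<close>

lemma small_power_sum_bounds:
  fixes u :: "nat \<Rightarrow> real"
  assumes l1: "real m / 60 \<le> (\<Sum>i<m. \<bar>u i\<bar>)" and l2: "(\<Sum>i<m. (u i)\<^sup>2) \<le> 32 * real m"
    and p: "p \<ge> 1" and \<theta>: "0 < \<theta>" "\<theta> \<le> 1" and q: "p * \<theta> \<le> 2"
  shows "real m * (1 / 55296000) powr p \<le> (\<Sum>i<m. \<bar>u i\<bar> powr (p * \<theta>))"
    "(\<Sum>i<m. \<bar>u i\<bar> powr (p * \<theta>)) \<le> real m * 33 powr p"
proof -
  let ?q = "p * \<theta>"
  have q0: "0 < ?q" "?q \<le> p" using p \<theta> by (auto simp: mult_le_cancel_left1)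
  define I where "I = {i \<in> {..<m}. 1/240 \<le> \<bar>u i\<bar>}"
  \<comment> \<open>The constants are \<open>1 / 240 = (1 / 60) / 4\<close>, \<open>1920 = 32 * 60\<close> and \<open>7680 = 4 * 1920\<close>.\<close>
  have pt: "\<bar>u i\<bar> - 1/240 - (u i)\<^sup>2 / 7680 \<le> 1920 * (if i \<in> I then 1 else 0)" if "i \<in> {..<m}" for i
  proof (cases "i \<in> I")
    case True
    have "0 \<le> (\<bar>u i\<bar> - 3840)\<^sup>2" by simp
    then have "\<bar>u i\<bar> * 7680 \<le> (u i)\<^sup>2 + 3840\<^sup>2" by (simp add: power2_diff)
    then show ?thesis using True by simp
  next
    case False
    then have "\<bar>u i\<bar> < 1/240" using that by (simp add: I_def)
    moreover have "0 \<le> (u i)\<^sup>2 / 7680" by simp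
    ultimately have "\<bar>u i\<bar> - 1/240 - (u i)\<^sup>2 / 7680 \<le> 0" by linarith
    then show ?thesis using False by simp
  qed
  have "real m / 60 - real m / 240 - 32 * real m / 7680 \<le> (\<Sum>i<m. \<bar>u i\<bar>) - real m * (1/240) - (\<Sum>i<m. (u i)\<^sup>2) / 7680"
    using l1 l2 by simp
  also have "\<dots> = (\<Sum>i<m. \<bar>u i\<bar> - 1/240 - (u i)\<^sup>2 / 7680)" by (simp add: sum_subtractf sum_divide_distrib)
  also have "\<dots> \<le> (\<Sum>i<m. 1920 * (if i \<in> I then 1 else 0))" by (intro sum_mono pt)
  also have "\<dots> = 1920 * real (card I)" by (simp add: sum_distrib_left[symmetric] I_def sum.If_cases Int_def)
  finally have card: "real m * (1 / 230400) \<le> real (card I)" by simp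
  have "real m * (1 / 55296000) powr p = real m * ((1 / 230400) powr p * (1 / 240) powr p)"
    by (simp only: powr_mult[symmetric]) simp
  also have "\<dots> \<le> real m * ((1 / 230400) powr 1 * (1 / 240) powr ?q)"
    using p q0 by (intro mult_left_mono mult_mono powr_mono') auto
  also have "\<dots> = real m * (1 / 230400) * (1 / 240) powr ?q" by simp
  also have "\<dots> \<le> real (card I) * (1 / 240) powr ?q" using card by (rule mult_right_mono) simp
  also have "\<dots> = (\<Sum>i\<in>I. (1 / 240) powr ?q)" by simp
  also have "\<dots> \<le> (\<Sum>i\<in>I. \<bar>u i\<bar> powr ?q)" using q0 by (intro sum_mono powr_mono2) (auto simp: I_def)
  also have "\<dots> \<le> (\<Sum>i<m. \<bar>u i\<bar> powr ?q)" by (intro sum_mono2) (auto simp: I_def)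
  finally show "real m * (1 / 55296000) powr p \<le> (\<Sum>i<m. \<bar>u i\<bar> powr ?q)" .
  have "\<bar>u i\<bar> powr ?q \<le> 1 + (u i)\<^sup>2" for i
  proof (cases "\<bar>u i\<bar> \<le> 1")
    case True
    then have "\<bar>u i\<bar> powr ?q \<le> 1" using q0 by (intro powr_le1) auto
    then show ?thesis by (simp add: add_increasing2)
  next
    case False
    then have "\<bar>u i\<bar> powr ?q \<le> \<bar>u i\<bar> powr 2" using q by (intro powr_mono) auto
    then show ?thesis using False by simp
  qed
  then have "(\<Sum>i<m. \<bar>u i\<bar> powr ?q) \<le> (\<Sum>i<m. 1 + (u i)\<^sup>2)" by (intro sum_mono)
  also have "\<dots> \<le> real m * 33 powr 1" using l2 by (simp add: sum.distrib)
  also have "\<dots> \<le> real m * 33 powr p" using p by (intro mult_left_mono powr_mono) auto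
  finally show "(\<Sum>i<m. \<bar>u i\<bar> powr ?q) \<le> real m * 33 powr p" .
qed

text \<open>By homogeneity it suffices to state the comparison with the Euclidean norm on the unit sphere.\<close>

definition sphere_bounds ::
  "nat \<Rightarrow> nat \<Rightarrow> real \<Rightarrow> (nat \<Rightarrow> nat \<Rightarrow> real) \<Rightarrow> real \<Rightarrow> real \<Rightarrow> bool" where
  "sphere_bounds k m q G c C \<longleftrightarrow> (\<forall>x. L2_set x {..<k} = 1 \<longrightarrow>
     c \<le> (\<Sum>i<m. \<bar>matv k G x i\<bar> powr q) \<and> (\<Sum>i<m. \<bar>matv k G x i\<bar> powr q) \<le> C)"

text \<open>The number of rows is \<open>768\<^sup>2 * k\<close>, so that the medians of the 1-norm and of the 2-norm both satisfy the
  hypothesis of Dvoretzky's theorem. The two exceptional events do not cover the probability space.\<close>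

lemma euclidean_embedding_small:
  assumes k: "k \<ge> 1" and p: "p \<ge> 1" and \<theta>: "0 < \<theta>" "\<theta> \<le> 1" and q: "p * \<theta> \<le> 2"
  shows "\<exists>G. sphere_bounds k (589824 * k) (p * \<theta>) G
    (real (589824 * k) * (1 / 55296000) powr p) (real (589824 * k) * 33 powr p)"
proof -
  define m where "m = 589824 * k"
  have m: "m \<ge> 1" using k by (simp add: m_def)
  have sm: "sqrt (real m) = 768 * sqrt (real k)"
  proof -
    have "real m = 768\<^sup>2 * real k" by (simp add: m_def)
    then show ?thesis by (simp add: real_sqrt_mult)
  qed
  interpret M: prob_space "gaussM m k" by (rule prob_space_gaussM)
  have le1: "lp_norm 1 m x \<le> sqrt (real m) * L2_set x {..<m}" for x
    unfolding lp_norm_1 by (rule l1_le_sqrt_l2)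
  have N1: "coordinate_norm m (lp_norm 1 m) (sqrt (real m))"
    by (rule coordinate_norm_lp) (use le1 m in auto)
  have N2: "coordinate_norm m (lp_norm 2 m) 1"
    by (rule coordinate_norm_lp) (auto simp: lp_norm_2)
  interpret one: coordinate_norm m "lp_norm 1 m" "sqrt (real m)" by (rule N1)
  interpret two: coordinate_norm m "lp_norm 2 m" 1 by (rule N2)
  obtain \<mu>1 where \<mu>1: "one.is_median \<mu>1" using one.ex_median by blast
  obtain \<mu>2 where \<mu>2: "two.is_median \<mu>2" using two.ex_median by blast
  have big1: "real m / 24 \<le> \<mu>1" using median_lp_norm_ge[OF _ m N1 \<mu>1] m by simp
  have big2: "sqrt (real m) / 24 \<le> \<mu>2"
    using median_lp_norm_ge[OF _ m N2 \<mu>2] by (simp add: powr_half_sqrt)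
  have up2: "\<mu>2 \<le> sqrt (8 * real m)" by (rule median_l2_norm_le[OF m N2 \<mu>2])
  have "32 * sqrt (real m) * sqrt (real k) = sqrt (real m) * sqrt (real m) / 24" by (simp only: sm)
  then have c1: "32 * sqrt (real m) * sqrt (real k) \<le> \<mu>1" using big1 by simp
  have c2: "32 * 1 * sqrt (real k) \<le> \<mu>2" using big2 unfolding sm by simp
  obtain B1 where B1: "B1 \<in> M.events" "M.prob B1 \<le> 1/3"
    "\<And>G x. G \<in> space (gaussM m k) - B1 \<Longrightarrow> L2_set x {..<k} = 1 \<Longrightarrow> 2/5 * \<mu>1 \<le> lp_norm 1 m (matv k G x)"
    using one.dvoretzky[OF k \<mu>1 c1] by blast
  obtain B2 where B2: "B2 \<in> M.events" "M.prob B2 \<le> 1/3"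
    "\<And>G x. G \<in> space (gaussM m k) - B2 \<Longrightarrow> L2_set x {..<k} = 1 \<Longrightarrow> lp_norm 2 m (matv k G x) \<le> 2 * \<mu>2"
    using two.dvoretzky[OF k \<mu>2 c2] by blast
  have "M.prob (B1 \<union> B2) \<le> 1/3 + 1/3" using B1 B2 measure_Un_le[of B1 "gaussM m k" B2] by linarith
  then have "B1 \<union> B2 \<noteq> space (gaussM m k)" using M.prob_space by auto
  moreover have "B1 \<union> B2 \<subseteq> space (gaussM m k)" using B1(1) B2(1) sets.sets_into_space by blast
  ultimately obtain G where G: "G \<in> space (gaussM m k)" "G \<notin> B1" "G \<notin> B2" by blast
  have "real m * (1 / 55296000) powr p \<le> (\<Sum>i<m. \<bar>matv k G x i\<bar> powr (p * \<theta>)) \<and>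
    (\<Sum>i<m. \<bar>matv k G x i\<bar> powr (p * \<theta>)) \<le> real m * 33 powr p" if x: "L2_set x {..<k} = 1" for x
  proof -
    have l1: "real m / 60 \<le> (\<Sum>i<m. \<bar>matv k G x i\<bar>)"
      using B1(3)[of G x] G x big1 unfolding lp_norm_1 by simp
    have "L2_set (matv k G x) {..<m} \<le> 2 * sqrt (8 * real m)"
      using B2(3)[of G x] G x up2 unfolding lp_norm_2 by simp
    then have "(L2_set (matv k G x) {..<m})\<^sup>2 \<le> (2 * sqrt (8 * real m))\<^sup>2" by (intro power_mono L2_set_nonneg)
    then have l2: "(\<Sum>i<m. (matv k G x i)\<^sup>2) \<le> 32 * real m" by (simp add: L2_set_sq power_mult_distrib)
    show ?thesis using small_power_sum_bounds[OF l1 l2 p \<theta> q] by blast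
  qed
  then show ?thesis unfolding m_def sphere_bounds_def by blast
qed

text \<open>The \<open>q\<close>-norm with \<open>q = p * \<theta>\<close> has Lipschitz constant 1 and median of order \<open>m powr (1 / q)\<close>, so \<open>m\<close> of order
  \<open>k powr (q / 2)\<close> suffices.\<close>

lemma euclidean_embedding_large:
  assumes k: "k \<ge> 1" and p: "p \<ge> 1" and \<theta>: "0 < \<theta>" "\<theta> \<le> 1" and q: "2 < p * \<theta>"
  shows "\<exists>m G \<kappa>. 1 \<le> m \<and> real m \<le> 2 * 768 powr p * real k powr (p * \<theta> / 2) \<and> (\<kappa>::real) > 0 \<and>
    sphere_bounds k m (p * \<theta>) G (\<kappa> * (2/5) powr p) (\<kappa> * 2 powr p)"
proof -
  let ?q = "p * \<theta>"
  have qp: "?q \<le> p" using p \<theta> by (simp add: mult_le_cancel_left1)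
  define t where "t = (768 * sqrt (real k)) powr ?q"
  define m where "m = nat \<lceil>t\<rceil>"
  have t1: "1 \<le> t"
  proof -
    have "1 \<le> sqrt (real k)" using k by simp
    then have "1 \<le> 768 * sqrt (real k)" by linarith
    then show ?thesis unfolding t_def using q by (intro ge_one_powr_ge_zero) auto
  qed
  have m: "t \<le> real m" "real m \<le> t + 1"
  proof -
    have "0 \<le> \<lceil>t\<rceil>" using t1 by linarith
    then have "real m = of_int \<lceil>t\<rceil>" unfolding m_def by simp
    then show "t \<le> real m" "real m \<le> t + 1" by linarith+
  qed
  have m1: "m \<ge> 1" using m(1) t1 by linarith
  have mle: "real m \<le> 2 * 768 powr p * real k powr (?q / 2)"
  proof -
    have "t = 768 powr ?q * real k powr (?q / 2)"
      unfolding t_def using k by (simp add: powr_mult powr_half_sqrt[symmetric] powr_powr)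
    also have "\<dots> \<le> 768 powr p * real k powr (?q / 2)" using qp by (intro mult_right_mono powr_mono) auto
    finally show ?thesis using m(2) t1 by linarith
  qed
  interpret M: prob_space "gaussM m k" by (rule prob_space_gaussM)
  have N: "coordinate_norm m (lp_norm ?q m) 1"
    by (rule coordinate_norm_lp) (use q lp_norm_le_lp_norm_2 in auto)
  interpret coordinate_norm m "lp_norm ?q m" 1 by (rule N)
  obtain \<mu> where \<mu>: "is_median \<mu>" using ex_median by blast
  have "768 * sqrt (real k) = t powr (1 / ?q)" unfolding t_def using p \<theta> by (simp add: powr_powr)
  also have "\<dots> \<le> real m powr (1 / ?q)" using m(1) t1 q by (intro powr_mono2) auto
  finally have "32 * 1 * sqrt (real k) \<le> real m powr (1 / ?q) / 24" by simp
  also have "\<dots> \<le> \<mu>" by (rule median_lp_norm_ge[OF _ m1 N \<mu>]) (use q in simp)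
  finally have big: "32 * 1 * sqrt (real k) \<le> \<mu>" .
  have \<mu>0: "\<mu> > 0"
  proof -
    have "0 < 32 * 1 * sqrt (real k)" using k by simp
    then show ?thesis using big by linarith
  qed
  obtain B where B: "B \<in> M.events" "M.prob B \<le> 1/3"
    "\<And>G x. G \<in> space (gaussM m k) - B \<Longrightarrow> L2_set x {..<k} = 1 \<Longrightarrow>
       2/5 * \<mu> \<le> lp_norm ?q m (matv k G x) \<and> lp_norm ?q m (matv k G x) \<le> 2 * \<mu>"
    using dvoretzky[OF k \<mu> big] by blast
  have "B \<noteq> space (gaussM m k)" using B(2) M.prob_space by auto
  then obtain G where G: "G \<in> space (gaussM m k) - B" using sets.sets_into_space[OF B(1)] by blast
  have "\<mu> powr ?q * (2/5) powr p \<le> (\<Sum>i<m. \<bar>matv k G x i\<bar> powr ?q) \<and>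
      (\<Sum>i<m. \<bar>matv k G x i\<bar> powr ?q) \<le> \<mu> powr ?q * 2 powr p" if x: "L2_set x {..<k} = 1" for x
  proof -
    let ?n = "lp_norm ?q m (matv k G x)"
    have n: "2/5 * \<mu> \<le> ?n" "?n \<le> 2 * \<mu>" using B(3)[OF G x] by auto
    have eq: "(\<Sum>i<m. \<bar>matv k G x i\<bar> powr ?q) = ?n powr ?q" by (rule lp_norm_powr[symmetric]) (use q in simp)
    have "\<mu> powr ?q * (2/5) powr p \<le> \<mu> powr ?q * (2/5) powr ?q"
      using qp by (intro mult_left_mono powr_mono') auto
    also have "\<dots> = (2/5 * \<mu>) powr ?q" by (simp only: powr_mult mult.commute)
    also have "\<dots> \<le> ?n powr ?q" using n \<mu>0 q by (intro powr_mono2) auto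
    finally have lo: "\<mu> powr ?q * (2/5) powr p \<le> ?n powr ?q" .
    have "?n powr ?q \<le> (2 * \<mu>) powr ?q" using n \<mu>0 q lp_norm_nonneg by (intro powr_mono2) auto
    also have "\<dots> = \<mu> powr ?q * 2 powr ?q" by (simp only: powr_mult mult.commute)
    also have "\<dots> \<le> \<mu> powr ?q * 2 powr p" using qp by (intro mult_left_mono powr_mono) auto
    finally show ?thesis using lo unfolding eq by blast
  qed
  then have "sphere_bounds k m ?q G (\<mu> powr ?q * (2/5) powr p) (\<mu> powr ?q * 2 powr p)"
    unfolding sphere_bounds_def by blast
  then show ?thesis using m1 mle \<mu>0 by (intro exI[of _ m] exI[of _ G] exI[of _ "\<mu> powr ?q"]) auto
qed

lemma euclidean_embedding:
  assumes k: "k \<ge> 1" and p: "p \<ge> 1" and \<theta>: "0 < \<theta>" "\<theta> \<le> 1"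
  shows "\<exists>m G \<kappa>. 1 \<le> m \<and> real m \<le> (2 * 768 powr p + 589824) * real k powr max 1 (p * \<theta> / 2) \<and> (\<kappa>::real) > 0 \<and>
    sphere_bounds k m (p * \<theta>) G (\<kappa> * (1 / 55296000) powr p) (\<kappa> * 33 powr p)"
proof (cases "p * \<theta> \<le> 2")
  case True
  obtain G where G: "sphere_bounds k (589824 * k) (p * \<theta>) G
    (real (589824 * k) * (1 / 55296000) powr p) (real (589824 * k) * 33 powr p)"
    using euclidean_embedding_small[OF k p \<theta> True] by blast
  have mx: "max 1 (p * \<theta> / 2) = 1" using True by simp
  have "real (589824 * k) \<le> (2 * 768 powr p + 589824) * real k powr max 1 (p * \<theta> / 2)"
    unfolding mx using k by (simp add: mult_right_mono)
  moreover have "1 \<le> 589824 * k" "real (589824 * k) > 0" using k by auto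
  ultimately show ?thesis using G by blast
next
  case False
  then have q: "2 < p * \<theta>" by simp
  obtain m G \<kappa> where h: "1 \<le> m" "real m \<le> 2 * 768 powr p * real k powr (p * \<theta> / 2)" "(\<kappa>::real) > 0"
    "sphere_bounds k m (p * \<theta>) G (\<kappa> * (2/5) powr p) (\<kappa> * 2 powr p)"
    using euclidean_embedding_large[OF k p \<theta> q] by blast
  have mx: "max 1 (p * \<theta> / 2) = p * \<theta> / 2" using q by simp
  have "2 * 768 powr p * real k powr (p * \<theta> / 2) \<le> (2 * 768 powr p + 589824) * real k powr (p * \<theta> / 2)"
    by (intro mult_right_mono) auto
  then have m: "real m \<le> (2 * 768 powr p + 589824) * real k powr max 1 (p * \<theta> / 2)" unfolding mx using h(2) by linarith
  have "\<kappa> * (1 / 55296000) powr p \<le> \<kappa> * (2/5) powr p" "\<kappa> * 2 powr p \<le> \<kappa> * 33 powr p"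
    using h(3) p by (auto intro!: mult_left_mono powr_mono2)
  then have "sphere_bounds k m (p * \<theta>) G (\<kappa> * (1 / 55296000) powr p) (\<kappa> * 33 powr p)"
    using h(4) unfolding sphere_bounds_def by (meson order_trans)
  then show ?thesis using h(1,3) m by blast
qed

text \<open>The coordinate with number \<open>i * n + r\<close> is the \<open>r\<close>-th coordinate of the snowflake of the line, applied to the
  \<open>i\<close>-th coordinate of \<open>G x\<close>.\<close>

lemma snowflake_embedding:
  assumes k: "k \<ge> 1" and p: "p \<ge> 1" and \<theta>: "0 < \<theta>" "\<theta> \<le> 1"
  shows "\<exists>m. 1 \<le> m \<and> real m \<le> (192 * (2 * 768 powr p + 589824)) * (real k / \<theta>) powr (max 1 (p * \<theta> / 2)) \<and>
    embeds_with_distortion (33 * 384 * 64 * 55296000) (Rn k) (snowflake_dist \<theta> k) (Rn m) (lp_dist p m)"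
proof -
  let ?e = "max 1 (p * \<theta> / 2)"
  obtain m G \<kappa> where m: "1 \<le> m" "real m \<le> (2 * 768 powr p + 589824) * real k powr ?e" and \<kappa>: "(\<kappa>::real) > 0"
    and "sphere_bounds k m (p * \<theta>) G (\<kappa> * (1 / 55296000) powr p) (\<kappa> * 33 powr p)"
    using euclidean_embedding[OF k p \<theta>] by blast
  then have G: "\<kappa> * (1 / 55296000) powr p \<le> (\<Sum>i<m. \<bar>matv k G x i\<bar> powr (p * \<theta>)) \<and>
      (\<Sum>i<m. \<bar>matv k G x i\<bar> powr (p * \<theta>)) \<le> \<kappa> * 33 powr p" if "L2_set x {..<k} = 1" for x
    using that unfolding sphere_bounds_def by blast
  obtain n j and \<Psi> :: "nat \<Rightarrow> real \<Rightarrow> real" where n: "1 \<le> n" "real n \<le> 192 / \<theta>" and j: "1 \<le> (j::nat)"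
    and "line_snowflake \<theta> n j (1 / 64) 384 \<Psi>" using snowflake_line[OF \<theta>] by blast
  then have \<Psi>: "real j * (1 / 64 * \<bar>x - y\<bar> powr \<theta>) powr p \<le> (\<Sum>r<n. \<bar>\<Psi> r x - \<Psi> r y\<bar> powr p)"
      "(\<Sum>r<n. \<bar>\<Psi> r x - \<Psi> r y\<bar> powr p) \<le> real j * (384 * \<bar>x - y\<bar> powr \<theta>) powr p" for x y
    using p unfolding line_snowflake_def by blast+
  define f where "f x = (\<lambda>t. if t < m * n then \<Psi> (t mod n) (matv k G x (t div n)) else 0)" for x
  define \<tau> where "\<tau> = (real j * \<kappa>) powr (1 / p)"
  have \<tau>0: "\<tau> > 0" using j \<kappa> by (simp add: \<tau>_def)
  have \<tau>p: "\<tau> powr p = real j * \<kappa>" using p j \<kappa> by (simp add: \<tau>_def powr_powr)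
  have double: "(\<Sum>t<m * n. \<bar>f x t - f y t\<bar> powr p) = (\<Sum>i<m. \<Sum>r<n. \<bar>\<Psi> r (matv k G x i) - \<Psi> r (matv k G y i)\<bar> powr p)" for x y
  proof -
    have "(\<Sum>t<m * n. \<bar>f x t - f y t\<bar> powr p)
       = (\<Sum>(i, r)\<in>{..<m} \<times> {..<n}. \<bar>\<Psi> r (matv k G x i) - \<Psi> r (matv k G y i)\<bar> powr p)"
    proof (rule sum.reindex_bij_witness[of _ "\<lambda>(i, r). i * n + r" "\<lambda>t. (t div n, t mod n)"])
      fix ir assume "ir \<in> {..<m} \<times> {..<n}"
      then obtain i r where ir: "ir = (i, r)" "i < m" "r < n" by auto
      have "i * n + r < Suc i * n" using ir by simp
      also have "\<dots> \<le> m * n" using ir by (intro mult_le_mono1) simp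
      finally show "(case ir of (i, r) \<Rightarrow> i * n + r) \<in> {..<m * n}" using ir by simp
      show "((case ir of (i, r) \<Rightarrow> i * n + r) div n, (case ir of (i, r) \<Rightarrow> i * n + r) mod n) = ir" using ir by simp
    next
      fix t assume t: "t \<in> {..<m * n}"
      then show "(t div n, t mod n) \<in> {..<m} \<times> {..<n}" using n by (auto simp: less_mult_imp_div_less)
    qed (use n in \<open>auto simp: f_def\<close>)
    then show ?thesis by (simp add: sum.cartesian_product)
  qed
  have main: "\<tau> * (1 / (64 * 55296000)) * snowflake_dist \<theta> k x y \<le> lp_dist p (m * n) (f x) (f y)
     \<and> lp_dist p (m * n) (f x) (f y) \<le> \<tau> * (33 * 384) * snowflake_dist \<theta> k x y" for x y
  proof -
    define v where "v = (\<lambda>a. x a - y a)"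
    define \<delta> where "\<delta> = L2_set v {..<k}"
    have \<delta>0: "\<delta> \<ge> 0" by (simp add: \<delta>_def L2_set_nonneg)
    have sd: "snowflake_dist \<theta> k x y = \<delta> powr \<theta>" unfolding snowflake_dist_def lp_dist_2 \<delta>_def v_def ..
    let ?\<Sigma> = "\<Sum>i<m. \<bar>matv k G v i\<bar> powr (p * \<theta>)"
    have \<Sigma>: "\<delta> powr (p * \<theta>) * (\<kappa> * (1 / 55296000) powr p) \<le> ?\<Sigma> \<and> ?\<Sigma> \<le> \<delta> powr (p * \<theta>) * (\<kappa> * 33 powr p)"
    proof (cases "\<delta> = 0")
      case True
      then have "v a = 0" if "a < k" for a using that unfolding \<delta>_def by (simp add: L2_set_eq_0_iff)
      then have "matv k G v i = 0" for i unfolding matv_def by simp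
      then show ?thesis using True by simp
    next
      case False
      then have \<delta>: "\<delta> > 0" using \<delta>0 by simp
      define w where "w = (\<lambda>a. (1 / \<delta>) * v a)"
      have w1: "L2_set w {..<k} = 1"
        using L2_set_right_distrib[of "1 / \<delta>" v "{..<k}"] \<delta> unfolding w_def \<delta>_def[symmetric] by simp
      have "v = (\<lambda>a. \<delta> * w a)" unfolding w_def using \<delta> by simp
      then have "matv k G v i = \<delta> * matv k G w i" for i using matv_scale[of k G \<delta> w] by simp
      then have "?\<Sigma> = \<delta> powr (p * \<theta>) * (\<Sum>i<m. \<bar>matv k G w i\<bar> powr (p * \<theta>))"
        using \<delta> by (simp add: abs_mult powr_mult sum_distrib_left)
      then show ?thesis using G[OF w1] by (auto intro: mult_left_mono)
    qed
    have pw: "(c * z powr \<theta>) powr p = c powr p * z powr (p * \<theta>)" for c z :: real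
      by (simp add: powr_mult powr_powr mult.commute)
    let ?S = "\<Sum>t<m * n. \<bar>f x t - f y t\<bar> powr p"
    have Gv: "matv k G x i - matv k G y i = matv k G v i" for i using matv_diff[of k G x y] by (simp add: v_def)
    have "real j * ((1 / 64) powr p * ?\<Sigma>) = (\<Sum>i<m. real j * (1 / 64 * \<bar>matv k G x i - matv k G y i\<bar> powr \<theta>) powr p)"
      unfolding pw Gv by (simp add: sum_distrib_left)
    also have "\<dots> \<le> ?S" unfolding double by (intro sum_mono \<Psi>(1))
    finally have lo: "real j * ((1 / 64) powr p * ?\<Sigma>) \<le> ?S" .
    have "?S \<le> (\<Sum>i<m. real j * (384 * \<bar>matv k G x i - matv k G y i\<bar> powr \<theta>) powr p)"
      unfolding double by (intro sum_mono \<Psi>(2))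
    also have "\<dots> = real j * (384 powr p * ?\<Sigma>)" unfolding pw Gv by (simp add: sum_distrib_left)
    finally have hi: "?S \<le> real j * (384 powr p * ?\<Sigma>)" .
    have "(\<tau> * (1 / (64 * 55296000)) * \<delta> powr \<theta>) powr p
       = real j * ((1 / 64) powr p * (\<delta> powr (p * \<theta>) * (\<kappa> * (1 / 55296000) powr p)))"
    proof -
      have "(1 / (64 * 55296000) :: real) = 1 / 64 * (1 / 55296000)" by simp
      then have "(1 / (64 * 55296000) :: real) powr p = (1 / 64) powr p * (1 / 55296000) powr p" by (simp only: powr_mult)
      then show ?thesis unfolding pw powr_mult[of \<tau>] \<tau>p by (simp only: mult_ac)
    qed
    also have "\<dots> \<le> real j * ((1 / 64) powr p * ?\<Sigma>)" using \<Sigma> by (intro mult_left_mono) auto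
    also have "\<dots> \<le> ?S" by (rule lo)
    finally have "((\<tau> * (1 / (64 * 55296000)) * \<delta> powr \<theta>) powr p) powr (1 / p) \<le> ?S powr (1 / p)"
      using p by (intro powr_mono2) auto
    then have A: "\<tau> * (1 / (64 * 55296000)) * \<delta> powr \<theta> \<le> lp_dist p (m * n) (f x) (f y)"
      using p \<tau>0 by (simp add: powr_powr lp_dist_def lp_norm_def)
    have "?S \<le> real j * (384 powr p * ?\<Sigma>)" by (rule hi)
    also have "\<dots> \<le> real j * (384 powr p * (\<delta> powr (p * \<theta>) * (\<kappa> * 33 powr p)))" using \<Sigma> by (intro mult_left_mono) auto
    also have "\<dots> = (\<tau> * (33 * 384) * \<delta> powr \<theta>) powr p"
      unfolding pw powr_mult[of \<tau>] powr_mult[of 33 384] \<tau>p by (simp only: mult_ac)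
    finally have "?S powr (1 / p) \<le> ((\<tau> * (33 * 384) * \<delta> powr \<theta>) powr p) powr (1 / p)"
      using p by (intro powr_mono2 sum_nonneg) auto
    then have B: "lp_dist p (m * n) (f x) (f y) \<le> \<tau> * (33 * 384) * \<delta> powr \<theta>"
      using p \<tau>0 by (simp add: powr_powr lp_dist_def lp_norm_def)
    show ?thesis unfolding sd using A B by blast
  qed
  have emb: "embeds_with_distortion (33 * 384 * 64 * 55296000) (Rn k) (snowflake_dist \<theta> k) (Rn (m * n)) (lp_dist p (m * n))"
    unfolding embeds_with_distortion_def
  proof (intro exI[of _ f] exI[of _ "\<tau> * (1 / (64 * 55296000))"] conjI ballI)
    show "f \<in> Rn k \<rightarrow> Rn (m * n)" unfolding f_def Rn_def by auto
    show "0 < \<tau> * (1 / (64 * 55296000))" using \<tau>0 by simp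
    fix x y
    show "\<tau> * (1 / (64 * 55296000)) * snowflake_dist \<theta> k x y \<le> lp_dist p (m * n) (f x) (f y)" using main by blast
    have "\<tau> * (33 * 384) = 33 * 384 * 64 * 55296000 * (\<tau> * (1 / (64 * 55296000)))" by simp
    then show "lp_dist p (m * n) (f x) (f y) \<le> 33 * 384 * 64 * 55296000 * (\<tau> * (1 / (64 * 55296000))) * snowflake_dist \<theta> k x y"
      using main[of x y] by (simp only:)
  qed
  have "real (m * n) \<le> (192 * (2 * 768 powr p + 589824)) * (real k / \<theta>) powr ?e"
  proof -
    have "real (m * n) \<le> ((2 * 768 powr p + 589824) * real k powr ?e) * (192 / \<theta>)"
      unfolding of_nat_mult using m(2) n(2) by (intro mult_mono) auto
    also have "\<dots> = (192 * (2 * 768 powr p + 589824)) * (real k powr ?e * (1 / \<theta>) powr 1)" using \<theta> by (simp add: mult_ac)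
    also have "\<dots> \<le> (192 * (2 * 768 powr p + 589824)) * (real k powr ?e * (1 / \<theta>) powr ?e)"
      using \<theta> by (intro mult_left_mono powr_mono) auto
    also have "real k powr ?e * (1 / \<theta>) powr ?e = (real k / \<theta>) powr ?e" by (simp only: powr_mult[symmetric]) simp
    finally show ?thesis .
  qed
  moreover have "1 \<le> m * n" using m(1) n(1) by simp
  ultimately show ?thesis using emb by blast
qed

theorem theorem1:
  shows
    "(\<forall>(p::real) (k::nat) (\<theta>::real) (M :: (nat \<Rightarrow> real) set) (D::real) (m::nat).
        p \<ge> 1 \<longrightarrow> k \<ge> 4 \<longrightarrow> 0 < \<theta> \<longrightarrow> \<theta> \<le> 1 \<longrightarrow>
        eps_dense (1 / sqrt (real k)) M (unit_sphere k) (lp_dist 2 k) \<longrightarrow>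
        D \<ge> 1 \<longrightarrow>
        embeds_with_distortion D M (snowflake_dist \<theta> k) (Rn m) (lp_dist p m) \<longrightarrow>
        real m \<ge> 1 / (4 * D) powr p *
          (real k / (2 * p * \<theta> * ln (real k) + 8)) powr (p * \<theta> / 2))
     \<and>
     (\<exists>C::real. C \<ge> 1 \<and>
        (\<forall>p::real. p \<ge> 1 \<longrightarrow>
          (\<exists>Cp::real. Cp > 0 \<and>
            (\<forall>(k::nat) (\<theta>::real). k \<ge> 4 \<longrightarrow> 0 < \<theta> \<longrightarrow> \<theta> \<le> 1 \<longrightarrow>
              (\<exists>m::nat. 1 \<le> m \<and> real m \<le> Cp * (real k / \<theta>) powr (max 1 (p * \<theta> / 2)) \<and>
                 embeds_with_distortion C (Rn k) (snowflake_dist \<theta> k) (Rn m) (lp_dist p m))))))"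
proof (intro conjI, goal_cases)
  case 1
  show ?case
  proof (intro allI impI)
    fix p \<theta> D :: real and k m :: nat and M :: "(nat \<Rightarrow> real) set"
    assume h: "p \<ge> 1" "k \<ge> 4" "0 < \<theta>" "\<theta> \<le> 1"
      "eps_dense (1 / sqrt (real k)) M (unit_sphere k) (lp_dist 2 k)" "D \<ge> 1"
      and emb: "embeds_with_distortion D M (snowflake_dist \<theta> k) (Rn m) (lp_dist p m)"
    from emb obtain f s where f: "s > 0"
      "\<And>x y. x \<in> M \<Longrightarrow> y \<in> M \<Longrightarrow> s * snowflake_dist \<theta> k x y \<le> lp_dist p m (f x) (f y)"
      "\<And>x y. x \<in> M \<Longrightarrow> y \<in> M \<Longrightarrow> lp_dist p m (f x) (f y) \<le> D * s * snowflake_dist \<theta> k x y"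
      unfolding embeds_with_distortion_def by blast
    interpret sphere_embedding p \<theta> D s k m M f
      by unfold_locales (use h f in \<open>auto simp: snowflake_dist_def\<close>)
    show "real m \<ge> 1 / (4 * D) powr p *
          (real k / (2 * p * \<theta> * ln (real k) + 8)) powr (p * \<theta> / 2)"
      by (rule dimension_lower_bound)
  qed
next
  case 2
  have C: "1 \<le> (33 * 384 * 64 * 55296000 :: real)" by simp
  have Cp: "0 < 192 * (2 * 768 powr p + 589824)" for p :: real by (simp add: add_pos_pos)
  have "\<exists>m. 1 \<le> m \<and> real m \<le> 192 * (2 * 768 powr p + 589824) * (real k / \<theta>) powr (max 1 (p * \<theta> / 2)) \<and>
      embeds_with_distortion (33 * 384 * 64 * 55296000) (Rn k) (snowflake_dist \<theta> k) (Rn m) (lp_dist p m)"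
    if "p \<ge> 1" "k \<ge> 4" "0 < \<theta>" "\<theta> \<le> 1" for p \<theta> and k :: nat
    by (rule snowflake_embedding) (use that in auto)
  with C Cp show ?case by blast
qed

end
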